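(* Let $A\in\mathcal B(\mathcal Y)$. For any $f\in\mathcal{SH}_L(\sigma_S(A))$, the integral $$f(A):=\frac1{2\pi}\int_{\partial(U\cap\mathbb C_J)}S_L^{-1}(s,A)\,ds_J\,f(s)$$ is independent of the choice of the imaginary unit $J\in\mathbb S$ and of the choice of the bounded slice Cauchy domain $U\subset\mathcal W_{\mathcal F}$ with $\sigma_S(A)\subset U$ and $\overline U\subset\mathrm{dom}(f)$. Similarly, for any $f\in\mathcal{SH}_R(\sigma_S(A))$, the integral $$f(A):=\frac1{2\pi}\int_{\partial(U\cap\mathbb C_J)}f(s)\,ds_J\,S_R^{-1}(s,A)$$ is independent of the choice of such $U$ and of $J\in\mathbb S$.
   Context: Algebra: $\mathcal F$ is a nontrivial, finite-dimensional, associative real algebra with unit $1$ (multiples of $1$ are identified with real numbers) and a fixed real basis $u_1=1,u_2,\dots,u_N$; for $a=\sum_\ell a_\ell u_\ell$ put $[a]_0=a_1$. It is equipped with an anti-involution $\bar\cdot$ (an involution with $\overline{ab}=\bar b\,\bar a$) fixing $\mathbb R$, such that $[a\bar a]_0\ge 0$ with equality iff $a=0$ and such that $\|a\|=([a\bar a]_0)^{1/2}$ is a norm. The set $\mathbb S=\{s\in\mathcal F: s\bar s\in\mathbb R,\ s^2=-1\}$ is assumed nonempty. For $J\in\mathbb S$, $\mathbb C_J=\{u+Jv:u,v\in\mathbb R\}$, and the weak cone is $\mathcal W_{\mathcal F}=\bigcup_{J\in\mathbb S}\mathbb C_J$. One has $\bar J=-J$ for $J\in\mathbb S$, so for $s=u+Jv\in\mathcal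 W_{\mathcal F}$: $\bar s=u-Jv$, $\mathrm{Re}(s)=\frac12(s+\bar s)=u$, $|s|=\sqrt{s\bar s}=\|s\|$. Operators: $\mathcal Y$ is a two-sided Banach module over $\mathcal F$, i.e. a complete normed two-sided $\mathcal F$-module with $\|ys\|\le\|y\|\|s\|$ and $\|sy\|\le\|y\|\|s\|$. $\mathcal B(\mathcal Y)$ is the space of all bounded right-linear (or of all bounded left-linear) operators on $\mathcal Y$ with norm $\|A\|=\sup_{\|v\|=1}\|Av\|$; it is assumed to be a two-sided Banach algebra over $\mathcal F$: it has a product of operators with unit $\mathcal I$, and a compatible two-sided $\mathcal F$-module structure ($a(AB)=(aA)B$, $(Aa)B=A(aB)$, $(AB)a=A(Ba)$, $a\mathcal I=\mathcal I a$, norm inequalities with constant $1$). For right-linear operators the product is composition, $(aA)(v)=a(Av)$ and $(Aa)(v)=A(av)$. $S$-spectrum: for $s\in\mathcal W_{\mathcal F}$, $\mathcal Q_s(A)=A^2-2\mathrm{Re}(s)A+|s|^2\mathcal I$; $\rho_S(A)=\{s\in\mathcal W_{\mathcal F}:\mathcal Q_s(A)\text{ is invertible in }\mathcal B(\mathcal Y)\}$, $\sigma_S(A)=\mathcal W_{\mathcal F}\setminus\rho_S(A)$. For $s\in\rho_S(A)$: $S_L^{-1}(s,A)=-\mathcal Q_s(A)^{-1}(A-\bar s\,\mathcal I)$ and $S_R^{-1}(s,A)=-(A-\bar s\,\mathcal I)\mathcal Q_s(A)^{-1}$. Functions: axially symmetric open sets are sets $U=\{u+Jv:(u,v)\in\mathcal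 U,\ J\in\mathbb S\}$ with $\mathcal U\subseteq\mathbb R^2$ open (invariant under $(u,v)\mapsto(u,-v)$). A function $f:U\to\mathcal F$ is left (resp. right) slice hyperholomorphic if $f(u+Jv)=f_0(u,v)+Jf_1(u,v)$ (resp. $f_0(u,v)+f_1(u,v)J$) for all $u+Jv\in U$, where $f_0,f_1:\mathcal U\to\mathcal F$ are $C^1$, $f_0(u,-v)=f_0(u,v)$, $f_1(u,-v)=-f_1(u,v)$, $\partial_uf_0=\partial_vf_1$, $\partial_vf_0=-\partial_uf_1$. $\mathcal{SH}_L(\sigma_S(A))$ (resp. $\mathcal{SH}_R(\sigma_S(A))$) is the set of left (resp. right) slice hyperholomorphic functions $f$ whose domain $\mathrm{dom}(f)$, an axially symmetric open set, contains $\sigma_S(A)$. A slice Cauchy domain is an axially symmetric open set $U$ such that for every $J\in\mathbb S$ the boundary $\partial(U\cap\mathbb C_J)$ is a finite union of non-intersecting piecewise $C^1$ Jordan curves in $\mathbb C_J$ (positively oriented in integrals). $ds_J=ds(-J)$. *)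

theory Defs
  imports "HOL-Complex_Analysis.Complex_Analysis"
begin

section \<open>The algebra, its imaginary units and its weak cone\<close>

text \<open>
  The ambient algebra is a type. Its norm is the one of the type class \<open>real_normed_vector\<close>
  (which makes it a norm and fixes the topology), tied by \<open>norm_conjg\<close> to the anti-involution.
  It is deliberately \<^emph>\<open>not\<close> required to be submultiplicative. Nontriviality is \<open>0 \<noteq> 1\<close>,
  inherited from \<open>real_algebra_1\<close>.

  The distinguished basis is a finite set \<open>ubasis\<close> that contains \<open>1\<close>. Inside a class
  specification the constants \<open>span\<close>, \<open>independent\<close>, \<open>representation\<close>, \<open>of_real\<close> and \<open>\<real>\<close> are
  not available, so they are written out: in the assumptions on \<open>a * conjg a\<close> the family \<open>c\<close>
  consists of its coordinates, so that \<open>c 1\<close> is \<open>[a * conjg a]\<^sub>0\<close>, and \<open>r *\<^sub>R 1\<close> is the real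
  number \<open>r\<close> as an element of the algebra.
\<close>

class weak_cone_algebra = real_algebra_1 + real_normed_vector +
  fixes ubasis :: "'a set"
    and conjg :: "'a \<Rightarrow> 'a"
  assumes finite_ubasis: "finite ubasis"
    and ubasis_independent: "(\<Sum>u\<in>ubasis. c u *\<^sub>R u) = 0 \<Longrightarrow> u \<in> ubasis \<Longrightarrow> c u = 0"
    and ubasis_spans: "\<exists>c. a = (\<Sum>u\<in>ubasis. c u *\<^sub>R u)"
    and one_in_ubasis: "1 \<in> ubasis"
    and conjg_add: "conjg (a + b) = conjg a + conjg b"
    and conjg_conjg: "conjg (conjg a) = a"
    and conjg_mult: "conjg (a * b) = conjg b * conjg a"
    and conjg_real: "conjg (r *\<^sub>R 1) = r *\<^sub>R 1"
    and coord_nonneg: "a * conjg a = (\<Sum>u\<in>ubasis. c u *\<^sub>R u) \<Longrightarrow> c 1 \<ge> 0"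
    and coord_eq_0: "a * conjg a = (\<Sum>u\<in>ubasis. c u *\<^sub>R u) \<Longrightarrow> c 1 = 0 \<longleftrightarrow> a = 0"
    and norm_conjg: "a * conjg a = (\<Sum>u\<in>ubasis. c u *\<^sub>R u) \<Longrightarrow> norm a = sqrt (c 1)"
    and imag_unit_exists: "\<exists>s. (\<exists>r. s * conjg s = r *\<^sub>R 1) \<and> s * s = - 1"

lemma independent_ubasis: "independent (ubasis :: 'f::weak_cone_algebra set)"
  unfolding independent_explicit_finite_subsets
proof (intro allI ballI impI)
  fix S :: "'f set" and c x
  assume S: "S \<subseteq> ubasis" "(\<Sum>v\<in>S. c v *\<^sub>R v) = 0" and "finite S" and x: "x \<in> S"
  have "(\<Sum>v\<in>ubasis. (if v \<in> S then c v else 0) *\<^sub>R v) = (\<Sum>v\<in>S. c v *\<^sub>R v)"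
    using S(1) by (intro sum.mono_neutral_cong_right) (auto simp: finite_ubasis)
  then have "(if x \<in> S then c x else 0) = 0"
    using S x by (intro ubasis_independent) auto
  then show "c x = 0" using x by simp
qed

lemma span_ubasis: "span (ubasis :: 'f::weak_cone_algebra set) = UNIV"
  using ubasis_spans by (auto simp: span_finite[OF finite_ubasis] image_iff)

lemma norm_eq_coord:
  fixes a :: "'f::weak_cone_algebra"
  shows "norm a = sqrt (representation ubasis (a * conjg a) 1)"
proof (rule norm_conjg)
  have "(\<Sum>v\<in>ubasis. representation ubasis (a * conjg a) v *\<^sub>R v) = a * conjg a"
    by (rule real_vector.sum_representation_eq) (auto simp: independent_ubasis span_ubasis finite_ubasis)
  then show "a * conjg a = (\<Sum>u\<in>ubasis. representation ubasis (a * conjg a) u *\<^sub>R u)" ..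
qed

definition imag_units :: "'f::weak_cone_algebra set" where
  "imag_units = {s. s * conjg s \<in> \<real> \<and> s ^ 2 = - 1}"

definition slice_point :: "'f::weak_cone_algebra \<Rightarrow> real \<Rightarrow> real \<Rightarrow> 'f" where
  "slice_point J u v = of_real u + J * of_real v"

definition slice_plane :: "'f::weak_cone_algebra \<Rightarrow> 'f set" where
  "slice_plane J = {slice_point J u v | u v. True}"

definition weak_cone :: "'f::weak_cone_algebra set" where
  "weak_cone = (\<Union>J\<in>imag_units. slice_plane J)"

definition cone_Re :: "'f::weak_cone_algebra \<Rightarrow> 'f" where
  "cone_Re s = (1/2) *\<^sub>R (s + conjg s)"


section \<open>Modules and operators\<close>

locale two_sided_banach_module =
  fixes lact :: "'f::weak_cone_algebra \<Rightarrow> 'y::banach \<Rightarrow> 'y"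
    and ract :: "'y \<Rightarrow> 'f \<Rightarrow> 'y"
  assumes lact_add_right: "lact a (x + y) = lact a x + lact a y"
    and lact_add_left: "lact (a + b) x = lact a x + lact b x"
    and lact_mult: "lact (a * b) x = lact a (lact b x)"
    and lact_of_real: "lact (of_real r) x = r *\<^sub>R x"
    and ract_add_left: "ract (x + y) a = ract x a + ract y a"
    and ract_add_right: "ract x (a + b) = ract x a + ract x b"
    and ract_mult: "ract x (a * b) = ract (ract x a) b"
    and ract_of_real: "ract x (of_real r) = r *\<^sub>R x"
    and lact_ract: "ract (lact a x) b = lact a (ract x b)"
    and norm_lact: "norm (lact a x) \<le> norm x * norm a"
    and norm_ract: "norm (ract x a) \<le> norm x * norm a"

definition right_linear_ops :: "('y::real_normed_vector \<Rightarrow> 'f \<Rightarrow> 'y) \<Rightarrow> ('y \<Rightarrow>\<^sub>L 'y) set" where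
  "right_linear_ops ract = {A. \<forall>v a. blinfun_apply A (ract v a) = ract (blinfun_apply A v) a}"

definition left_linear_ops :: "('f \<Rightarrow> 'y::real_normed_vector \<Rightarrow> 'y) \<Rightarrow> ('y \<Rightarrow>\<^sub>L 'y) set" where
  "left_linear_ops lact = {A. \<forall>a v. blinfun_apply A (lact a v) = lact a (blinfun_apply A v)}"

text \<open>
  The data of the operator space \<open>\<B>(\<Y>)\<close>: the set of operators, their product, and
  the left and right multiplication of an operator by an element of the algebra.
\<close>

record ('f, 'o) op_structure =
  ops :: "'o set"
  op_mult :: "'o \<Rightarrow> 'o \<Rightarrow> 'o"
  op_lscale :: "'f \<Rightarrow> 'o \<Rightarrow> 'o"
  op_rscale :: "'o \<Rightarrow> 'f \<Rightarrow> 'o"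

text \<open>
  For right-linear operators the operations are the concrete ones. For left-linear operators
  the product and the module structure are only required to satisfy the axioms below; an example
  is \<open>AB = B \<circ> A\<close>, \<open>(aA)(v) = A(va)\<close>, \<open>(Aa)(v) = A(v)a\<close>.
  Closedness of \<open>ops B\<close> under addition and limits follows from \<open>ops_cases\<close>.
\<close>

locale operator_algebra = two_sided_banach_module lact ract
  for lact :: "'f::weak_cone_algebra \<Rightarrow> 'y::banach \<Rightarrow> 'y"
    and ract :: "'y \<Rightarrow> 'f \<Rightarrow> 'y" +
  fixes B :: "('f, 'y \<Rightarrow>\<^sub>L 'y) op_structure"
  assumes ops_cases:
      "(ops B = right_linear_ops ract \<and>
        (\<forall>S\<in>ops B. \<forall>T\<in>ops B. op_mult B S T = S o\<^sub>L T) \<and>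
        (\<forall>a. \<forall>T\<in>ops B. \<forall>v. blinfun_apply (op_lscale B a T) v = lact a (blinfun_apply T v)) \<and>
        (\<forall>a. \<forall>T\<in>ops B. \<forall>v. blinfun_apply (op_rscale B T a) v = blinfun_apply T (lact a v)))
       \<or> ops B = left_linear_ops lact"
    and mult_closed: "\<lbrakk>S \<in> ops B; T \<in> ops B\<rbrakk> \<Longrightarrow> op_mult B S T \<in> ops B"
    and lscale_closed: "T \<in> ops B \<Longrightarrow> op_lscale B a T \<in> ops B"
    and rscale_closed: "T \<in> ops B \<Longrightarrow> op_rscale B T a \<in> ops B"
    \<comment> \<open>Banach algebra with unit the identity operator\<close>
    and mult_assoc: "\<lbrakk>R \<in> ops B; S \<in> ops B; T \<in> ops B\<rbrakk>
      \<Longrightarrow> op_mult B (op_mult B R S) T = op_mult B R (op_mult B S T)"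
    and mult_add_left: "\<lbrakk>R \<in> ops B; S \<in> ops B; T \<in> ops B\<rbrakk>
      \<Longrightarrow> op_mult B (R + S) T = op_mult B R T + op_mult B S T"
    and mult_add_right: "\<lbrakk>R \<in> ops B; S \<in> ops B; T \<in> ops B\<rbrakk>
      \<Longrightarrow> op_mult B R (S + T) = op_mult B R S + op_mult B R T"
    and mult_id_left: "T \<in> ops B \<Longrightarrow> op_mult B id_blinfun T = T"
    and mult_id_right: "T \<in> ops B \<Longrightarrow> op_mult B T id_blinfun = T"
    and norm_mult: "\<lbrakk>S \<in> ops B; T \<in> ops B\<rbrakk> \<Longrightarrow> norm (op_mult B S T) \<le> norm S * norm T"
    \<comment> \<open>two-sided module structure\<close>
    and lscale_add_right: "\<lbrakk>S \<in> ops B; T \<in> ops B\<rbrakk>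
      \<Longrightarrow> op_lscale B a (S + T) = op_lscale B a S + op_lscale B a T"
    and lscale_add_left: "T \<in> ops B \<Longrightarrow> op_lscale B (a + b) T = op_lscale B a T + op_lscale B b T"
    and lscale_mult: "T \<in> ops B \<Longrightarrow> op_lscale B (a * b) T = op_lscale B a (op_lscale B b T)"
    and lscale_of_real: "T \<in> ops B \<Longrightarrow> op_lscale B (of_real r) T = r *\<^sub>R T"
    and rscale_add_left: "\<lbrakk>S \<in> ops B; T \<in> ops B\<rbrakk>
      \<Longrightarrow> op_rscale B (S + T) a = op_rscale B S a + op_rscale B T a"
    and rscale_add_right: "T \<in> ops B \<Longrightarrow> op_rscale B T (a + b) = op_rscale B T a + op_rscale B T b"
    and rscale_mult: "T \<in> ops B \<Longrightarrow> op_rscale B T (a * b) = op_rscale B (op_rscale B T a) b"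
    and rscale_of_real: "T \<in> ops B \<Longrightarrow> op_rscale B T (of_real r) = r *\<^sub>R T"
    and lscale_rscale: "T \<in> ops B
      \<Longrightarrow> op_rscale B (op_lscale B a T) b = op_lscale B a (op_rscale B T b)"
    and norm_lscale: "T \<in> ops B \<Longrightarrow> norm (op_lscale B a T) \<le> norm T * norm a"
    and norm_rscale: "T \<in> ops B \<Longrightarrow> norm (op_rscale B T a) \<le> norm T * norm a"
    \<comment> \<open>compatibility of the product with the module structure\<close>
    and lscale_op_mult: "\<lbrakk>S \<in> ops B; T \<in> ops B\<rbrakk>
      \<Longrightarrow> op_lscale B a (op_mult B S T) = op_mult B (op_lscale B a S) T"
    and rscale_mid: "\<lbrakk>S \<in> ops B; T \<in> ops B\<rbrakk>
      \<Longrightarrow> op_mult B (op_rscale B S a) T = op_mult B S (op_lscale B a T)"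
    and rscale_op_mult: "\<lbrakk>S \<in> ops B; T \<in> ops B\<rbrakk>
      \<Longrightarrow> op_rscale B (op_mult B S T) a = op_mult B S (op_rscale B T a)"
    and scale_id: "op_lscale B a id_blinfun = op_rscale B id_blinfun a"


section \<open>The \<open>S\<close>-spectrum and the \<open>S\<close>-resolvent operators\<close>

definition Q_op :: "('f::weak_cone_algebra, 'y::real_normed_vector \<Rightarrow>\<^sub>L 'y) op_structure
    \<Rightarrow> 'f \<Rightarrow> ('y \<Rightarrow>\<^sub>L 'y) \<Rightarrow> ('y \<Rightarrow>\<^sub>L 'y)" where
  "Q_op B s A = op_mult B A A - op_lscale B (2 *\<^sub>R cone_Re s) A + (norm s)\<^sup>2 *\<^sub>R id_blinfun"

definition is_op_inverse :: "('f, 'y::real_normed_vector \<Rightarrow>\<^sub>L 'y) op_structure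
    \<Rightarrow> ('y \<Rightarrow>\<^sub>L 'y) \<Rightarrow> ('y \<Rightarrow>\<^sub>L 'y) \<Rightarrow> bool" where
  "is_op_inverse B T R \<longleftrightarrow>
     R \<in> ops B \<and> op_mult B T R = id_blinfun \<and> op_mult B R T = id_blinfun"

definition op_inv :: "('f, 'y::real_normed_vector \<Rightarrow>\<^sub>L 'y) op_structure
    \<Rightarrow> ('y \<Rightarrow>\<^sub>L 'y) \<Rightarrow> ('y \<Rightarrow>\<^sub>L 'y)" where
  "op_inv B T = (THE R. is_op_inverse B T R)"

definition S_resolvent_set :: "('f::weak_cone_algebra, 'y::real_normed_vector \<Rightarrow>\<^sub>L 'y) op_structure
    \<Rightarrow> ('y \<Rightarrow>\<^sub>L 'y) \<Rightarrow> 'f set" where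
  "S_resolvent_set B A = {s \<in> weak_cone. \<exists>R. is_op_inverse B (Q_op B s A) R}"

definition S_spectrum :: "('f::weak_cone_algebra, 'y::real_normed_vector \<Rightarrow>\<^sub>L 'y) op_structure
    \<Rightarrow> ('y \<Rightarrow>\<^sub>L 'y) \<Rightarrow> 'f set" where
  "S_spectrum B A = weak_cone - S_resolvent_set B A"

definition S_resolvent_L :: "('f::weak_cone_algebra, 'y::real_normed_vector \<Rightarrow>\<^sub>L 'y) op_structure
    \<Rightarrow> 'f \<Rightarrow> ('y \<Rightarrow>\<^sub>L 'y) \<Rightarrow> ('y \<Rightarrow>\<^sub>L 'y)" where
  "S_resolvent_L B s A =
     - op_mult B (op_inv B (Q_op B s A)) (A - op_lscale B (conjg s) id_blinfun)"

definition S_resolvent_R :: "('f::weak_cone_algebra, 'y::real_normed_vector \<Rightarrow>\<^sub>L 'y) op_structure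
    \<Rightarrow> 'f \<Rightarrow> ('y \<Rightarrow>\<^sub>L 'y) \<Rightarrow> ('y \<Rightarrow>\<^sub>L 'y)" where
  "S_resolvent_R B s A =
     - op_mult B (A - op_lscale B (conjg s) id_blinfun) (op_inv B (Q_op B s A))"


section \<open>Slice hyperholomorphic functions\<close>

definition axial_base :: "(real \<times> real) set \<Rightarrow> bool" where
  "axial_base V \<longleftrightarrow> open V \<and> (\<forall>u v. (u, v) \<in> V \<longrightarrow> (u, - v) \<in> V)"

definition axial_set :: "(real \<times> real) set \<Rightarrow> 'f::weak_cone_algebra set" where
  "axial_set V = {slice_point J u v | J u v. J \<in> imag_units \<and> (u, v) \<in> V}"

definition axially_symmetric_open :: "'f::weak_cone_algebra set \<Rightarrow> bool" where
  "axially_symmetric_open U \<longleftrightarrow> (\<exists>V. axial_base V \<and> U = axial_set V)"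

text \<open>\<open>g\<close> is \<open>C\<^sup>1\<close> on \<open>V\<close>, with partial derivatives \<open>gu\<close> and \<open>gv\<close>.\<close>

definition C1_with_partials :: "(real \<times> real) set \<Rightarrow> (real \<times> real \<Rightarrow> 'f::real_normed_vector)
    \<Rightarrow> (real \<times> real \<Rightarrow> 'f) \<Rightarrow> (real \<times> real \<Rightarrow> 'f) \<Rightarrow> bool" where
  "C1_with_partials V g gu gv \<longleftrightarrow>
     continuous_on V gu \<and> continuous_on V gv \<and>
     (\<forall>p\<in>V. (g has_derivative (\<lambda>(h, k). h *\<^sub>R gu p + k *\<^sub>R gv p)) (at p))"

definition slice_pair :: "(real \<times> real) set \<Rightarrow> (real \<times> real \<Rightarrow> 'f::real_normed_vector)
    \<Rightarrow> (real \<times> real \<Rightarrow> 'f) \<Rightarrow> bool" where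
  "slice_pair V f0 f1 \<longleftrightarrow>
     (\<forall>u v. (u, v) \<in> V \<longrightarrow> f0 (u, - v) = f0 (u, v) \<and> f1 (u, - v) = - f1 (u, v)) \<and>
     (\<exists>f0u f0v f1u f1v. C1_with_partials V f0 f0u f0v \<and> C1_with_partials V f1 f1u f1v \<and>
        (\<forall>p\<in>V. f0u p = f1v p \<and> f0v p = - f1u p))"

definition left_slice_hyperholomorphic_on ::
    "'f::weak_cone_algebra set \<Rightarrow> ('f \<Rightarrow> 'f) \<Rightarrow> bool" where
  "left_slice_hyperholomorphic_on U f \<longleftrightarrow>
     (\<exists>V f0 f1. axial_base V \<and> U = axial_set V \<and> slice_pair V f0 f1 \<and>
        (\<forall>J\<in>imag_units. \<forall>u v. (u, v) \<in> V \<longrightarrow>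
           f (slice_point J u v) = f0 (u, v) + J * f1 (u, v)))"

definition right_slice_hyperholomorphic_on ::
    "'f::weak_cone_algebra set \<Rightarrow> ('f \<Rightarrow> 'f) \<Rightarrow> bool" where
  "right_slice_hyperholomorphic_on U f \<longleftrightarrow>
     (\<exists>V f0 f1. axial_base V \<and> U = axial_set V \<and> slice_pair V f0 f1 \<and>
        (\<forall>J\<in>imag_units. \<forall>u v. (u, v) \<in> V \<longrightarrow>
           f (slice_point J u v) = f0 (u, v) + f1 (u, v) * J))"

text \<open>A function with domain \<open>D\<close> is encoded as a pair \<open>(D, f)\<close> with \<open>f\<close> total; only values on \<open>D\<close> matter.\<close>

definition SH_L :: "'f::weak_cone_algebra set \<Rightarrow> ('f set \<times> ('f \<Rightarrow> 'f)) set" where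
  "SH_L K = {(D, f). left_slice_hyperholomorphic_on D f \<and> K \<subseteq> D}"

definition SH_R :: "'f::weak_cone_algebra set \<Rightarrow> ('f set \<times> ('f \<Rightarrow> 'f)) set" where
  "SH_R K = {(D, f). right_slice_hyperholomorphic_on D f \<and> K \<subseteq> D}"


section \<open>Slice Cauchy domains\<close>

text \<open>
  For \<open>J \<in> imag_units\<close> the plane \<open>slice_plane J\<close> is identified with \<^typ>\<open>complex\<close> through
  \<open>in_slice J\<close>. Boundaries of slices are boundaries relative to this plane (in the whole algebra
  a slice has empty interior as soon as the dimension exceeds 2), so slices and the curves
  bounding them are written in the coordinate \<^typ>\<open>complex\<close>.
\<close>

definition in_slice :: "'f::weak_cone_algebra \<Rightarrow> complex \<Rightarrow> 'f" where
  "in_slice J z = slice_point J (Re z) (Im z)"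

definition slice_of :: "'f::weak_cone_algebra \<Rightarrow> 'f set \<Rightarrow> complex set" where
  "slice_of J U = {z. in_slice J z \<in> U}"

text \<open>\<open>valid_path\<close> means piecewise \<open>C\<^sup>1\<close>.\<close>

definition jordan_boundary :: "(real \<Rightarrow> complex) list \<Rightarrow> complex set \<Rightarrow> bool" where
  "jordan_boundary \<gamma>s V \<longleftrightarrow>
     (\<forall>\<gamma>\<in>set \<gamma>s. valid_path \<gamma> \<and> simple_path \<gamma> \<and> pathfinish \<gamma> = pathstart \<gamma>) \<and>
     (\<forall>i<length \<gamma>s. \<forall>j<length \<gamma>s. i \<noteq> j \<longrightarrow>
        path_image (\<gamma>s ! i) \<inter> path_image (\<gamma>s ! j) = {}) \<and>
     frontier V = (\<Union>\<gamma>\<in>set \<gamma>s. path_image \<gamma>)"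

definition slice_cauchy_domain :: "'f::weak_cone_algebra set \<Rightarrow> bool" where
  "slice_cauchy_domain U \<longleftrightarrow>
     axially_symmetric_open U \<and> (\<forall>J\<in>imag_units. \<exists>\<gamma>s. jordan_boundary \<gamma>s (slice_of J U))"

text \<open>
  Positive orientation of the boundary of a bounded open set in the plane: in total, the boundary
  curves wind once around the points of the set and do not wind around the points outside its
  closure (so outer curves run counterclockwise and inner ones clockwise).
\<close>

definition positively_oriented_boundary :: "(real \<Rightarrow> complex) list \<Rightarrow> complex set \<Rightarrow> bool" where
  "positively_oriented_boundary \<gamma>s V \<longleftrightarrow>
     jordan_boundary \<gamma>s V \<and>
     (\<forall>z\<in>V. (\<Sum>\<gamma>\<leftarrow>\<gamma>s. winding_number \<gamma> z) = 1) \<and>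
     (\<forall>z. z \<notin> closure V \<longrightarrow> (\<Sum>\<gamma>\<leftarrow>\<gamma>s. winding_number \<gamma> z) = 0)"

text \<open>
  The admissible choices: an imaginary unit \<open>J\<close>, a bounded slice Cauchy domain \<open>U\<close> with
  \<open>K \<subseteq> U\<close> and \<open>closure U \<subseteq> D\<close>, and a positively oriented parametrization \<open>\<gamma>s\<close> of
  \<open>\<partial>(U \<inter> slice_plane J)\<close>.
\<close>

definition admissible_choice :: "'f::weak_cone_algebra set \<Rightarrow> 'f set
    \<Rightarrow> 'f \<Rightarrow> 'f set \<Rightarrow> (real \<Rightarrow> complex) list \<Rightarrow> bool" where
  "admissible_choice K D J U \<gamma>s \<longleftrightarrow>
     J \<in> imag_units \<and>
     slice_cauchy_domain U \<and> bounded U \<and> U \<subseteq> weak_cone \<and> K \<subseteq> U \<and> closure U \<subseteq> D \<and>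
     positively_oriented_boundary \<gamma>s (slice_of J U)"


section \<open>The integrals of the \<open>S\<close>-functional calculus\<close>

text \<open>\<open>ds\<^sub>J = ds (-J)\<close> along the curve \<open>in_slice J \<circ> \<gamma>\<close> at parameter \<open>t\<close>, without the factor \<open>dt\<close>.\<close>

definition ds_J :: "'f::weak_cone_algebra \<Rightarrow> (real \<Rightarrow> complex) \<Rightarrow> real \<Rightarrow> 'f" where
  "ds_J J \<gamma> t = in_slice J (vector_derivative \<gamma> (at t within {0..1})) * (- J)"

definition L_integrand :: "('f::weak_cone_algebra, 'y::real_normed_vector \<Rightarrow>\<^sub>L 'y) op_structure
    \<Rightarrow> ('y \<Rightarrow>\<^sub>L 'y) \<Rightarrow> ('f \<Rightarrow> 'f) \<Rightarrow> 'f \<Rightarrow> (real \<Rightarrow> complex) \<Rightarrow> real \<Rightarrow> ('y \<Rightarrow>\<^sub>L 'y)" where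
  "L_integrand B A f J \<gamma> t =
     op_rscale B (S_resolvent_L B (in_slice J (\<gamma> t)) A) (ds_J J \<gamma> t * f (in_slice J (\<gamma> t)))"

definition R_integrand :: "('f::weak_cone_algebra, 'y::real_normed_vector \<Rightarrow>\<^sub>L 'y) op_structure
    \<Rightarrow> ('y \<Rightarrow>\<^sub>L 'y) \<Rightarrow> ('f \<Rightarrow> 'f) \<Rightarrow> 'f \<Rightarrow> (real \<Rightarrow> complex) \<Rightarrow> real \<Rightarrow> ('y \<Rightarrow>\<^sub>L 'y)" where
  "R_integrand B A f J \<gamma> t =
     op_lscale B (f (in_slice J (\<gamma> t)) * ds_J J \<gamma> t) (S_resolvent_R B (in_slice J (\<gamma> t)) A)"

definition S_calculus_L :: "('f::weak_cone_algebra, 'y::banach \<Rightarrow>\<^sub>L 'y) op_structure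
    \<Rightarrow> ('y \<Rightarrow>\<^sub>L 'y) \<Rightarrow> ('f \<Rightarrow> 'f) \<Rightarrow> 'f \<Rightarrow> (real \<Rightarrow> complex) list \<Rightarrow> ('y \<Rightarrow>\<^sub>L 'y)" where
  "S_calculus_L B A f J \<gamma>s = (1 / (2 * pi)) *\<^sub>R (\<Sum>\<gamma>\<leftarrow>\<gamma>s. integral {0..1} (L_integrand B A f J \<gamma>))"

definition S_calculus_R :: "('f::weak_cone_algebra, 'y::banach \<Rightarrow>\<^sub>L 'y) op_structure
    \<Rightarrow> ('y \<Rightarrow>\<^sub>L 'y) \<Rightarrow> ('f \<Rightarrow> 'f) \<Rightarrow> 'f \<Rightarrow> (real \<Rightarrow> complex) list \<Rightarrow> ('y \<Rightarrow>\<^sub>L 'y)" where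
  "S_calculus_R B A f J \<gamma>s = (1 / (2 * pi)) *\<^sub>R (\<Sum>\<gamma>\<leftarrow>\<gamma>s. integral {0..1} (R_integrand B A f J \<gamma>))"

end

theory Submission
  imports Defs
begin

text \<open>
  The idea is to replace the imaginary unit \<open>J\<close> by the \<open>\<i>\<close> of a complexification. For \<open>z = x + \<i> y\<close>
  the operator \<open>Q\<^sub>s(A)\<close> with \<open>s = x + J y\<close> has real coefficients, does not depend on \<open>J\<close>, and equals
  \<open>(A - z)(A - cnj z)\<close> in the complexified operator algebra. With \<open>q = Q\<^sub>s(A)\<^sup>-\<^sup>1\<close> the resolvent
  \<open>(z - A)\<^sup>-\<^sup>1\<close> is therefore \<open>R\<^sub>1 + \<i> R\<^sub>2\<close>, where \<open>R\<^sub>1 = (x - A) q\<close> and \<open>R\<^sub>2 = - y q\<close>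
  (\<open>res_re\<close>, \<open>res_im\<close>), and the left \<open>S\<close>-resolvent is the same expression with \<open>J\<close> for \<open>\<i>\<close>:
  \<open>S\<^sub>L\<^sup>-\<^sup>1(s, A) = R\<^sub>1 + R\<^sub>2 J\<close>. Likewise, expanding the two components of a left slice hyperholomorphic \<open>f\<close>
  in the basis \<open>u\<^sub>1, \<dots>, u\<^sub>N\<close> gives \<open>f(s) = \<Sum>\<^sub>l F\<^sub>l(s) u\<^sub>l\<close>, where \<open>F\<^sub>l\<close> is an ordinary holomorphic
  function with \<open>F\<^sub>l(cnj z) = cnj (F\<^sub>l z)\<close> whose values are read in \<open>\<complex>\<^sub>J\<close>.

  Multiplying out, the integrand becomes a sum of two real parts of holomorphic one-forms with values in
  the complexified operator space: one in which \<open>J\<close> does not occur at all, built from \<open>R\<^sub>1 u\<^sub>l\<close>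
  and \<open>R\<^sub>2 u\<^sub>l\<close>, and one in which \<open>J\<close> occurs only in the coefficients \<open>R\<^sub>1 J u\<^sub>l\<close> and \<open>R\<^sub>2 J u\<^sub>l\<close>. Both
  are holomorphic on the part of the base of \<open>dom f\<close> where \<open>Q\<close> is invertible. The boundaries of two
  admissible domains have the same winding numbers about every point outside that region: total winding
  number 1 about the spectrum, which lies in both domains, and 0 about the points outside \<open>dom f\<close>.
  Cauchy's theorem then shows that both integrals are independent of the domain
  (\<open>integral_form_homologous_cycles\<close>). The second form is compatible with complex conjugation, and the
  conjugate of a boundary cycle, run backwards, is homologous to the cycle itself. So its complex integral
  is purely imaginary and its real part is 0 (\<open>integral_real_symmetric_form_eq_0\<close>). What remains
  does not involve \<open>J\<close>. The right calculus is the mirror image.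

  Three pieces of analysis carry this. Vector-valued statements are reduced to scalar ones by bounded
  linear functionals, which separate points by the Hahn-Banach theorem; the same theorem gives bounded
  coordinate functionals on the finite-dimensional algebra. Cauchy's theorem is needed for several
  curves at once whose winding numbers cancel only in total (\<open>Cauchy_theorem_cycle\<close>). Finally,
  a piecewise \<open>C\<^sup>1\<close> curve in the sense of \<open>valid_path\<close> may have an unbounded derivative near a break point, so
  integrability of the integrand is not a matter of continuity: it comes from local primitives
  and the fundamental theorem of calculus (\<open>form_on_path_integrable\<close>).
\<close>

section \<open>Bounded linear functionals separate points\<close>

definition sublinear :: "('a::real_vector \<Rightarrow> real) \<Rightarrow> bool" where
  "sublinear p \<longleftrightarrow> (\<forall>x y. p (x + y) \<le> p x + p y) \<and> (\<forall>c>0. \<forall>x. p (c *\<^sub>R x) = c * p x)"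

lemma sublinearI:
  assumes "\<And>x y. p (x + y) \<le> p x + p y" and hom: "\<And>c x. c > 0 \<Longrightarrow> p (c *\<^sub>R x) \<le> c * p x"
  shows "sublinear p"
  unfolding sublinear_def
proof (intro conjI allI impI)
  fix c :: real and x assume c: "c > 0"
  have "p x \<le> (1 / c) * p (c *\<^sub>R x)"
    using hom[of "1 / c" "c *\<^sub>R x"] c by simp
  then have "c * p x \<le> p (c *\<^sub>R x)"
    using c by (simp add: field_simps)
  with hom[OF c, of x] show "p (c *\<^sub>R x) = c * p x" by simp
qed (rule assms)

lemma sublinear_add: "sublinear p \<Longrightarrow> p (x + y) \<le> p x + p y"
  and sublinear_scale: "sublinear p \<Longrightarrow> c > 0 \<Longrightarrow> p (c *\<^sub>R x) = c * p x"
  by (auto simp: sublinear_def)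

lemma sublinear_zero: "sublinear p \<Longrightarrow> p 0 = 0"
  using sublinear_scale[of p 2 0] by simp

lemma sublinear_lower: "sublinear p \<Longrightarrow> - p (- x) \<le> p x"
  using sublinear_add[of p x "- x"] sublinear_zero[of p] by simp

text \<open>
  A bound for the linear functionals \<open>\<phi> \<le> p\<close> with \<open>\<phi> x0 = p x0\<close>, because then \<open>\<phi> y = \<phi> (y + t x0) - t p x0\<close>.
  Conversely, its value at \<open>- x0\<close> is at most \<open>- p x0\<close> (take \<open>t = 1\<close>), so a linear functional below it has at
  least the value \<open>p x0\<close> at \<open>x0\<close>.
\<close>

definition lower_along :: "('a::real_vector \<Rightarrow> real) \<Rightarrow> 'a \<Rightarrow> 'a \<Rightarrow> real" where
  "lower_along p x0 y = (INF t\<in>{0..}. p (y + t *\<^sub>R x0) - t * p x0)"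

lemma lower_along_le:
  assumes p: "sublinear p" and t: "t \<ge> 0"
  shows "lower_along p x0 y \<le> p (y + t *\<^sub>R x0) - t * p x0"
  unfolding lower_along_def
proof (rule cINF_lower)
  show "bdd_below ((\<lambda>t. p (y + t *\<^sub>R x0) - t * p x0) ` {0..})"
  proof (rule bdd_belowI2)
    fix t :: real assume "t \<in> {0..}"
    then have "t * p x0 = p (t *\<^sub>R x0)"
      using sublinear_scale[OF p] sublinear_zero[OF p] by (cases "t = 0") auto
    also have "\<dots> \<le> p (y + t *\<^sub>R x0) + p (- y)"
      using sublinear_add[OF p, of "y + t *\<^sub>R x0" "- y"] by (simp add: algebra_simps)
    finally show "- p (- y) \<le> p (y + t *\<^sub>R x0) - t * p x0" by simp
  qed
qed (use t in auto)

lemma lower_along_ge: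
  assumes "\<And>t. t \<ge> 0 \<Longrightarrow> c \<le> p (y + t *\<^sub>R x0) - t * p x0"
  shows "c \<le> lower_along p x0 y"
  unfolding lower_along_def by (rule cINF_greatest) (use assms in auto)

lemma sublinear_lower_along:
  assumes p: "sublinear p"
  shows "sublinear (lower_along p x0)"
proof (rule sublinearI)
  fix x y
  have "lower_along p x0 (x + y) - (p (y + s *\<^sub>R x0) - s * p x0) \<le> p (x + t *\<^sub>R x0) - t * p x0"
    if "s \<ge> 0" "t \<ge> 0" for s t
  proof -
    have "lower_along p x0 (x + y) \<le> p ((x + y) + (t + s) *\<^sub>R x0) - (t + s) * p x0"
      using that by (intro lower_along_le[OF p]) auto
    also have "(x + y) + (t + s) *\<^sub>R x0 = (x + t *\<^sub>R x0) + (y + s *\<^sub>R x0)"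
      by (simp add: algebra_simps)
    also have "p \<dots> \<le> p (x + t *\<^sub>R x0) + p (y + s *\<^sub>R x0)"
      by (rule sublinear_add[OF p])
    finally show ?thesis by (simp add: algebra_simps)
  qed
  then have "lower_along p x0 (x + y) - (p (y + s *\<^sub>R x0) - s * p x0) \<le> lower_along p x0 x"
    if "s \<ge> 0" for s
    by (intro lower_along_ge) (use that in auto)
  then have "lower_along p x0 (x + y) - lower_along p x0 x \<le> lower_along p x0 y"
    by (intro lower_along_ge) (force simp: algebra_simps)
  then show "lower_along p x0 (x + y) \<le> lower_along p x0 x + lower_along p x0 y" by simp
next
  fix c :: real and x assume c: "c > 0"
  have "lower_along p x0 (c *\<^sub>R x) / c \<le> p (x + t *\<^sub>R x0) - t * p x0" if "t \<ge> 0" for t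
  proof -
    have "lower_along p x0 (c *\<^sub>R x) \<le> p (c *\<^sub>R x + (c * t) *\<^sub>R x0) - (c * t) * p x0"
      using that c by (intro lower_along_le[OF p]) auto
    also have "c *\<^sub>R x + (c * t) *\<^sub>R x0 = c *\<^sub>R (x + t *\<^sub>R x0)"
      by (simp add: algebra_simps)
    also have "p \<dots> = c * p (x + t *\<^sub>R x0)"
      by (rule sublinear_scale[OF p c])
    finally have "lower_along p x0 (c *\<^sub>R x) \<le> c * (p (x + t *\<^sub>R x0) - t * p x0)"
      by (simp add: algebra_simps)
    then show ?thesis
      using c by (simp add: pos_divide_le_eq mult.commute)
  qed
  then have "lower_along p x0 (c *\<^sub>R x) / c \<le> lower_along p x0 x"
    by (rule lower_along_ge)
  then show "lower_along p x0 (c *\<^sub>R x) \<le> c * lower_along p x0 x"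
    using c by (simp add: field_simps)
qed

text \<open>
  Lowering \<open>m\<close> along \<open>y\<close> cannot change a minimal \<open>m\<close>. Taking \<open>t = 1\<close> in the infimum gives
  \<open>m x + m y \<le> m (x + y)\<close>, so the subadditive \<open>m\<close> is additive.
\<close>

lemma minimal_sublinear_linear:
  assumes m: "sublinear m" and min: "\<And>p. sublinear p \<Longrightarrow> (\<And>x. p x \<le> m x) \<Longrightarrow> p = m"
  shows "linear m"
proof -
  have super: "m x + m y \<le> m (x + y)" for x y
  proof -
    have "lower_along m y = m"
      using lower_along_le[OF m, of 0 y] by (intro min sublinear_lower_along m) auto
    then show ?thesis using lower_along_le[OF m, of 1 y x] by simp
  qed
  have add: "m (x + y) = m x + m y" for x y
    using super[of x y] sublinear_add[OF m, of x y] by simp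
  have neg: "m (- x) = - m x" for x
    using add[of x "- x"] sublinear_zero[OF m] by simp
  have "m (c *\<^sub>R x) = c * m x" for c x
  proof (cases c "0::real" rule: linorder_cases)
    case less
    then have "m (- (c *\<^sub>R x)) = - c * m x"
      using sublinear_scale[OF m, of "- c" x] by simp
    then show ?thesis by (simp add: neg)
  qed (use sublinear_scale[OF m] sublinear_zero[OF m] in auto)
  then show ?thesis by (intro linearI) (auto simp: add)
qed

text \<open>
  The lower bounds that Zorn's lemma asks for. The infimum is finite because \<open>p x \<ge> - p0 (- x)\<close> for every
  member, and it is subadditive because two members of a chain have a common lower member.
\<close>

lemma sublinear_INF_chain:
  assumes "C \<noteq> {}" and sub: "\<And>p. p \<in> C \<Longrightarrow> sublinear p"
    and below: "\<And>p x. p \<in> C \<Longrightarrow> p x \<le> p0 x"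
    and chain: "\<And>p q. p \<in> C \<Longrightarrow> q \<in> C \<Longrightarrow> (\<forall>x. p x \<le> q x) \<or> (\<forall>x. q x \<le> p x)"
  shows "sublinear (\<lambda>x. INF p\<in>C. p x)" and "\<And>p x. p \<in> C \<Longrightarrow> (INF p\<in>C. p x) \<le> p x"
proof -
  have bdd: "bdd_below ((\<lambda>p. p x) ` C)" for x
  proof (rule bdd_belowI2)
    fix p assume "p \<in> C"
    then show "- p0 (- x) \<le> p x"
      using sublinear_lower[OF sub, of p x] below[of p "- x"] by simp
  qed
  show lower: "(INF p\<in>C. p x) \<le> p x" if "p \<in> C" for p x
    using that bdd by (rule cINF_lower[rotated])
  show "sublinear (\<lambda>x. INF p\<in>C. p x)"
  proof (rule sublinearI)
    fix x y
    have le: "(INF p\<in>C. p (x + y)) - q y \<le> p x" if p: "p \<in> C" and q: "q \<in> C" for p q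
    proof -
      obtain r where r: "r \<in> C" "r x \<le> p x" "r y \<le> q y"
        using chain[OF p q] p q by auto
      have "(INF p\<in>C. p (x + y)) \<le> r (x + y)" by (rule lower[OF r(1)])
      also have "\<dots> \<le> r x + r y" by (rule sublinear_add[OF sub[OF r(1)]])
      finally show ?thesis using r by simp
    qed
    have "(INF p\<in>C. p (x + y)) - q y \<le> (INF p\<in>C. p x)" if "q \<in> C" for q
      using \<open>C \<noteq> {}\<close> le[OF _ that] by (rule cINF_greatest)
    then have "(INF p\<in>C. p (x + y)) - (INF p\<in>C. p x) \<le> q y" if "q \<in> C" for q
      using that by (simp add: algebra_simps)
    then have "(INF p\<in>C. p (x + y)) - (INF p\<in>C. p x) \<le> (INF p\<in>C. p y)"
      using \<open>C \<noteq> {}\<close> by (intro cINF_greatest)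
    then show "(INF p\<in>C. p (x + y)) \<le> (INF p\<in>C. p x) + (INF p\<in>C. p y)" by simp
  next
    fix c :: real and x assume c: "c > 0"
    have "(INF p\<in>C. p (c *\<^sub>R x)) / c \<le> p x" if "p \<in> C" for p
      using lower[OF that, of "c *\<^sub>R x"] sublinear_scale[OF sub[OF that] c, of x] c
      by (simp add: field_simps)
    then have "(INF p\<in>C. p (c *\<^sub>R x)) / c \<le> (INF p\<in>C. p x)"
      using \<open>C \<noteq> {}\<close> by (intro cINF_greatest)
    then show "(INF p\<in>C. p (c *\<^sub>R x)) \<le> c * (INF p\<in>C. p x)"
      using c by (simp add: field_simps)
  qed
qed

text \<open>
  The Hahn-Banach theorem: Zorn's lemma provides a minimal sublinear functional below \<open>p0\<close>, and minimality
  forces linearity.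
\<close>

lemma exists_linear_below_sublinear:
  fixes p0 :: "'a::real_vector \<Rightarrow> real"
  assumes p0: "sublinear p0"
  obtains \<phi> where "linear \<phi>" "\<And>x. \<phi> x \<le> p0 x"
proof -
  define A where "A = {p. sublinear p \<and> (\<forall>x. p x \<le> p0 x)}"
  define P where "P = (\<lambda>p q :: 'a \<Rightarrow> real. \<forall>x. q x \<le> p x)"
  have "\<exists>m\<in>A. \<forall>p\<in>A. P m p \<longrightarrow> p = m"
  proof (rule predicate_Zorn)
    show "partial_order_on A (relation_of P A)"
      unfolding P_def
      by (rule partial_order_on_relation_ofI) (auto intro: order_trans intro!: ext order_antisym)
  next
    fix C assume C: "C \<in> Chains (relation_of P A)"
    then have CA: "C \<subseteq> A"
      by (auto simp: Chains_def relation_of_def)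
    have chain: "(\<forall>x. p x \<le> q x) \<or> (\<forall>x. q x \<le> p x)" if "p \<in> C" "q \<in> C" for p q
      using C that by (auto simp: Chains_def relation_of_def P_def)
    show "\<exists>u\<in>A. \<forall>p\<in>C. P p u"
    proof (cases "C = {}")
      case True
      then show ?thesis using p0 by (auto simp: A_def)
    next
      case False
      then obtain r where r: "r \<in> C" by auto
      note I = sublinear_INF_chain[of C p0, OF False _ _ chain]
      have I1: "sublinear (\<lambda>x. INF p\<in>C. p x)"
        by (rule I(1)) (use CA A_def in auto)
      have I2: "(INF p\<in>C. p x) \<le> p x" if "p \<in> C" for p x
        by (rule I(2)) (use CA A_def that in auto)
      have "(INF p\<in>C. p x) \<le> p0 x" for x
        using I2[OF r, of x] r CA by (force simp: A_def intro: order_trans)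
      then show ?thesis
        using I1 I2 by (intro bexI[of _ "\<lambda>x. INF p\<in>C. p x"]) (auto simp: A_def P_def)
    qed
  qed
  then obtain m where m: "m \<in> A" "\<And>p. p \<in> A \<Longrightarrow> P m p \<Longrightarrow> p = m" by blast
  have "linear m"
  proof (rule minimal_sublinear_linear)
    fix p assume "sublinear p" "\<And>x. p x \<le> m x"
    then show "p = m"
      using m(1) by (intro m(2)) (auto simp: A_def P_def intro: order_trans)
  qed (use m(1) A_def in auto)
  then show ?thesis using that m(1) by (auto simp: A_def)
qed

text \<open>
  The functional is taken below the norm lowered along \<open>x\<close>, so that it is bounded by the norm and still
  has the value \<open>norm x\<close> at \<open>x\<close>.
\<close>

lemma bounded_linear_functional_nonzero:
  fixes x :: "'a::real_normed_vector"
  assumes "x \<noteq> 0"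
  obtains \<phi> :: "'a \<Rightarrow> real" where "bounded_linear \<phi>" "\<phi> x \<noteq> 0"
proof -
  have n: "sublinear (norm :: 'a \<Rightarrow> real)"
    by (rule sublinearI) (auto simp: norm_triangle_ineq)
  obtain \<phi> where \<phi>: "linear \<phi>" "\<And>y. \<phi> y \<le> lower_along norm x y"
    using exists_linear_below_sublinear[OF sublinear_lower_along[OF n]] by blast
  have le: "\<phi> y \<le> norm y" for y
    using \<phi>(2)[of y] lower_along_le[OF n, of 0 x y] by simp
  have "\<bar>\<phi> y\<bar> \<le> norm y * 1" for y
    using le[of y] le[of "- y"] linear_neg[OF \<phi>(1), of y] by auto
  then have "bounded_linear \<phi>"
    using \<phi>(1) by (intro bounded_linear_intro[where K = 1]) (auto simp: linear_add linear_scale)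
  moreover have "\<phi> (- x) \<le> - norm x"
    using \<phi>(2)[of "- x"] lower_along_le[OF n, of 1 x "- x"] by simp
  then have "\<phi> x \<noteq> 0"
    using assms linear_neg[OF \<phi>(1), of x] by auto
  ultimately show ?thesis by (rule that)
qed

lemma eq_if_functionals_eq:
  fixes x y :: "'a::real_normed_vector"
  assumes "\<And>\<phi> :: 'a \<Rightarrow> real. bounded_linear \<phi> \<Longrightarrow> \<phi> x = \<phi> y"
  shows "x = y"
proof (rule ccontr)
  assume "x \<noteq> y"
  then obtain \<phi> :: "'a \<Rightarrow> real" where \<phi>: "bounded_linear \<phi>" "\<phi> (x - y) \<noteq> 0"
    using bounded_linear_functional_nonzero[of "x - y"] by auto
  with assms show False by (auto simp: bounded_linear.linear linear_diff)
qed

text \<open>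
  Coordinates with respect to a finite spanning set can be chosen continuous. A new element \<open>c\<close> outside the
  span of \<open>S\<close> has a nonzero remainder \<open>c - P c\<close> under the projection \<open>P\<close> defined by the functionals found so far;
  a functional \<open>\<psi>\<close> that sees this remainder yields \<open>\<psi> \<circ> (id - P)\<close>, which vanishes on the span of \<open>S\<close> but
  not at \<open>c\<close>; divided by its value at \<open>c\<close> it is the coordinate functional \<open>\<eta>\<close> of \<open>c\<close>.
\<close>

lemma bounded_coordinate_functionals:
  fixes S :: "'a::real_normed_vector set"
  assumes "finite S"
  obtains \<phi> :: "'a \<Rightarrow> 'a \<Rightarrow> real"
  where "\<And>u. bounded_linear (\<phi> u)" "\<And>x. x \<in> span S \<Longrightarrow> x = (\<Sum>u\<in>S. \<phi> u x *\<^sub>R u)"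
  using assms
proof (induction S arbitrary: thesis rule: finite_induct)
  case empty
  show ?case by (rule empty(1)[of "\<lambda>_ _. 0"]) auto
next
  case (insert c S)
  obtain \<phi> :: "'a \<Rightarrow> 'a \<Rightarrow> real" where \<phi>: "\<And>u. bounded_linear (\<phi> u)"
      "\<And>x. x \<in> span S \<Longrightarrow> x = (\<Sum>u\<in>S. \<phi> u x *\<^sub>R u)"
    using insert.IH by blast
  define P where "P x = (\<Sum>u\<in>S. \<phi> u x *\<^sub>R u)" for x
  have P: "bounded_linear P"
    unfolding P_def using \<phi>(1)
    by (intro bounded_linear_sum bounded_linear_compose[OF bounded_linear_scaleR_left]) auto
  note P_lin = bounded_linear.linear[OF P]
  have P_id: "P x = x" if "x \<in> span S" for x
    using \<phi>(2)[OF that] by (simp add: P_def)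
  have P_span: "P x \<in> span S" for x
    unfolding P_def by (intro span_sum span_scale span_base)
  show ?case
  proof (cases "c \<in> span S")
    case True
    show ?thesis
    proof (rule insert.prems[of "\<lambda>u. if u = c then (\<lambda>_. 0) else \<phi> u"])
      fix x assume "x \<in> span (insert c S)"
      then have "x \<in> span S" using span_redundant[OF True] by simp
      then have "x = (\<Sum>u\<in>S. \<phi> u x *\<^sub>R u)" by (rule \<phi>(2))
      also have "\<dots> = (\<Sum>u\<in>insert c S. (if u = c then (\<lambda>_. 0) else \<phi> u) x *\<^sub>R u)"
        using insert.hyps by (auto intro!: sum.cong)
      finally show "x = \<dots>" .
    qed (use \<phi>(1) in auto)
  next
    case False
    then have "c - P c \<noteq> 0" using P_span[of c] by auto
    then obtain \<psi> :: "'a \<Rightarrow> real" where \<psi>: "bounded_linear \<psi>" "\<psi> (c - P c) \<noteq> 0"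
      using bounded_linear_functional_nonzero by blast
    define \<eta> where "\<eta> x = \<psi> (x - P x) / \<psi> (c - P c)" for x
    have \<eta>: "bounded_linear \<eta>"
      unfolding \<eta>_def divide_inverse using P \<psi>(1)
      by (intro bounded_linear_mult_const bounded_linear_compose[OF \<psi>(1)] bounded_linear_sub
          bounded_linear_ident) auto
    have \<eta>c: "\<eta> c = 1" using \<psi>(2) by (simp add: \<eta>_def)
    have \<eta>0: "\<eta> x = 0" if "x \<in> span S" for x
      using P_id[OF that] \<psi>(1) by (simp add: \<eta>_def linear_simps)
    define \<phi>' where "\<phi>' u = (if u = c then \<eta> else (\<lambda>x. \<phi> u x - \<phi> u c * \<eta> x))" for u
    show ?thesis
    proof (rule insert.prems[of \<phi>'])
      show "bounded_linear (\<phi>' u)" for u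
        unfolding \<phi>'_def using \<phi>(1) \<eta>
        by (auto intro!: bounded_linear_sub bounded_linear_const_mult)
    next
      fix x assume "x \<in> span (insert c S)"
      then obtain k where k: "x - k *\<^sub>R c \<in> span S"
        by (auto simp: span_insert)
      have \<eta>x: "\<eta> x = k"
        using \<eta>0[OF k] \<eta>c bounded_linear.linear[OF \<eta>] by (simp add: linear_diff linear_scale)
      have "x - k *\<^sub>R c = P x - k *\<^sub>R P c"
        using P_id[OF k] P_lin by (simp add: linear_diff linear_scale)
      then have "x = k *\<^sub>R c + (P x - k *\<^sub>R P c)"
        by (metis add.commute diff_add_cancel)
      also have "P x - k *\<^sub>R P c = (\<Sum>u\<in>S. (\<phi> u x - \<phi> u c * k) *\<^sub>R u)"
        by (simp add: P_def scaleR_sum_right algebra_simps sum_subtractf)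
      also have "\<dots> = (\<Sum>u\<in>S. \<phi>' u x *\<^sub>R u)"
        using insert.hyps by (intro sum.cong) (auto simp: \<phi>'_def \<eta>x)
      also have "k *\<^sub>R c = \<phi>' c x *\<^sub>R c"
        by (simp add: \<phi>'_def \<eta>x)
      finally show "x = (\<Sum>u\<in>insert c S. \<phi>' u x *\<^sub>R u)"
        using insert.hyps by simp
    qed
  qed
qed


section \<open>Cauchy's theorem for cycles of closed curves\<close>

text \<open>
  In a connected open set, joining each curve to the next by a path that is traversed there and back
  turns a list of closed curves into a single one without changing any integral.
\<close>

lemma merge_closed_paths:
  assumes C: "open C" "connected C"
    and "\<gamma>s \<noteq> []"
    and "\<forall>\<gamma>\<in>set \<gamma>s. valid_path \<gamma> \<and> pathfinish \<gamma> = pathstart \<gamma> \<and> path_image \<gamma> \<subseteq> C"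
  obtains g where "valid_path g" "pathfinish g = pathstart g" "path_image g \<subseteq> C"
    "\<And>f. f holomorphic_on C \<Longrightarrow> contour_integral g f = (\<Sum>\<gamma>\<leftarrow>\<gamma>s. contour_integral \<gamma> f)"
  using assms(3,4)
proof (induction \<gamma>s arbitrary: thesis rule: list_nonempty_induct)
  case (single \<gamma>)
  then show ?case by force
next
  case (cons \<gamma> \<gamma>s)
  then obtain g where g: "valid_path g" "pathfinish g = pathstart g" "path_image g \<subseteq> C"
    and int: "\<And>f. f holomorphic_on C \<Longrightarrow> contour_integral g f = (\<Sum>\<gamma>\<leftarrow>\<gamma>s. contour_integral \<gamma> f)"
    by (metis list.set_intros(2))
  from cons have \<gamma>: "valid_path \<gamma>" "pathfinish \<gamma> = pathstart \<gamma>" "path_image \<gamma> \<subseteq> C" by auto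
  have "pathstart \<gamma> \<in> C" "pathstart g \<in> C"
    using g(3) \<gamma>(3) pathstart_in_path_image by blast+
  then obtain p where p: "polynomial_function p" "path_image p \<subseteq> C"
      "pathstart p = pathstart \<gamma>" "pathfinish p = pathstart g"
    using connected_open_polynomial_connected[OF C] by metis
  note vp = valid_path_polynomial_function[OF p(1)]
  \<comment> \<open>The connecting path is traversed in both directions, so its contributions cancel.\<close>
  define h where "h = \<gamma> +++ p +++ g +++ reversepath p"
  show ?case
  proof (rule cons.prems(1))
    show "valid_path h" "pathfinish h = pathstart h" "path_image h \<subseteq> C"
      unfolding h_def using g \<gamma> p vp
      by (auto intro!: valid_path_join simp: path_image_join valid_path_imp_reverse)
  next
    fix f assume f: "f holomorphic_on C"
    have [simp]: "f contour_integrable_on q" if "valid_path q" "path_image q \<subseteq> C" for q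
      using contour_integrable_holomorphic_simple[OF f C(1) that] .
    show "contour_integral h f = (\<Sum>\<gamma>\<leftarrow>\<gamma> # \<gamma>s. contour_integral \<gamma> f)"
      unfolding h_def using g \<gamma> p vp int[OF f]
      by (simp add: contour_integral_reversepath valid_path_imp_reverse path_image_join)
  qed
qed

lemma Cauchy_theorem_cycle_connected:
  assumes C: "open C" "connected C" and f: "f holomorphic_on C"
    and \<gamma>s: "\<forall>\<gamma>\<in>set \<gamma>s. valid_path \<gamma> \<and> pathfinish \<gamma> = pathstart \<gamma> \<and> path_image \<gamma> \<subseteq> C"
    and wn: "\<And>w. w \<notin> C \<Longrightarrow> (\<Sum>\<gamma>\<leftarrow>\<gamma>s. winding_number \<gamma> w) = 0"
  shows "(\<Sum>\<gamma>\<leftarrow>\<gamma>s. contour_integral \<gamma> f) = 0"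
proof (cases "\<gamma>s = []")
  case False
  obtain g where g: "valid_path g" "pathfinish g = pathstart g" "path_image g \<subseteq> C"
    and int: "\<And>f. f holomorphic_on C \<Longrightarrow> contour_integral g f = (\<Sum>\<gamma>\<leftarrow>\<gamma>s. contour_integral \<gamma> f)"
    using merge_closed_paths[OF C False \<gamma>s] by blast
  have "winding_number g w = 0" if w: "w \<notin> C" for w
  proof -
    have "(\<lambda>z. 1 / (z - w)) holomorphic_on C"
      using w by (intro holomorphic_intros) auto
    then have "contour_integral g (\<lambda>z. 1 / (z - w))
        = (\<Sum>\<gamma>\<leftarrow>\<gamma>s. contour_integral \<gamma> (\<lambda>z. 1 / (z - w)))"
      by (rule int)
    then have "winding_number g w
        = (\<Sum>\<gamma>\<leftarrow>\<gamma>s. 1 / (2 * pi * \<i>) * contour_integral \<gamma> (\<lambda>z. 1 / (z - w)))"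
      unfolding sum_list_const_mult using g w by (subst winding_number_valid_path) auto
    also have "\<dots> = (\<Sum>\<gamma>\<leftarrow>\<gamma>s. winding_number \<gamma> w)"
      using \<gamma>s w by (intro arg_cong[where f = sum_list] map_cong refl)
        (subst winding_number_valid_path; auto)
    finally show ?thesis using wn[OF w] by simp
  qed
  then have "contour_integral g f = 0"
    using Cauchy_theorem_global[OF C(1) f g] contour_integral_unique by blast
  then show ?thesis using int[OF f] by simp
qed auto

text \<open>
  When the winding numbers of a cycle in a disconnected open set cancel in total outside the set, they
  already cancel for the curves in a single component \<open>C\<close>. The remaining curves do not meet the
  connected set \<open>closure C\<close>, so their total winding number is a constant \<open>k\<close> on it; hence the curves
  in \<open>C\<close> have total winding number \<open>- k\<close> on the whole boundary of \<open>C\<close>. Every point outside \<open>C\<close>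
  is joined to that boundary by a segment outside \<open>C\<close>, and a far away point has winding number 0,
  so \<open>k = 0\<close> and the total is 0 everywhere outside \<open>C\<close>.
\<close>

lemma winding_number_sum_zero_outside_component:
  assumes C: "open C" "connected C" "bounded C" "C \<noteq> {}" and T: "open T" "T \<inter> C = {}"
    and \<gamma>s: "\<forall>\<gamma>\<in>set \<gamma>s. path \<gamma> \<and> pathfinish \<gamma> = pathstart \<gamma> \<and> path_image \<gamma> \<subseteq> C"
    and \<eta>s: "\<forall>\<eta>\<in>set \<eta>s. path \<eta> \<and> pathfinish \<eta> = pathstart \<eta> \<and> path_image \<eta> \<subseteq> T"
    and wn: "\<And>w. w \<notin> C \<union> T \<Longrightarrow>
      (\<Sum>\<gamma>\<leftarrow>\<gamma>s. winding_number \<gamma> w) + (\<Sum>\<eta>\<leftarrow>\<eta>s. winding_number \<eta> w) = 0"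
    and w: "w \<notin> C"
  shows "(\<Sum>\<gamma>\<leftarrow>\<gamma>s. winding_number \<gamma> w) = 0"
proof -
  define N where "N w = (\<Sum>\<gamma>\<leftarrow>\<gamma>s. winding_number \<gamma> w)" for w
  define M where "M w = (\<Sum>\<eta>\<leftarrow>\<eta>s. winding_number \<eta> w)" for w
  have clT: "closure C \<inter> T = {}"
    using T open_Int_closure_eq_empty[OF T(1), of C] by blast
  have M_const: "M w = M w'" if "w \<in> closure C" "w' \<in> closure C" for w w'
    unfolding M_def
  proof (intro arg_cong[where f = sum_list] map_cong refl)
    fix \<eta> assume "\<eta> \<in> set \<eta>s"
    then have "winding_number \<eta> constant_on closure C"
      using \<eta>s clT C(2) by (intro winding_number_constant connected_imp_connected_closure) auto
    then show "winding_number \<eta> w = winding_number \<eta> w'"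
      using that by (auto simp: constant_on_def)
  qed
  have N_seg: "N w = N w'" if "closed_segment w w' \<inter> C = {}" for w w'
    unfolding N_def
  proof (intro arg_cong[where f = sum_list] map_cong refl)
    fix \<gamma> assume "\<gamma> \<in> set \<gamma>s"
    then have "winding_number \<gamma> constant_on closed_segment w w'"
      using \<gamma>s that by (intro winding_number_constant connected_segment) auto
    then show "winding_number \<gamma> w = winding_number \<gamma> w'"
      using ends_in_segment by (auto simp: constant_on_def)
  qed
  have to_frontier: "\<exists>p. p \<in> closure C - C \<and> N p = N w" if w: "w \<notin> C" for w
  proof (cases "w \<in> closure C")
    case True
    then show ?thesis using w by auto
  next
    case False
    define p where "p = closest_point (closure C) w"
    have ne: "closure C \<noteq> {}" using C(4) by simp
    have p: "p \<in> closure C"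
      unfolding p_def by (rule closest_point_in_set[OF closed_closure ne])
    have open_seg: "open_segment w p \<inter> closure C = {}"
      unfolding p_def by (rule segment_to_closest_point[OF closed_closure ne])
    have "C \<inter> closure (open_segment w p) = {}"
      using open_Int_closure_eq_empty[OF C(1)] open_seg closure_subset[of C] by blast
    moreover have "p \<in> closure (open_segment w p)"
      using p False by auto
    ultimately have "p \<notin> C" by blast
    then have "closed_segment w p \<inter> C = {}"
      using w open_seg closure_subset[of C] by (auto simp: closed_segment_eq_open)
    then show ?thesis using N_seg[of w p] p \<open>p \<notin> C\<close> by auto
  qed
  have NM: "N p = - M p" if "p \<in> closure C - C" for p
    using wn[of p] that clT by (auto simp: N_def M_def eq_neg_iff_add_eq_0)
  \<comment> \<open>The constant value on the boundary of \<open>C\<close> is determined by a point far outside.\<close>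
  obtain r where r: "C \<subseteq> ball 0 r"
    using bounded_subset_ballD[OF C(3), of 0] by blast
  define far where "far = complex_of_real \<bar>r\<bar>"
  have far: "far \<notin> ball 0 r" by (simp add: far_def)
  have "\<forall>\<gamma>\<in>set \<gamma>s. winding_number \<gamma> far = 0"
    using \<gamma>s r far by (blast intro: winding_number_zero_outside[OF _ convex_ball[of 0 r]])
  then have "N far = 0"
    by (simp add: N_def cong: map_cong)
  moreover obtain p where p: "p \<in> closure C - C" "N p = N far"
    using to_frontier[of far] far r by blast
  moreover obtain q where q: "q \<in> closure C - C" "N q = N w"
    using to_frontier[OF w] by blast
  ultimately have "N w = 0"
    using NM[of p] NM[of q] M_const[of p q] by auto
  then show ?thesis by (simp add: N_def)
qed

text \<open>
  Homological form of Cauchy's theorem for finitely many closed curves, by splitting off one component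
  of \<open>S\<close> at a time.
\<close>

theorem Cauchy_theorem_cycle:
  assumes S: "open S" "bounded S" and f: "f holomorphic_on S"
    and "\<forall>\<gamma>\<in>set \<gamma>s. valid_path \<gamma> \<and> pathfinish \<gamma> = pathstart \<gamma> \<and> path_image \<gamma> \<subseteq> S"
    and "\<And>w. w \<notin> S \<Longrightarrow> (\<Sum>\<gamma>\<leftarrow>\<gamma>s. winding_number \<gamma> w) = 0"
  shows "(\<Sum>\<gamma>\<leftarrow>\<gamma>s. contour_integral \<gamma> f) = 0"
  using assms(4,5)
proof (induction "length \<gamma>s" arbitrary: \<gamma>s rule: less_induct)
  case less
  show ?case
  proof (cases "\<gamma>s = []")
    case False
    then obtain \<gamma>0 where \<gamma>0: "\<gamma>0 \<in> set \<gamma>s" by (cases \<gamma>s) auto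
    define C where "C = connected_component_set S (pathstart \<gamma>0)"
    have C: "open C" "connected C" "C \<subseteq> S"
      unfolding C_def using S by (auto simp: open_connected_component connected_component_subset)
    have start: "pathstart \<gamma>0 \<in> C"
      using less.prems(1) \<gamma>0 pathstart_in_path_image by (fastforce simp: C_def)
    have "C \<in> components S"
      using start connected_component_in by (fastforce simp: C_def components_def)
    then have "S - C = \<Union>(components S - {C})"
      using components_nonoverlap[of C S] Union_components[of S] by blast
    then have T: "open (S - C)"
      using open_components[OF S(1)] by auto
    define in_C where "in_C = (\<lambda>\<gamma> :: real \<Rightarrow> complex. path_image \<gamma> \<subseteq> C)"
    have out: "path_image \<gamma> \<subseteq> S - C" if "\<gamma> \<in> set \<gamma>s" "\<not> in_C \<gamma>" for \<gamma>
    proof (rule ccontr)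
      assume *: "\<not> path_image \<gamma> \<subseteq> S - C"
      have "path_image \<gamma> \<subseteq> S" using less.prems(1) that(1) by simp
      with * obtain x where x: "x \<in> path_image \<gamma>" "x \<in> C" by blast
      have "path_image \<gamma> \<subseteq> connected_component_set S x"
        using less.prems(1) that(1) x(1)
        by (intro connected_component_maximal connected_path_image valid_path_imp_path) simp_all
      also have "\<dots> = C"
        using connected_component_eq[of x S] x(2) unfolding C_def by simp
      finally show False using that(2) by (simp add: in_C_def)
    qed
    have "in_C \<gamma>0"
    proof (rule ccontr)
      assume "\<not> in_C \<gamma>0"
      from out[OF \<gamma>0 this] show False
        using start pathstart_in_path_image[of \<gamma>0] by auto
    qed
    let ?in = "filter in_C \<gamma>s" and ?out = "filter (\<lambda>\<gamma>. \<not> in_C \<gamma>) \<gamma>s"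
    have split: "(\<Sum>\<gamma>\<leftarrow>\<gamma>s. h \<gamma>) = (\<Sum>\<gamma>\<leftarrow>?in. h \<gamma>) + (\<Sum>\<gamma>\<leftarrow>?out. h \<gamma>)"
      for h :: "(real \<Rightarrow> complex) \<Rightarrow> complex"
      by (induction \<gamma>s) (auto simp: algebra_simps)
    have wn_in: "(\<Sum>\<gamma>\<leftarrow>?in. winding_number \<gamma> w) = 0" if "w \<notin> C" for w
    proof (rule winding_number_sum_zero_outside_component[OF C(1,2) _ _ T _ _ _ _ that])
      show "bounded C" using bounded_subset[OF S(2) C(3)] .
      show "C \<noteq> {}" using start by auto
      show "\<forall>\<gamma>\<in>set ?in. path \<gamma> \<and> pathfinish \<gamma> = pathstart \<gamma> \<and> path_image \<gamma> \<subseteq> C"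
        using less.prems(1) by (auto simp: in_C_def valid_path_imp_path)
      show "\<forall>\<gamma>\<in>set ?out. path \<gamma> \<and> pathfinish \<gamma> = pathstart \<gamma> \<and> path_image \<gamma> \<subseteq> S - C"
        using less.prems(1) out by (auto simp: valid_path_imp_path)
      show "(\<Sum>\<gamma>\<leftarrow>?in. winding_number \<gamma> w) + (\<Sum>\<gamma>\<leftarrow>?out. winding_number \<gamma> w) = 0"
        if "w \<notin> C \<union> (S - C)" for w
        using less.prems(2)[of w] that split[of "\<lambda>\<gamma>. winding_number \<gamma> w"] by auto
    qed auto
    have "(\<Sum>\<gamma>\<leftarrow>?in. contour_integral \<gamma> f) = 0"
      using less.prems(1) holomorphic_on_subset[OF f C(3)]
      by (intro Cauchy_theorem_cycle_connected[OF C(1,2)] wn_in) (auto simp: in_C_def)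
    moreover have "(\<Sum>\<gamma>\<leftarrow>?out. contour_integral \<gamma> f) = 0"
    proof (rule less.hyps)
      show "length ?out < length \<gamma>s"
        using \<gamma>0 \<open>in_C \<gamma>0\<close> by (intro length_filter_less) auto
      show "(\<Sum>\<gamma>\<leftarrow>?out. winding_number \<gamma> w) = 0" if "w \<notin> S" for w
        using less.prems(2)[OF that] split[of "\<lambda>\<gamma>. winding_number \<gamma> w"]
          wn_in[of w] subsetD[OF C(3), of w] that by fastforce
    qed (use less.prems(1) in auto)
    ultimately show ?thesis using split[of "\<lambda>\<gamma>. contour_integral \<gamma> f"] by simp
  qed auto
qed


section \<open>Holomorphic one-forms with values in a Banach space\<close>

text \<open>
  The pair \<open>a, b\<close> stands for the function \<open>a + \<i> b\<close> into the complexification of \<open>'e\<close>, and it is tested by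
  real functionals extended complex linearly.
\<close>

definition weakly_holomorphic_on ::
    "complex set \<Rightarrow> (complex \<Rightarrow> 'e::real_normed_vector) \<Rightarrow> (complex \<Rightarrow> 'e) \<Rightarrow> bool" where
  "weakly_holomorphic_on S a b \<longleftrightarrow> continuous_on S a \<and> continuous_on S b \<and>
     (\<forall>\<phi>. bounded_linear \<phi> \<longrightarrow> (\<lambda>z. Complex (\<phi> (a z)) (\<phi> (b z))) holomorphic_on S)"

text \<open>
  The real part of \<open>(a + \<i> b) h\<close>, that is, of the one-form \<open>(a + \<i> b) dz\<close> applied to the tangent vector \<open>h\<close>.
\<close>

definition real_form ::
    "(complex \<Rightarrow> 'e::real_vector) \<Rightarrow> (complex \<Rightarrow> 'e) \<Rightarrow> complex \<Rightarrow> complex \<Rightarrow> 'e" where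
  "real_form a b z h = Re h *\<^sub>R a z - Im h *\<^sub>R b z"

definition form_on_path ::
    "(complex \<Rightarrow> 'e::real_vector) \<Rightarrow> (complex \<Rightarrow> 'e) \<Rightarrow> (real \<Rightarrow> complex) \<Rightarrow> real \<Rightarrow> 'e" where
  "form_on_path a b \<gamma> t = real_form a b (\<gamma> t) (vector_derivative \<gamma> (at t within {0..1}))"

lemma functional_real_form:
  assumes "bounded_linear \<phi>"
  shows "\<phi> (real_form a b z h) = Re (Complex (\<phi> (a z)) (\<phi> (b z)) * h)"
  using bounded_linear.linear[OF assms]
  by (simp add: real_form_def linear_diff linear_scale)

lemma weakly_holomorphic_on_subset:
  "weakly_holomorphic_on T a b \<Longrightarrow> S \<subseteq> T \<Longrightarrow> weakly_holomorphic_on S a b"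
  unfolding weakly_holomorphic_on_def by (meson continuous_on_subset holomorphic_on_subset)

lemma weakly_holomorphic_on_add:
  assumes "weakly_holomorphic_on S a b" "weakly_holomorphic_on S c d"
  shows "weakly_holomorphic_on S (\<lambda>z. a z + c z) (\<lambda>z. b z + d z)"
proof -
  have "(\<lambda>z. Complex (\<phi> (a z + c z)) (\<phi> (b z + d z))) holomorphic_on S" if "bounded_linear \<phi>" for \<phi>
  proof -
    have "(\<lambda>z. Complex (\<phi> (a z)) (\<phi> (b z)) + Complex (\<phi> (c z)) (\<phi> (d z))) holomorphic_on S"
      using assms that by (intro holomorphic_intros) (auto simp: weakly_holomorphic_on_def)
    then show ?thesis
      using bounded_linear.linear[OF that] by (simp add: linear_add complex_add)
  qed
  then show ?thesis
    using assms by (auto simp: weakly_holomorphic_on_def intro!: continuous_intros)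
qed

lemma weakly_holomorphic_on_sum:
  assumes "\<And>i. i \<in> I \<Longrightarrow> weakly_holomorphic_on S (a i) (b i)"
  shows "weakly_holomorphic_on S (\<lambda>z. \<Sum>i\<in>I. a i z) (\<lambda>z. \<Sum>i\<in>I. b i z)"
  using assms
proof (induction I rule: infinite_finite_induct)
  case (insert i I)
  then show ?case by (simp add: weakly_holomorphic_on_add)
qed (auto simp: weakly_holomorphic_on_def linear_simps holomorphic_on_const)

text \<open>
  The product with a scalar holomorphic function, written in real and imaginary parts.
\<close>

lemma weakly_holomorphic_on_mult:
  assumes F: "F holomorphic_on S" and ab: "weakly_holomorphic_on S a b"
  shows "weakly_holomorphic_on S (\<lambda>z. Re (F z) *\<^sub>R a z - Im (F z) *\<^sub>R b z)
                                (\<lambda>z. Re (F z) *\<^sub>R b z + Im (F z) *\<^sub>R a z)"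
proof -
  have "(\<lambda>z. Complex (\<phi> (Re (F z) *\<^sub>R a z - Im (F z) *\<^sub>R b z))
                     (\<phi> (Re (F z) *\<^sub>R b z + Im (F z) *\<^sub>R a z))) holomorphic_on S"
    if "bounded_linear \<phi>" for \<phi>
  proof -
    have "(\<lambda>z. F z * Complex (\<phi> (a z)) (\<phi> (b z))) holomorphic_on S"
      using ab that F by (intro holomorphic_intros) (auto simp: weakly_holomorphic_on_def)
    also have "(\<lambda>z. F z * Complex (\<phi> (a z)) (\<phi> (b z)))
      = (\<lambda>z. Complex (\<phi> (Re (F z) *\<^sub>R a z - Im (F z) *\<^sub>R b z))
                     (\<phi> (Re (F z) *\<^sub>R b z + Im (F z) *\<^sub>R a z)))"
      using bounded_linear.linear[OF that]
      by (auto simp: linear_add linear_diff linear_scale complex_eq_iff)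
    finally show ?thesis .
  qed
  moreover have "continuous_on S F" using F by (rule holomorphic_on_imp_continuous_on)
  ultimately show ?thesis
    using ab by (auto simp: weakly_holomorphic_on_def intro!: continuous_intros)
qed

lemma continuous_on_real_form_linepath:
  fixes a b :: "complex \<Rightarrow> 'e::real_normed_vector"
  assumes "continuous_on S a" "continuous_on S b" "closed_segment x y \<subseteq> S"
  shows "continuous_on {0..1} (\<lambda>t. real_form a b (linepath x y t) h)"
proof -
  have "continuous_on {0..1} (\<lambda>t. c (linepath x y t))" if "continuous_on S c"
    for c :: "complex \<Rightarrow> 'e"
    using that assms(3)
    by (intro continuous_on_compose2[OF that]) (auto intro!: continuous_intros simp: linepath_in_path)
  from this[OF assms(1)] this[OF assms(2)] show ?thesis
    unfolding real_form_def
    by (intro continuous_on_diff continuous_on_scaleR continuous_on_const)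
qed

text \<open>
  The candidate is the integral of the form along the segment from a base point. By the scalar theory,
  each functional sees the integral round a triangle as 0, so the difference of two values is the integral
  along the segment between the points, and continuity of \<open>a\<close> and \<open>b\<close> gives the derivative.
\<close>

lemma weakly_holomorphic_primitive:
  fixes a b :: "complex \<Rightarrow> 'e::banach"
  assumes S: "convex S" "open S" and ab: "weakly_holomorphic_on S a b"
  obtains H where "\<And>z. z \<in> S \<Longrightarrow> (H has_derivative real_form a b z) (at z)"
proof (cases "S = {}")
  case False
  then obtain z0 where z0: "z0 \<in> S" by auto
  define I where "I x y = integral {0..1} (\<lambda>t. real_form a b (linepath x y t) (y - x))" for x y
  have cont: "continuous_on {0..1} (\<lambda>t. real_form a b (linepath x y t) h)"
    if "x \<in> S" "y \<in> S" for x y h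
    using ab closed_segment_subset[OF that S(1)]
    by (intro continuous_on_real_form_linepath) (auto simp: weakly_holomorphic_on_def)
  note integrable = integrable_continuous_real[OF cont]
  have add: "I z0 y - I z0 x = I x y" if x: "x \<in> S" and y: "y \<in> S" for x y
  proof (rule eq_if_functionals_eq)
    fix \<phi> :: "'e \<Rightarrow> real" assume \<phi>: "bounded_linear \<phi>"
    let ?G = "\<lambda>z. Complex (\<phi> (a z)) (\<phi> (b z))"
    have G: "?G holomorphic_on S" using ab \<phi> by (auto simp: weakly_holomorphic_on_def)
    then obtain P where P: "\<And>z. z \<in> S \<Longrightarrow> (P has_field_derivative ?G z) (at z within S)"
      using holomorphic_convex_primitive'[OF S] by blast
    have I: "\<phi> (I p q) = Re (P q - P p)" if "p \<in> S" "q \<in> S" for p q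
    proof -
      have "(?G has_contour_integral (P q - P p)) (linepath p q)"
        using contour_integral_primitive[of S P ?G "linepath p q"] P that S(1)
        by (simp add: closed_segment_subset)
      then have "((\<lambda>t. Re (?G (linepath p q t) * (q - p))) has_integral Re (P q - P p)) {0..1}"
        unfolding has_contour_integral_linepath
        by (rule has_integral_linear[OF _ bounded_linear_Re, unfolded o_def])
      then have *: "integral {0..1} (\<lambda>t. Re (?G (linepath p q t) * (q - p))) = Re (P q - P p)"
        by (rule integral_unique)
      have "\<phi> (I p q) = integral {0..1} (\<lambda>t. \<phi> (real_form a b (linepath p q t) (q - p)))"
        using integral_linear[OF integrable[OF that] \<phi>] by (simp only: I_def o_def)
      then show ?thesis by (simp only: functional_real_form[OF \<phi>] *)
    qed
    show "\<phi> (I z0 y - I z0 x) = \<phi> (I x y)"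
      using I x y z0 bounded_linear.linear[OF \<phi>] by (simp add: linear_diff)
  qed
  have "(I z0 has_derivative real_form a b z) (at z)" if z: "z \<in> S" for z
    unfolding has_derivative_at_alt
  proof (intro conjI allI impI)
    show "bounded_linear (real_form a b z)"
      unfolding real_form_def[abs_def]
      by (intro bounded_linear_sub bounded_linear_compose[OF bounded_linear_scaleR_left]
          bounded_linear_Re bounded_linear_Im)
    fix e :: real assume e: "e > 0"
    have "isCont a z" "isCont b z"
      using ab z S(2) by (auto simp: weakly_holomorphic_on_def continuous_on_eq_continuous_at)
    then obtain d1 d2 where d: "d1 > 0" "\<And>w. dist w z < d1 \<Longrightarrow> dist (a w) (a z) < e / 2"
        "d2 > 0" "\<And>w. dist w z < d2 \<Longrightarrow> dist (b w) (b z) < e / 2"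
      unfolding continuous_at_eps_delta using e by (metis half_gt_zero)
    obtain d3 where d3: "d3 > 0" "ball z d3 \<subseteq> S"
      using S(2) z open_contains_ball by blast
    define d where "d = min d1 (min d2 d3)"
    have close: "norm (real_form a b w h - real_form a b z h) \<le> e * norm h" if "dist w z < d" for w h
    proof -
      have "real_form a b w h - real_form a b z h = Re h *\<^sub>R (a w - a z) - Im h *\<^sub>R (b w - b z)"
        by (simp add: real_form_def algebra_simps)
      also have "norm \<dots> \<le> \<bar>Re h\<bar> * norm (a w - a z) + \<bar>Im h\<bar> * norm (b w - b z)"
        by (rule order_trans[OF norm_triangle_ineq4]) simp
      also have "\<dots> \<le> norm h * (e / 2) + norm h * (e / 2)"
        using d(2)[of w] d(4)[of w] that
        by (intro add_mono mult_mono abs_Re_le_cmod abs_Im_le_cmod)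
          (auto simp: d_def dist_norm)
      finally show ?thesis by (simp add: algebra_simps)
    qed
    show "\<exists>d>0. \<forall>y. norm (y - z) < d \<longrightarrow>
        norm (I z0 y - I z0 z - real_form a b z (y - z)) \<le> e * norm (y - z)"
    proof (intro exI[of _ d] conjI allI impI)
      show "d > 0" using d d3 by (simp add: d_def)
      fix y assume y: "norm (y - z) < d"
      have yS: "y \<in> S" using y d3 by (auto simp: d_def dist_norm norm_minus_commute)
      let ?f = "\<lambda>t. real_form a b (linepath z y t) (y - z) - real_form a b z (y - z)"
      have "I z0 y - I z0 z - real_form a b z (y - z) = integral {0..1} ?f"
        unfolding add[OF z yS] unfolding I_def
        using integral_diff[OF integrable[OF z yS] integrable_const_ivl] by simp
      moreover have "norm (integral {0..1} ?f) \<le> e * norm (y - z) * (1 - 0)"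
      proof (rule integral_bound)
        show "continuous_on {0..1} ?f" by (intro continuous_intros cont z yS)
        fix t :: real assume t: "t \<in> {0..1}"
        have "dist (linepath z y t) z = t * norm (y - z)"
        proof -
          have "linepath z y t - z = t *\<^sub>R (y - z)" by (simp add: linepath_def algebra_simps)
          then show ?thesis using t by (simp add: dist_norm)
        qed
        also have "\<dots> \<le> norm (y - z)" using t by (simp add: mult_left_le_one_le)
        finally show "norm (?f t) \<le> e * norm (y - z)" using y by (intro close) auto
      qed auto
      ultimately show "norm (I z0 y - I z0 z - real_form a b z (y - z)) \<le> e * norm (y - z)" by simp
    qed
  qed
  then show ?thesis by (rule that)
qed auto

text \<open>
  Near each parameter value the form has a primitive \<open>H\<close>, and the integrand is the derivative of the continuous
  function \<open>H \<circ> \<gamma>\<close> away from finitely many points. So it is integrable by the fundamental theorem of calculus even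
  where the derivative of \<open>\<gamma>\<close> is unbounded.
\<close>

theorem form_on_path_integrable:
  fixes a b :: "complex \<Rightarrow> 'e::banach"
  assumes S: "open S" and ab: "weakly_holomorphic_on S a b"
    and \<gamma>: "valid_path \<gamma>" "path_image \<gamma> \<subseteq> S"
  shows "form_on_path a b \<gamma> integrable_on {0..1}"
  unfolding box_real(2)[symmetric]
proof (rule integrable_on_little_subintervals, intro ballI)
  fix x :: real assume "x \<in> cbox 0 1"
  then have x: "x \<in> {0..1}" by simp
  from \<gamma>(1) obtain K where K: "finite K" "\<gamma> C1_differentiable_on {0..1} - K"
    and cont: "continuous_on {0..1} \<gamma>"
    unfolding valid_path_def piecewise_C1_differentiable_on_def by auto
  have "\<gamma> x \<in> S" using \<gamma>(2) x by (auto simp: path_image_def)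
  then obtain r where r: "r > 0" "ball (\<gamma> x) r \<subseteq> S" using S open_contains_ball by blast
  obtain H where H: "\<And>z. z \<in> ball (\<gamma> x) r \<Longrightarrow> (H has_derivative real_form a b z) (at z)"
    using weakly_holomorphic_primitive[OF convex_ball open_ball weakly_holomorphic_on_subset[OF ab r(2)]]
    by blast
  obtain d where d: "d > 0" "\<And>y. y \<in> {0..1} \<Longrightarrow> dist y x < d \<Longrightarrow> dist (\<gamma> y) (\<gamma> x) < r"
    using cont x r(1) unfolding continuous_on_iff by blast
  show "\<exists>d>0. \<forall>u v. x \<in> cbox u v \<and> cbox u v \<subseteq> ball x d \<and> cbox u v \<subseteq> cbox 0 1
      \<longrightarrow> form_on_path a b \<gamma> integrable_on cbox u v"
  proof (intro exI[of _ d] conjI allI impI)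
    fix u v :: real
    assume "x \<in> cbox u v \<and> cbox u v \<subseteq> ball x d \<and> cbox u v \<subseteq> cbox 0 1"
    then have uv: "u \<le> v" "{u..v} \<subseteq> ball x d" "{u..v} \<subseteq> {0..1}" by auto
    have in_ball: "\<gamma> t \<in> ball (\<gamma> x) r" if "t \<in> {u..v}" for t
      using d(2)[of t] that uv by (auto simp: dist_commute subset_eq)
    have "(form_on_path a b \<gamma> has_integral (H (\<gamma> v) - H (\<gamma> u))) {u..v}"
    proof (rule fundamental_theorem_of_calculus_interior_strong[where f = "\<lambda>t. H (\<gamma> t)", OF K(1) uv(1)])
      fix t assume t: "t \<in> {u<..<v} - K"
      moreover have "0 \<le> u" "v \<le> 1" using uv by auto
      ultimately have t01: "t \<in> {0<..<1}" by simp
      have "\<gamma> differentiable at t"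
        using K(2) t uv(3) by (auto simp: C1_differentiable_on_eq)
      then have "(\<gamma> has_vector_derivative vector_derivative \<gamma> (at t)) (at t)"
        by (simp add: vector_derivative_works)
      moreover have "vector_derivative \<gamma> (at t) = vector_derivative \<gamma> (at t within {0..1})"
        using at_within_interior[of t "{0..1}"] t01 by simp
      ultimately have deriv: "(\<gamma> has_derivative (\<lambda>h. h *\<^sub>R vector_derivative \<gamma> (at t within {0..1}))) (at t)"
        by (simp add: has_vector_derivative_def)
      have "\<gamma> t \<in> ball (\<gamma> x) r" using t by (intro in_ball) auto
      from has_derivative_compose[OF deriv H[OF this]] have "((\<lambda>t. H (\<gamma> t)) has_derivative
          (\<lambda>h. real_form a b (\<gamma> t) (h *\<^sub>R vector_derivative \<gamma> (at t within {0..1})))) (at t)" .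
      then show "((\<lambda>t. H (\<gamma> t)) has_vector_derivative form_on_path a b \<gamma> t) (at t)"
        by (simp add: has_vector_derivative_def form_on_path_def real_form_def algebra_simps)
    next
      have "continuous_on (ball (\<gamma> x) r) H"
        using H has_derivative_continuous by (intro continuous_at_imp_continuous_on ballI) blast
      then show "continuous_on {u..v} (\<lambda>t. H (\<gamma> t))"
        by (rule continuous_on_compose2[OF _ continuous_on_subset[OF cont uv(3)]])
          (use in_ball in blast)
    qed
    then show "form_on_path a b \<gamma> integrable_on cbox u v" by auto
  qed (use d in auto)
qed

lemma functional_integral_form_on_path:
  fixes a b :: "complex \<Rightarrow> 'e::banach"
  assumes S: "open S" and ab: "weakly_holomorphic_on S a b"
    and \<gamma>: "valid_path \<gamma>" "path_image \<gamma> \<subseteq> S" and \<phi>: "bounded_linear \<phi>"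
  shows "\<phi> (integral {0..1} (form_on_path a b \<gamma>))
    = Re (contour_integral \<gamma> (\<lambda>z. Complex (\<phi> (a z)) (\<phi> (b z))))"
proof -
  let ?G = "\<lambda>z. Complex (\<phi> (a z)) (\<phi> (b z))"
  have "?G contour_integrable_on \<gamma>"
    using ab \<phi> by (intro contour_integrable_holomorphic_simple[OF _ S \<gamma>])
      (auto simp: weakly_holomorphic_on_def)
  then have "((\<lambda>t. ?G (\<gamma> t) * vector_derivative \<gamma> (at t within {0..1})) has_integral
      contour_integral \<gamma> ?G) {0..1}"
    using has_contour_integral_integral[unfolded has_contour_integral_def] by blast
  from has_integral_linear[OF this bounded_linear_Re]
  have "integral {0..1} (\<phi> \<circ> form_on_path a b \<gamma>) = Re (contour_integral \<gamma> ?G)"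
    by (intro integral_unique) (simp add: o_def form_on_path_def functional_real_form[OF \<phi>])
  then show ?thesis
    using integral_linear[OF form_on_path_integrable[OF S ab \<gamma>] \<phi>] by simp
qed

lemma functional_integral_form_on_cycle:
  fixes a b :: "complex \<Rightarrow> 'e::banach"
  assumes S: "open S" and ab: "weakly_holomorphic_on S a b"
    and \<gamma>s: "\<forall>\<gamma>\<in>set \<gamma>s. valid_path \<gamma> \<and> path_image \<gamma> \<subseteq> S" and \<phi>: "bounded_linear \<phi>"
  shows "\<phi> (\<Sum>\<gamma>\<leftarrow>\<gamma>s. integral {0..1} (form_on_path a b \<gamma>))
    = Re (\<Sum>\<gamma>\<leftarrow>\<gamma>s. contour_integral \<gamma> (\<lambda>z. Complex (\<phi> (a z)) (\<phi> (b z))))"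
  using \<gamma>s bounded_linear.linear[OF \<phi>]
  by (induction \<gamma>s)
    (auto simp: linear_0 linear_add functional_integral_form_on_path[OF S ab _ _ \<phi>])

text \<open>
  The cycle \<open>\<gamma>s\<close> together with the reversed curves of \<open>\<eta>s\<close> has total winding number 0 outside \<open>S\<close>.
\<close>

lemma Cauchy_theorem_homologous_cycles:
  assumes S: "open S" "bounded S" and f: "f holomorphic_on S"
    and \<gamma>s: "\<forall>\<gamma>\<in>set \<gamma>s. valid_path \<gamma> \<and> pathfinish \<gamma> = pathstart \<gamma> \<and> path_image \<gamma> \<subseteq> S"
    and \<eta>s: "\<forall>\<eta>\<in>set \<eta>s. valid_path \<eta> \<and> pathfinish \<eta> = pathstart \<eta> \<and> path_image \<eta> \<subseteq> S"
    and wn: "\<And>w. w \<notin> S \<Longrightarrow>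
      (\<Sum>\<gamma>\<leftarrow>\<gamma>s. winding_number \<gamma> w) = (\<Sum>\<eta>\<leftarrow>\<eta>s. winding_number \<eta> w)"
  shows "(\<Sum>\<gamma>\<leftarrow>\<gamma>s. contour_integral \<gamma> f) = (\<Sum>\<eta>\<leftarrow>\<eta>s. contour_integral \<eta> f)"
proof -
  have "(\<Sum>\<gamma>\<leftarrow>\<gamma>s @ map reversepath \<eta>s. contour_integral \<gamma> f) = 0"
  proof (rule Cauchy_theorem_cycle[OF S f])
    show "\<forall>\<gamma>\<in>set (\<gamma>s @ map reversepath \<eta>s).
        valid_path \<gamma> \<and> pathfinish \<gamma> = pathstart \<gamma> \<and> path_image \<gamma> \<subseteq> S"
      using \<gamma>s \<eta>s by (simp add: ball_Un valid_path_imp_reverse)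
    fix w assume w: "w \<notin> S"
    have "(\<Sum>\<eta>\<leftarrow>\<eta>s. winding_number (reversepath \<eta>) w) = (\<Sum>\<eta>\<leftarrow>\<eta>s. - winding_number \<eta> w)"
      using \<eta>s w by (intro arg_cong[where f = sum_list] map_cong refl winding_number_reversepath)
        (auto simp: valid_path_imp_path)
    then show "(\<Sum>\<gamma>\<leftarrow>\<gamma>s @ map reversepath \<eta>s. winding_number \<gamma> w) = 0"
      using wn[OF w] by (simp add: o_def uminus_sum_list_map[unfolded o_def, symmetric])
  qed
  moreover have "(\<Sum>\<eta>\<leftarrow>\<eta>s. contour_integral (reversepath \<eta>) f) = (\<Sum>\<eta>\<leftarrow>\<eta>s. - contour_integral \<eta> f)"
    using \<eta>s by (intro arg_cong[where f = sum_list] map_cong refl contour_integral_reversepath) auto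
  ultimately show ?thesis by (simp add: o_def uminus_sum_list_map[unfolded o_def, symmetric])
qed

theorem integral_form_homologous_cycles:
  fixes a b :: "complex \<Rightarrow> 'e::banach"
  assumes S: "open S" "bounded S" and ab: "weakly_holomorphic_on S a b"
    and \<gamma>s: "\<forall>\<gamma>\<in>set \<gamma>s. valid_path \<gamma> \<and> pathfinish \<gamma> = pathstart \<gamma> \<and> path_image \<gamma> \<subseteq> S"
    and \<eta>s: "\<forall>\<eta>\<in>set \<eta>s. valid_path \<eta> \<and> pathfinish \<eta> = pathstart \<eta> \<and> path_image \<eta> \<subseteq> S"
    and wn: "\<And>w. w \<notin> S \<Longrightarrow>
      (\<Sum>\<gamma>\<leftarrow>\<gamma>s. winding_number \<gamma> w) = (\<Sum>\<eta>\<leftarrow>\<eta>s. winding_number \<eta> w)"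
  shows "(\<Sum>\<gamma>\<leftarrow>\<gamma>s. integral {0..1} (form_on_path a b \<gamma>))
    = (\<Sum>\<eta>\<leftarrow>\<eta>s. integral {0..1} (form_on_path a b \<eta>))"
proof (rule eq_if_functionals_eq)
  fix \<phi> :: "'e \<Rightarrow> real" assume \<phi>: "bounded_linear \<phi>"
  have "(\<lambda>z. Complex (\<phi> (a z)) (\<phi> (b z))) holomorphic_on S"
    using ab \<phi> by (auto simp: weakly_holomorphic_on_def)
  from Cauchy_theorem_homologous_cycles[OF S this \<gamma>s \<eta>s wn]
  show "\<phi> (\<Sum>\<gamma>\<leftarrow>\<gamma>s. integral {0..1} (form_on_path a b \<gamma>))
      = \<phi> (\<Sum>\<eta>\<leftarrow>\<eta>s. integral {0..1} (form_on_path a b \<eta>))"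
    using \<gamma>s \<eta>s by (simp add: functional_integral_form_on_cycle[OF S(1) ab _ \<phi>])
qed

text \<open>
  For a functional \<open>\<phi>\<close> the scalar function \<open>G = \<phi> \<circ> a + \<i> (\<phi> \<circ> b)\<close> satisfies \<open>G (cnj z) = cnj (G z)\<close>. The cycle of
  reversed conjugate curves is homologous to the given one, and its integral of \<open>G\<close> is \<open>- cnj I\<close> if the
  original integral is \<open>I\<close>. Hence \<open>I = - cnj I\<close>, which means \<open>Re I = 0\<close>.
\<close>

theorem integral_real_symmetric_form_eq_0:
  fixes a b :: "complex \<Rightarrow> 'e::banach"
  assumes S: "open S" "bounded S" and sym: "\<And>z. z \<in> S \<Longrightarrow> cnj z \<in> S"
    and ab: "weakly_holomorphic_on S a b"
    and ab_cnj: "\<And>z. z \<in> S \<Longrightarrow> a (cnj z) = a z \<and> b (cnj z) = - b z"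
    and \<gamma>s: "\<forall>\<gamma>\<in>set \<gamma>s. valid_path \<gamma> \<and> pathfinish \<gamma> = pathstart \<gamma> \<and> path_image \<gamma> \<subseteq> S"
    and wn: "\<And>w. w \<notin> S \<Longrightarrow>
      (\<Sum>\<gamma>\<leftarrow>\<gamma>s. winding_number \<gamma> (cnj w)) = cnj (\<Sum>\<gamma>\<leftarrow>\<gamma>s. winding_number \<gamma> w)"
  shows "(\<Sum>\<gamma>\<leftarrow>\<gamma>s. integral {0..1} (form_on_path a b \<gamma>)) = 0"
proof (rule eq_if_functionals_eq)
  fix \<phi> :: "'e \<Rightarrow> real" assume \<phi>: "bounded_linear \<phi>"
  let ?G = "\<lambda>z. Complex (\<phi> (a z)) (\<phi> (b z))"
  let ?I = "\<Sum>\<gamma>\<leftarrow>\<gamma>s. contour_integral \<gamma> ?G"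
  let ?\<eta>s = "map (\<lambda>\<gamma>. reversepath (cnj \<circ> \<gamma>)) \<gamma>s"
  have cnj_valid: "valid_path (cnj \<circ> \<gamma>)" if "\<gamma> \<in> set \<gamma>s" for \<gamma>
    using \<gamma>s that by (simp add: valid_path_cnj)
  have G: "?G holomorphic_on S"
    using ab \<phi> by (auto simp: weakly_holomorphic_on_def)
  have "?I = (\<Sum>\<eta>\<leftarrow>?\<eta>s. contour_integral \<eta> ?G)"
  proof (rule Cauchy_theorem_homologous_cycles[OF S G \<gamma>s])
    have "path_image (cnj \<circ> \<gamma>) \<subseteq> S" if "\<gamma> \<in> set \<gamma>s" for \<gamma>
      using \<gamma>s sym that by (auto simp: path_image_def)
    then show "\<forall>\<eta>\<in>set ?\<eta>s. valid_path \<eta> \<and> pathfinish \<eta> = pathstart \<eta> \<and> path_image \<eta> \<subseteq> S"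
      using \<gamma>s cnj_valid
      by (simp add: valid_path_imp_reverse pathfinish_compose pathstart_compose)
    fix w assume w: "w \<notin> S"
    then have cw: "cnj w \<notin> S" using sym[of "cnj w"] by auto
    have "(\<Sum>\<eta>\<leftarrow>?\<eta>s. winding_number \<eta> w) = (\<Sum>\<gamma>\<leftarrow>\<gamma>s. cnj (winding_number \<gamma> (cnj w)))"
      unfolding map_map o_def
    proof (intro arg_cong[where f = sum_list] map_cong refl)
      fix \<gamma> assume \<gamma>: "\<gamma> \<in> set \<gamma>s"
      have "cnj w \<notin> path_image \<gamma>" "path \<gamma>"
        using \<gamma>s \<gamma> cw by (auto simp: valid_path_imp_path)
      moreover from this have "w \<notin> path_image (cnj \<circ> \<gamma>)"
        by (auto simp: path_image_def)
      moreover have "path (cnj \<circ> \<gamma>)" using cnj_valid[OF \<gamma>] by (rule valid_path_imp_path)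
      ultimately show "winding_number (reversepath (\<lambda>x. cnj (\<gamma> x))) w = cnj (winding_number \<gamma> (cnj w))"
        using winding_number_reversepath[of "cnj \<circ> \<gamma>" w] winding_number_cnj[of \<gamma> "cnj w"]
        by (simp add: o_def)
    qed
    also have "\<dots> = cnj (\<Sum>\<gamma>\<leftarrow>\<gamma>s. winding_number \<gamma> (cnj w))"
      by (induction \<gamma>s) auto
    finally show "(\<Sum>\<gamma>\<leftarrow>\<gamma>s. winding_number \<gamma> w) = (\<Sum>\<eta>\<leftarrow>?\<eta>s. winding_number \<eta> w)"
      using wn[OF w] by simp
  qed
  also have "\<dots> = (\<Sum>\<gamma>\<leftarrow>\<gamma>s. - cnj (contour_integral \<gamma> ?G))"
    unfolding map_map o_def
  proof (intro arg_cong[where f = sum_list] map_cong refl)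
    fix \<gamma> assume \<gamma>: "\<gamma> \<in> set \<gamma>s"
    have "contour_integral \<gamma> (cnj \<circ> ?G \<circ> cnj) = contour_integral \<gamma> ?G"
    proof (rule contour_integral_eq)
      fix z assume "z \<in> path_image \<gamma>"
      then have "z \<in> S" using \<gamma>s \<gamma> by auto
      then show "(cnj \<circ> ?G \<circ> cnj) z = ?G z"
        using ab_cnj[of z] bounded_linear.linear[OF \<phi>] by (simp add: linear_neg complex_eq_iff)
    qed
    then show "contour_integral (reversepath (\<lambda>x. cnj (\<gamma> x))) ?G = - cnj (contour_integral \<gamma> ?G)"
      using contour_integral_reversepath[OF cnj_valid[OF \<gamma>], of ?G] contour_integral_cnj[of \<gamma> ?G] \<gamma>s \<gamma>
      by (simp add: o_def)
  qed
  also have "\<dots> = - cnj ?I"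
    by (induction \<gamma>s) auto
  finally have "Re ?I = 0" by (auto simp: complex_eq_iff)
  then show "\<phi> (\<Sum>\<gamma>\<leftarrow>\<gamma>s. integral {0..1} (form_on_path a b \<gamma>)) = \<phi> 0"
    using \<gamma>s bounded_linear.linear[OF \<phi>]
    by (simp add: functional_integral_form_on_cycle[OF S(1) ab _ \<phi>] linear_0)
qed


section \<open>Complex coordinates on the slices of the weak cone\<close>

lemma of_real_eq_scaleR_one: "of_real r = r *\<^sub>R (1::'f::real_algebra_1)"
  by (simp add: of_real_def)

lemma conjg_scaleR: "conjg (r *\<^sub>R a) = r *\<^sub>R conjg (a::'f::weak_cone_algebra)"
  using conjg_mult[of "r *\<^sub>R 1" a] by (simp add: conjg_real)

lemma conjg_minus: "conjg (- a) = - conjg (a::'f::weak_cone_algebra)"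
  using conjg_scaleR[of "- 1" a] by simp

lemma conjg_one: "conjg 1 = (1::'f::weak_cone_algebra)"
  using conjg_real[of 1] by simp

lemma real_coordinates:
  "of_real r = (\<Sum>u\<in>ubasis. (if u = 1 then r else 0) *\<^sub>R (u::'f::weak_cone_algebra))"
  by (simp add: of_real_eq_scaleR_one if_distrib[of "\<lambda>c. c *\<^sub>R _"] finite_ubasis one_in_ubasis
      cong: if_cong)

lemma norm_eq_sqrt:
  assumes "a * conjg a = of_real r"
  shows "norm (a::'f::weak_cone_algebra) = sqrt r"
  using norm_conjg[of a "\<lambda>u. if u = 1 then r else 0"] assms real_coordinates[of r] by simp

lemma imag_unit_square: "J \<in> imag_units \<Longrightarrow> J * J = - 1"
  by (simp add: imag_units_def power2_eq_square)

text \<open>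
  From \<open>J (conjg J) = r\<close> and \<open>J\<^sup>2 = - 1\<close> one gets \<open>conjg J = - r J\<close>, and applying \<open>conjg\<close> again gives \<open>r\<^sup>2 = 1\<close>.
  Positivity of the first coordinate of \<open>J (conjg J)\<close> excludes \<open>r = - 1\<close>.
\<close>

lemma imag_unit_conjg:
  fixes J :: "'f::weak_cone_algebra"
  assumes J: "J \<in> imag_units"
  shows "conjg J = - J"
proof -
  obtain r where r: "J * conjg J = of_real r"
    using J by (auto simp: imag_units_def Reals_def)
  note sq = imag_unit_square[OF J]
  have "- conjg J = J * (J * conjg J)"
    by (simp add: mult.assoc[symmetric] sq)
  then have "- conjg J = r *\<^sub>R J"
    by (simp add: r of_real_eq_scaleR_one)
  then have "conjg J = - (r *\<^sub>R J)"
    by (metis minus_minus)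
  then have c: "conjg J = (- r) *\<^sub>R J" by simp
  have "J = conjg (conjg J)" by (simp add: conjg_conjg)
  also have "\<dots> = (r * r) *\<^sub>R J" by (simp add: c conjg_scaleR conjg_minus)
  finally have "(r * r - 1) *\<^sub>R J = 0" by (simp add: algebra_simps)
  moreover have "J \<noteq> 0" using sq by auto
  ultimately have "r * r = 1" by simp
  moreover have "r \<ge> 0"
    using coord_nonneg[of J "\<lambda>u. if u = 1 then r else 0"] r real_coordinates[of r] by simp
  ultimately have "r = 1" using square_eq_1_iff[of r] by auto
  with c show ?thesis by simp
qed

lemma in_slice_eq: "in_slice J z = Re z *\<^sub>R 1 + Im z *\<^sub>R J"
  by (simp add: in_slice_def slice_point_def of_real_eq_scaleR_one)

lemma in_slice_mult:
  assumes "J \<in> imag_units"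
  shows "in_slice J (w * z) = in_slice J w * in_slice J z"
  using imag_unit_square[OF assms] by (simp add: in_slice_eq algebra_simps)

lemma conjg_in_slice: "J \<in> imag_units \<Longrightarrow> conjg (in_slice J z) = in_slice J (cnj z)"
  by (simp add: in_slice_eq conjg_add conjg_scaleR conjg_one imag_unit_conjg)

lemma norm_in_slice:
  assumes J: "J \<in> imag_units"
  shows "norm (in_slice J z) = cmod z"
proof -
  have "in_slice J z * conjg (in_slice J z) = in_slice J (z * cnj z)"
    by (simp add: conjg_in_slice[OF J] in_slice_mult[OF J])
  also have "z * cnj z = complex_of_real ((cmod z)\<^sup>2)"
    by (rule complex_norm_square[symmetric])
  also have "in_slice J \<dots> = of_real ((cmod z)\<^sup>2)"
    by (simp add: in_slice_eq of_real_eq_scaleR_one)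
  finally show ?thesis using norm_eq_sqrt by fastforce
qed

lemma cone_Re_in_slice: "J \<in> imag_units \<Longrightarrow> cone_Re (in_slice J z) = of_real (Re z)"
  unfolding cone_Re_def conjg_in_slice
  by (simp add: in_slice_eq of_real_eq_scaleR_one scaleR_2[symmetric] del: scaleR_2)

lemma in_slice_mem_weak_cone: "J \<in> imag_units \<Longrightarrow> in_slice J z \<in> weak_cone"
  by (auto simp: weak_cone_def slice_plane_def in_slice_def)

lemma continuous_on_in_slice: "continuous_on S (in_slice J)"
  unfolding in_slice_eq[abs_def] by (intro continuous_intros)

text \<open>
  Two points of different slices can only coincide up to the sign of the imaginary part, because \<open>cone_Re\<close>
  and the norm recover the real part and the modulus.
\<close>

lemma in_slice_eq_imp:
  assumes "J \<in> imag_units" "I \<in> imag_units" "in_slice J z = in_slice I w"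
  shows "w = z \<or> w = cnj z"
proof -
  have "Re w = Re z"
    using cone_Re_in_slice[OF assms(1), of z] cone_Re_in_slice[OF assms(2), of w] assms(3)
    by simp
  moreover have "cmod w = cmod z"
    using norm_in_slice[OF assms(1), of z] norm_in_slice[OF assms(2), of w] assms(3) by simp
  ultimately have "(Im w)\<^sup>2 = (Im z)\<^sup>2"
    by (simp add: cmod_def)
  with \<open>Re w = Re z\<close> show ?thesis
    by (auto simp: complex_eq_iff power2_eq_iff)
qed

definition base_region :: "(real \<times> real) set \<Rightarrow> complex set" where
  "base_region V = {z. (Re z, Im z) \<in> V}"

lemma open_base_region: "axial_base V \<Longrightarrow> open (base_region V)"
  using continuous_open_vimage[of V "\<lambda>z. (Re z, Im z)"]
  by (simp add: base_region_def axial_base_def vimage_def continuous_intros)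

lemma cnj_base_region: "axial_base V \<Longrightarrow> cnj z \<in> base_region V \<longleftrightarrow> z \<in> base_region V"
  by (auto simp: base_region_def axial_base_def) (metis minus_minus)

lemma slice_of_axial_set:
  assumes "axial_base V" and J: "J \<in> imag_units"
  shows "slice_of J (axial_set V) = base_region V"
proof
  show "base_region V \<subseteq> slice_of J (axial_set V)"
    using J by (auto simp: slice_of_def base_region_def axial_set_def in_slice_def)
  show "slice_of J (axial_set V) \<subseteq> base_region V"
  proof
    fix z assume "z \<in> slice_of J (axial_set V)"
    then obtain I u v where I: "in_slice J z = in_slice I (Complex u v)" "I \<in> imag_units" "(u, v) \<in> V"
      by (auto simp: slice_of_def axial_set_def in_slice_def)
    then have "Complex u v \<in> base_region V" by (simp add: base_region_def)
    with in_slice_eq_imp[OF J I(2) I(1)] cnj_base_region[OF assms(1), of z]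
    show "z \<in> base_region V" by auto
  qed
qed

lemma closure_slice_of: "closure (slice_of J U) \<subseteq> slice_of J (closure U)"
proof (rule closure_minimal)
  show "slice_of J U \<subseteq> slice_of J (closure U)"
    using closure_subset by (auto simp: slice_of_def)
  show "closed (slice_of J (closure U))"
    using continuous_closed_vimage[of "closure U" "in_slice J"] continuous_on_in_slice[of UNIV J]
    by (simp add: slice_of_def vimage_def continuous_on_eq_continuous_at)
qed

lemma bounded_slice_of: "J \<in> imag_units \<Longrightarrow> bounded U \<Longrightarrow> bounded (slice_of J U)"
  by (auto simp: slice_of_def bounded_iff norm_in_slice) (metis norm_in_slice)


section \<open>Linear maps that are bounded on a subspace\<close>

text \<open>
  The operations of the operator algebra are controlled only on \<open>ops B\<close>, so linearity and boundedness are
  relativised to a subspace.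
\<close>

definition bounded_linear_on ::
    "'a::real_normed_vector set \<Rightarrow> ('a \<Rightarrow> 'b::real_normed_vector) \<Rightarrow> bool" where
  "bounded_linear_on V M \<longleftrightarrow>
     (\<forall>S\<in>V. \<forall>T\<in>V. M (S + T) = M S + M T) \<and> (\<forall>c. \<forall>T\<in>V. M (c *\<^sub>R T) = c *\<^sub>R M T) \<and>
     (\<exists>C. \<forall>T\<in>V. norm (M T) \<le> norm T * C)"

lemma bounded_linear_on_diff:
  assumes "bounded_linear_on V M" "subspace V" "S \<in> V" "T \<in> V"
  shows "M (S - T) = M S - M T"
proof -
  have "(- 1) *\<^sub>R T \<in> V" using assms by (intro subspace_scale)
  then have "M (S + (- 1) *\<^sub>R T) = M S + (- 1) *\<^sub>R M T"
    using assms unfolding bounded_linear_on_def by metis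
  then show ?thesis by simp
qed

lemma continuous_on_bounded_linear_on:
  assumes M: "bounded_linear_on V M" and V: "subspace V"
  shows "continuous_on V M"
proof -
  obtain C where C: "\<And>T. T \<in> V \<Longrightarrow> norm (M T) \<le> norm T * C"
    using M unfolding bounded_linear_on_def by blast
  have "\<bar>C\<bar>-lipschitz_on V M"
  proof (rule lipschitz_onI)
    fix S T assume "S \<in> V" "T \<in> V"
    then have "dist (M S) (M T) \<le> norm (S - T) * C"
      using C[of "S - T"] bounded_linear_on_diff[OF M V] subspace_diff[OF V] by (simp add: dist_norm)
    also have "\<dots> \<le> \<bar>C\<bar> * dist S T" by (simp add: dist_norm mult.commute mult_mono)
    finally show "dist (M S) (M T) \<le> \<bar>C\<bar> * dist S T" .
  qed simp
  then show ?thesis by (rule lipschitz_on_continuous_on)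
qed

lemma bounded_linear_on_compose:
  assumes \<phi>: "bounded_linear \<phi>" and M: "bounded_linear_on V M"
  shows "bounded_linear_on V (\<lambda>T. \<phi> (M T))"
proof -
  obtain C where C: "\<And>T. T \<in> V \<Longrightarrow> norm (M T) \<le> norm T * C"
    using M unfolding bounded_linear_on_def by blast
  obtain D where D: "D > 0" "\<And>x. norm (\<phi> x) \<le> norm x * D"
    using bounded_linear.pos_bounded[OF \<phi>] by blast
  have "norm (\<phi> (M T)) \<le> norm T * (C * D)" if "T \<in> V" for T
    using order_trans[OF D(2)[of "M T"] mult_right_mono[OF C[OF that], of D]] D(1)
    by (simp add: mult.assoc)
  then show ?thesis
    using M bounded_linear.linear[OF \<phi>]
    by (auto simp: bounded_linear_on_def linear_add linear_scale)
qed


section \<open>The Banach algebra of operators\<close>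

lemma linear_ract: "two_sided_banach_module lact ract \<Longrightarrow> bounded_linear (\<lambda>x. ract x a)"
proof -
  assume "two_sided_banach_module lact ract"
  then interpret two_sided_banach_module lact ract .
  have "ract (c *\<^sub>R x) a = c *\<^sub>R ract x a" for c x
  proof -
    have "ract (c *\<^sub>R x) a = ract x (of_real c * a)" by (simp add: ract_mult ract_of_real)
    also have "of_real c * a = a * of_real c" by (simp add: of_real_eq_scaleR_one)
    also have "ract x (a * of_real c) = c *\<^sub>R ract x a" by (simp only: ract_mult ract_of_real)
    finally show ?thesis .
  qed
  then show ?thesis
    by (intro bounded_linear_intro[of _ "norm a"]) (auto simp: ract_add_left norm_ract)
qed

lemma linear_lact: "two_sided_banach_module lact ract \<Longrightarrow> bounded_linear (lact a)"
proof -
  assume "two_sided_banach_module lact ract"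
  then interpret two_sided_banach_module lact ract .
  have "lact a (c *\<^sub>R x) = c *\<^sub>R lact a x" for c x
  proof -
    have "lact a (c *\<^sub>R x) = lact (a * of_real c) x" by (simp add: lact_mult lact_of_real)
    also have "a * of_real c = of_real c * a" by (simp add: of_real_eq_scaleR_one)
    also have "lact (of_real c * a) x = c *\<^sub>R lact a x" by (simp only: lact_mult lact_of_real)
    finally show ?thesis .
  qed
  then show ?thesis
    by (intro bounded_linear_intro[of _ "norm a"]) (auto simp: lact_add_right norm_lact)
qed

context operator_algebra
begin

abbreviation op_prod :: "('y \<Rightarrow>\<^sub>L 'y) \<Rightarrow> ('y \<Rightarrow>\<^sub>L 'y) \<Rightarrow> ('y \<Rightarrow>\<^sub>L 'y)" (infixl "\<odot>" 70) where
  "S \<odot> T \<equiv> op_mult B S T"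

text \<open>
  Linearity over the algebra is a family of linear equations that depend continuously on the operator. This
  single description gives that \<open>ops B\<close> is a closed subspace and that it contains integrals of its members.
\<close>

lemma ops_eq_common_kernel:
  obtains H :: "(('y \<Rightarrow>\<^sub>L 'y) \<Rightarrow> 'y) set"
  where "\<And>h. h \<in> H \<Longrightarrow> bounded_linear h" "ops B = {T. \<forall>h\<in>H. h T = 0}"
proof -
  note ract = linear_ract[OF two_sided_banach_module_axioms]
  note lact = linear_lact[OF two_sided_banach_module_axioms]
  from ops_cases show ?thesis
  proof (elim disjE conjE)
    assume B: "ops B = right_linear_ops ract"
    show ?thesis
    proof (rule that[of "range (\<lambda>(v, a) T. blinfun_apply T (ract v a) - ract (blinfun_apply T v) a)"])
      show "ops B = {T. \<forall>h\<in>range (\<lambda>(v, a) T. blinfun_apply T (ract v a) - ract (blinfun_apply T v) a).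
          h T = 0}"
        by (auto simp: B right_linear_ops_def)
    qed (auto intro!: bounded_linear_sub blinfun.bounded_linear_left bounded_linear_compose[OF ract])
  next
    assume B: "ops B = left_linear_ops lact"
    show ?thesis
    proof (rule that[of "range (\<lambda>(v, a) T. blinfun_apply T (lact a v) - lact a (blinfun_apply T v))"])
      show "ops B = {T. \<forall>h\<in>range (\<lambda>(v, a) T. blinfun_apply T (lact a v) - lact a (blinfun_apply T v)).
          h T = 0}"
        by (auto simp: B left_linear_ops_def)
    qed (auto intro!: bounded_linear_sub blinfun.bounded_linear_left bounded_linear_compose[OF lact])
  qed
qed

lemma subspace_ops: "subspace (ops B)"
proof -
  obtain H :: "(('y \<Rightarrow>\<^sub>L 'y) \<Rightarrow> 'y) set"
    where H: "\<And>h. h \<in> H \<Longrightarrow> bounded_linear h" "ops B = {T. \<forall>h\<in>H. h T = 0}"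
    using ops_eq_common_kernel by blast
  note lin = bounded_linear.linear[OF H(1)]
  show ?thesis
    unfolding subspace_def H(2)
    by (auto simp: linear_0[OF lin] linear_add[OF lin] linear_scale[OF lin])
qed

lemma closed_ops: "closed (ops B)"
proof -
  obtain H :: "(('y \<Rightarrow>\<^sub>L 'y) \<Rightarrow> 'y) set"
    where H: "\<And>h. h \<in> H \<Longrightarrow> bounded_linear h" "ops B = {T. \<forall>h\<in>H. h T = 0}"
    using ops_eq_common_kernel by blast
  have "closed {T. h T = 0}" if "h \<in> H" for h
    using H(1)[OF that] by (intro closed_Collect_eq linear_continuous_on continuous_on_const)
  moreover have "ops B = (\<Inter>h\<in>H. {T. h T = 0})" using H(2) by auto
  ultimately show ?thesis by auto
qed

lemma integral_in_ops:
  assumes "f integrable_on {0..1}" "\<And>t. t \<in> {0..1} \<Longrightarrow> f t \<in> ops B"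
  shows "integral {0..1::real} f \<in> ops B"
proof -
  obtain H :: "(('y \<Rightarrow>\<^sub>L 'y) \<Rightarrow> 'y) set"
    where H: "\<And>h. h \<in> H \<Longrightarrow> bounded_linear h" "ops B = {T. \<forall>h\<in>H. h T = 0}"
    using ops_eq_common_kernel by blast
  have "h (integral {0..1} f) = 0" if h: "h \<in> H" for h
  proof -
    have "h (integral {0..1} f) = integral {0..1} (h \<circ> f)"
      using integral_linear[OF assms(1) H(1)[OF h]] by simp
    also have "\<dots> = integral {0..1::real} (\<lambda>_. 0)"
      using assms(2) H(2) h by (intro integral_cong) auto
    finally show ?thesis by simp
  qed
  then show ?thesis using H(2) by auto
qed

lemma id_in_ops: "id_blinfun \<in> ops B"
  using ops_cases by (auto simp: right_linear_ops_def left_linear_ops_def)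

lemmas ops_add = subspace_add[OF subspace_ops]
  and ops_diff = subspace_diff[OF subspace_ops]
  and ops_neg = subspace_neg[OF subspace_ops]
  and ops_scale = subspace_scale[OF subspace_ops]

lemmas ops_intros = ops_add ops_diff ops_scale mult_closed lscale_closed rscale_closed id_in_ops

lemma scaleR_mult_left: "S \<in> ops B \<Longrightarrow> T \<in> ops B \<Longrightarrow> (c *\<^sub>R S) \<odot> T = c *\<^sub>R (S \<odot> T)"
  using lscale_op_mult[of S T "of_real c"] by (simp add: lscale_of_real mult_closed)

lemma scaleR_mult_right: "S \<in> ops B \<Longrightarrow> T \<in> ops B \<Longrightarrow> S \<odot> (c *\<^sub>R T) = c *\<^sub>R (S \<odot> T)"
  using rscale_op_mult[of S T "of_real c"] by (simp add: rscale_of_real mult_closed)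

lemma lscale_scaleR:
  assumes "T \<in> ops B"
  shows "op_lscale B a (c *\<^sub>R T) = c *\<^sub>R op_lscale B a T" "op_lscale B (c *\<^sub>R a) T = c *\<^sub>R op_lscale B a T"
proof -
  have "a * of_real c = c *\<^sub>R a" "of_real c * a = c *\<^sub>R a"
    by (simp_all add: of_real_eq_scaleR_one)
  then show "op_lscale B a (c *\<^sub>R T) = c *\<^sub>R op_lscale B a T"
    "op_lscale B (c *\<^sub>R a) T = c *\<^sub>R op_lscale B a T"
    using lscale_mult[OF assms, of a "of_real c"] lscale_mult[OF assms, of "of_real c" a] assms
    by (simp_all add: lscale_of_real lscale_closed)
qed

lemma rscale_scaleR:
  assumes "T \<in> ops B"
  shows "op_rscale B (c *\<^sub>R T) a = c *\<^sub>R op_rscale B T a" "op_rscale B T (c *\<^sub>R a) = c *\<^sub>R op_rscale B T a"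
proof -
  have "a * of_real c = c *\<^sub>R a" "of_real c * a = c *\<^sub>R a"
    by (simp_all add: of_real_eq_scaleR_one)
  then show "op_rscale B (c *\<^sub>R T) a = c *\<^sub>R op_rscale B T a"
    "op_rscale B T (c *\<^sub>R a) = c *\<^sub>R op_rscale B T a"
    using rscale_mult[OF assms, of a "of_real c"] rscale_mult[OF assms, of "of_real c" a] assms
    by (simp_all add: rscale_of_real rscale_closed)
qed

lemma bounded_linear_on_mult_left: "S \<in> ops B \<Longrightarrow> bounded_linear_on (ops B) (\<lambda>T. S \<odot> T)"
  unfolding bounded_linear_on_def
  by (intro conjI exI[of _ "norm S"])
    (auto simp: mult_add_right scaleR_mult_right norm_mult mult.commute[of _ "norm S"])

lemma bounded_linear_on_mult_right: "S \<in> ops B \<Longrightarrow> bounded_linear_on (ops B) (\<lambda>T. T \<odot> S)"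
  unfolding bounded_linear_on_def using norm_mult[of _ S]
  by (auto simp: mult_add_left scaleR_mult_left)

lemma bounded_linear_on_lscale: "bounded_linear_on (ops B) (op_lscale B a)"
  unfolding bounded_linear_on_def using norm_lscale[of _ a]
  by (auto simp: lscale_add_right lscale_scaleR)

lemma bounded_linear_on_rscale: "bounded_linear_on (ops B) (\<lambda>T. op_rscale B T a)"
  unfolding bounded_linear_on_def using norm_rscale[of _ a]
  by (auto simp: rscale_add_left rscale_scaleR)

lemma mult_diff:
  assumes "S \<in> ops B" "T \<in> ops B" "R \<in> ops B"
  shows "(S - T) \<odot> R = S \<odot> R - T \<odot> R" "R \<odot> (S - T) = R \<odot> S - R \<odot> T"
  using bounded_linear_on_diff[OF bounded_linear_on_mult_right subspace_ops, of R S T]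
    bounded_linear_on_diff[OF bounded_linear_on_mult_left subspace_ops, of R S T] assms by auto

lemma op_inverse_unique:
  assumes "T \<in> ops B" "is_op_inverse B T R" "is_op_inverse B T R'"
  shows "R = R'"
proof -
  have "R = (R' \<odot> T) \<odot> R" using assms by (simp add: is_op_inverse_def mult_id_left)
  also have "\<dots> = R' \<odot> (T \<odot> R)" using assms by (intro mult_assoc) (auto simp: is_op_inverse_def)
  also have "\<dots> = R'" using assms by (simp add: is_op_inverse_def mult_id_right)
  finally show ?thesis .
qed

lemma op_inv_eq: "T \<in> ops B \<Longrightarrow> is_op_inverse B T R \<Longrightarrow> op_inv B T = R"
  unfolding op_inv_def using op_inverse_unique by blast

lemma inverse_commute:
  assumes "T \<in> ops B" "S \<in> ops B" "is_op_inverse B T R" "S \<odot> T = T \<odot> S"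
  shows "S \<odot> R = R \<odot> S"
proof -
  have R: "R \<in> ops B" "T \<odot> R = id_blinfun" "R \<odot> T = id_blinfun"
    using assms(3) by (auto simp: is_op_inverse_def)
  have "S \<odot> R = (R \<odot> T) \<odot> (S \<odot> R)" using R assms by (simp add: mult_id_left mult_closed)
  also have "\<dots> = R \<odot> (T \<odot> (S \<odot> R))" using R assms by (intro mult_assoc mult_closed)
  also have "T \<odot> (S \<odot> R) = (T \<odot> S) \<odot> R" using R assms by (simp add: mult_assoc)
  also have "\<dots> = S \<odot> (T \<odot> R)" using R assms by (simp add: mult_assoc flip: assms(4))
  also have "R \<odot> \<dots> = R \<odot> S" using R assms by (simp add: mult_id_right)
  finally show ?thesis .
qed

text \<open>
  With \<open>E = T' - T\<close>, a right inverse of \<open>T'\<close> is a fixed point of \<open>X \<mapsto> R - R E X\<close> and a left inverse one of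
  \<open>X \<mapsto> R - X E R\<close>. Both maps are contractions of the complete set \<open>ops B\<close>.
\<close>

lemma perturbed_inverse:
  assumes T: "T \<in> ops B" "T' \<in> ops B" and R: "is_op_inverse B T R"
    and small: "norm (T' - T) * norm R < 1"
  obtains R' where "is_op_inverse B T' R'"
proof -
  have R: "R \<in> ops B" "T \<odot> R = id_blinfun" "R \<odot> T = id_blinfun"
    using R by (auto simp: is_op_inverse_def)
  define E where "E = T' - T"
  have E: "E \<in> ops B" using T by (simp add: E_def ops_diff)
  let ?c = "norm E * norm R"
  have c: "0 \<le> ?c" "?c < 1" using small by (auto simp: E_def)
  have "\<exists>!X. X \<in> ops B \<and> R - R \<odot> (E \<odot> X) = X"
  proof (rule Banach_fix[of "ops B" ?c "\<lambda>X. R - R \<odot> (E \<odot> X)"])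
    fix X Y assume "X \<in> ops B" "Y \<in> ops B"
    then have "dist (R - R \<odot> (E \<odot> X)) (R - R \<odot> (E \<odot> Y)) = norm (R \<odot> (E \<odot> (Y - X)))"
      using R E by (simp add: dist_norm mult_diff mult_closed)
    also have "\<dots> \<le> norm R * (norm E * norm (Y - X))"
      using \<open>X \<in> ops B\<close> \<open>Y \<in> ops B\<close> R E
      by (intro order_trans[OF norm_mult] mult_left_mono norm_mult) (auto intro: ops_intros)
    finally show "dist (R - R \<odot> (E \<odot> X)) (R - R \<odot> (E \<odot> Y)) \<le> ?c * dist X Y"
      by (simp add: dist_norm norm_minus_commute mult_ac)
  qed (use R E c closed_ops[folded complete_eq_closed] id_in_ops in \<open>auto intro: ops_intros\<close>)
  then obtain X where X: "X \<in> ops B" "R - R \<odot> (E \<odot> X) = X" by blast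
  have "\<exists>!X. X \<in> ops B \<and> R - (X \<odot> E) \<odot> R = X"
  proof (rule Banach_fix[of "ops B" ?c "\<lambda>X. R - (X \<odot> E) \<odot> R"])
    fix X Y assume "X \<in> ops B" "Y \<in> ops B"
    then have "dist (R - (X \<odot> E) \<odot> R) (R - (Y \<odot> E) \<odot> R) = norm (((Y - X) \<odot> E) \<odot> R)"
      using R E by (simp add: dist_norm mult_diff mult_closed)
    also have "\<dots> \<le> (norm (Y - X) * norm E) * norm R"
      using \<open>X \<in> ops B\<close> \<open>Y \<in> ops B\<close> R E
      by (intro order_trans[OF norm_mult] mult_right_mono norm_mult) (auto intro: ops_intros)
    finally show "dist (R - (X \<odot> E) \<odot> R) (R - (Y \<odot> E) \<odot> R) \<le> ?c * dist X Y"
      by (simp add: dist_norm norm_minus_commute mult_ac)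
  qed (use R E c closed_ops[folded complete_eq_closed] id_in_ops in \<open>auto intro: ops_intros\<close>)
  then obtain Y where Y: "Y \<in> ops B" "R - (Y \<odot> E) \<odot> R = Y" by blast
  have T': "T' = T + E" by (simp add: E_def)
  have "T \<odot> X = T \<odot> R - T \<odot> (R \<odot> (E \<odot> X))"
    using X R E T by (metis mult_diff(2) mult_closed)
  also have "T \<odot> (R \<odot> (E \<odot> X)) = E \<odot> X"
    using X R E T by (simp add: mult_assoc[symmetric] mult_closed mult_id_left)
  finally have right: "T' \<odot> X = id_blinfun"
    using X R E T(1) by (simp add: T' mult_add_left)
  have "Y \<odot> T = R \<odot> T - ((Y \<odot> E) \<odot> R) \<odot> T"
    using Y R E T by (metis mult_diff(1) mult_closed)
  also have "((Y \<odot> E) \<odot> R) \<odot> T = Y \<odot> E"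
    using Y R E T by (simp add: mult_assoc mult_closed mult_id_right)
  finally have left: "Y \<odot> T' = id_blinfun"
    using Y R E T(1) by (simp add: T' mult_add_right)
  have "Y = (Y \<odot> T') \<odot> X"
    using X Y T right by (simp add: mult_assoc mult_id_right)
  then have "Y = X" using X left by (simp add: mult_id_left)
  then show ?thesis
    using that[of X] X left right by (simp add: is_op_inverse_def)
qed

end


section \<open>The resolvent in the complexified operator algebra\<close>

locale operator_in_algebra = operator_algebra lact ract B
  for lact :: "'f::weak_cone_algebra \<Rightarrow> 'y::banach \<Rightarrow> 'y"
    and ract :: "'y \<Rightarrow> 'f \<Rightarrow> 'y"
    and B :: "('f, 'y \<Rightarrow>\<^sub>L 'y) op_structure" +
  fixes A :: "'y \<Rightarrow>\<^sub>L 'y"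
  assumes A: "A \<in> ops B"
begin

text \<open>
  The operator \<open>Q\<^sub>s(A)\<close> as a function of the complex coordinate of \<open>s\<close>; it is the same on every slice.
\<close>

definition Q :: "complex \<Rightarrow> 'y \<Rightarrow>\<^sub>L 'y" where
  "Q z = A \<odot> A - (2 * Re z) *\<^sub>R A + (cmod z)\<^sup>2 *\<^sub>R id_blinfun"

definition resolvent_region :: "complex set" where
  "resolvent_region = {z. \<exists>R. is_op_inverse B (Q z) R}"

definition Q_inv :: "complex \<Rightarrow> 'y \<Rightarrow>\<^sub>L 'y" where
  "Q_inv z = op_inv B (Q z)"

text \<open>
  \<open>res_re z + \<i> res_im z\<close> is the resolvent \<open>(z - A)\<^sup>-\<^sup>1 = (cnj z - A) Q\<^sub>z\<^sup>-\<^sup>1\<close> in the complexification.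
\<close>

definition res_re :: "complex \<Rightarrow> 'y \<Rightarrow>\<^sub>L 'y" where
  "res_re z = Re z *\<^sub>R Q_inv z - A \<odot> Q_inv z"

definition res_im :: "complex \<Rightarrow> 'y \<Rightarrow>\<^sub>L 'y" where
  "res_im z = - (Im z *\<^sub>R Q_inv z)"

lemma Q_in_ops: "Q z \<in> ops B"
  unfolding Q_def by (intro ops_intros A)

lemma Q_inv_inverse:
  assumes "z \<in> resolvent_region"
  shows "Q_inv z \<in> ops B" "Q z \<odot> Q_inv z = id_blinfun" "Q_inv z \<odot> Q z = id_blinfun"
    "is_op_inverse B (Q z) (Q_inv z)"
proof -
  show *: "is_op_inverse B (Q z) (Q_inv z)"
  proof -
    obtain R where R: "is_op_inverse B (Q z) R"
      using assms by (auto simp: resolvent_region_def)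
    show ?thesis unfolding Q_inv_def op_inv_eq[OF Q_in_ops R] by (rule R)
  qed
  then show "Q_inv z \<in> ops B" "Q z \<odot> Q_inv z = id_blinfun" "Q_inv z \<odot> Q z = id_blinfun"
    by (auto simp: is_op_inverse_def)
qed

lemma res_in_ops:
  assumes "z \<in> resolvent_region"
  shows "res_re z \<in> ops B" "res_im z \<in> ops B"
  using Q_inv_inverse(1)[OF assms]
  by (auto simp: res_re_def res_im_def intro: ops_intros A ops_neg)

lemma continuous_Q: "continuous_on UNIV Q"
  unfolding Q_def[abs_def] by (intro continuous_intros)

lemma open_resolvent_region: "open resolvent_region"
  unfolding open_dist
proof
  fix z assume z: "z \<in> resolvent_region"
  note q = Q_inv_inverse[OF z]
  have "isCont Q z" using continuous_Q by (simp add: continuous_on_eq_continuous_at)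
  moreover have "1 / (norm (Q_inv z) + 1) > 0" by (simp add: add_nonneg_pos)
  ultimately obtain d where d: "d > 0" "\<And>w. dist w z < d \<Longrightarrow> dist (Q w) (Q z) < 1 / (norm (Q_inv z) + 1)"
    unfolding continuous_at_eps_delta by blast
  have "w \<in> resolvent_region" if "dist w z < d" for w
  proof -
    have "norm (Q w - Q z) * (norm (Q_inv z) + 1) < 1"
      using d(2)[OF that] by (simp add: dist_norm pos_less_divide_eq add_nonneg_pos)
    then have "norm (Q w - Q z) * norm (Q_inv z) < 1"
      by (simp add: distrib_left) (smt (verit) norm_ge_zero)
    then show ?thesis
      using perturbed_inverse[OF Q_in_ops Q_in_ops q(4)] by (auto simp: resolvent_region_def)
  qed
  then show "\<exists>e>0. \<forall>w. dist w z < e \<longrightarrow> w \<in> resolvent_region" using d(1) by blast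
qed

lemma Q_inv_diff:
  assumes w: "w \<in> resolvent_region" and z: "z \<in> resolvent_region"
  shows "Q_inv w - Q_inv z = Q_inv w \<odot> ((Q z - Q w) \<odot> Q_inv z)"
proof -
  note qw = Q_inv_inverse[OF w] and qz = Q_inv_inverse[OF z]
  have "Q_inv w \<odot> ((Q z - Q w) \<odot> Q_inv z)
      = Q_inv w \<odot> (Q z \<odot> Q_inv z) - Q_inv w \<odot> (Q w \<odot> Q_inv z)"
    using qw(1) qz(1) by (simp add: mult_diff Q_in_ops mult_closed)
  also have "Q_inv w \<odot> (Q w \<odot> Q_inv z) = Q_inv z"
    using qw qz by (simp add: mult_assoc[symmetric] Q_in_ops mult_id_left)
  also have "Q_inv w \<odot> (Q z \<odot> Q_inv z) = Q_inv w"
    using qw qz by (simp add: mult_id_right)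
  finally show ?thesis by simp
qed

lemma continuous_Q_inv: "continuous_on resolvent_region Q_inv"
  unfolding continuous_on_eq_continuous_at[OF open_resolvent_region]
proof
  fix z assume z: "z \<in> resolvent_region"
  let ?n = "norm (Q_inv z)"
  have Q0: "((\<lambda>w. norm (Q z - Q w)) \<longlongrightarrow> 0) (at z)"
  proof -
    have "(Q \<longlongrightarrow> Q z) (at z)"
      using continuous_Q by (simp add: continuous_on_eq_continuous_at isCont_def)
    then have "((\<lambda>w. norm (Q z - Q w)) \<longlongrightarrow> norm (Q z - Q z)) (at z)"
      by (intro tendsto_intros)
    then show ?thesis by simp
  qed
  \<comment> \<open>Within this distance of \<open>Q z\<close> the inverse has at most twice the norm of \<open>Q_inv z\<close>; the \<open>+ 1\<close> keeps the bound finite.\<close>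
  have "1 / (2 * (?n + 1)) > 0" by (simp add: add_nonneg_pos)
  from order_tendstoD(2)[OF Q0 this]
  have small: "\<forall>\<^sub>F w in at z. norm (Q z - Q w) < 1 / (2 * (?n + 1))" .
  have near: "\<forall>\<^sub>F w in at z. w \<in> resolvent_region"
    using open_resolvent_region z by (auto simp: eventually_at_topological)
  have "\<forall>\<^sub>F w in at z. norm (Q_inv w - Q_inv z) \<le> 2 * ?n * ?n * norm (Q z - Q w)"
    using small near
  proof eventually_elim
    case (elim w)
    let ?e = "norm (Q z - Q w)"
    note qw = Q_inv_inverse(1)[OF elim(2)] and qz = Q_inv_inverse(1)[OF z]
    have diff: "norm (Q_inv w - Q_inv z) \<le> norm (Q_inv w) * (?e * ?n)"
      unfolding Q_inv_diff[OF elim(2) z] using qw qz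
      by (intro order_trans[OF norm_mult] mult_left_mono norm_mult) (auto intro: ops_intros Q_in_ops)
    have "?e * (2 * (?n + 1)) < 1"
      using elim(1) by (simp add: pos_less_divide_eq add_nonneg_pos)
    then have e: "?e * ?n \<le> 1 / 2"
      by (simp add: algebra_simps) (smt (verit) norm_ge_zero)
    have "norm (Q_inv w) * (?e * ?n) \<le> norm (Q_inv w) * (1 / 2)"
      using e by (intro mult_left_mono) auto
    moreover have "norm (Q_inv w) \<le> ?n + norm (Q_inv w - Q_inv z)"
      by (metis add.commute norm_triangle_sub)
    ultimately have "norm (Q_inv w) \<le> 2 * ?n" using diff by linarith
    then have "norm (Q_inv w) * (?e * ?n) \<le> 2 * ?n * (?e * ?n)"
      by (intro mult_right_mono) auto
    with diff show ?case by (simp add: mult_ac)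
  qed
  moreover have "((\<lambda>w. 2 * ?n * ?n * norm (Q z - Q w)) \<longlongrightarrow> 0) (at z)"
    using tendsto_mult_right_zero[OF Q0] by simp
  ultimately have "((\<lambda>w. Q_inv w - Q_inv z) \<longlongrightarrow> 0) (at z)"
    by (rule Lim_null_comparison)
  then show "isCont Q_inv z"
    unfolding isCont_def by (simp add: LIM_zero_iff)
qed

lemma continuous_res: "continuous_on resolvent_region res_re" "continuous_on resolvent_region res_im"
proof -
  have "continuous_on resolvent_region (\<lambda>z. A \<odot> Q_inv z)"
    by (rule continuous_on_compose2[OF continuous_on_bounded_linear_on[OF
          bounded_linear_on_mult_left[OF A] subspace_ops] continuous_Q_inv])
      (auto dest: Q_inv_inverse(1))
  then show "continuous_on resolvent_region res_re" "continuous_on resolvent_region res_im"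
    unfolding res_re_def[abs_def] res_im_def[abs_def]
    by (auto intro!: continuous_intros continuous_Q_inv)
qed

lemma Q_mult: "T \<in> ops B \<Longrightarrow> Q z \<odot> T = A \<odot> (A \<odot> T) - (2 * Re z) *\<^sub>R (A \<odot> T) + (cmod z)\<^sup>2 *\<^sub>R T"
  using A by (simp add: Q_def mult_add_left mult_diff scaleR_mult_left mult_id_left mult_assoc ops_intros)

lemma mult_Q:
  assumes "T \<in> ops B"
  shows "T \<odot> Q z = (T \<odot> A) \<odot> A - (2 * Re z) *\<^sub>R (T \<odot> A) + (cmod z)\<^sup>2 *\<^sub>R T"
  using A assms
  by (simp add: Q_def mult_add_right mult_diff scaleR_mult_right mult_id_right mult_assoc ops_intros)

lemma A_Q_inv: "z \<in> resolvent_region \<Longrightarrow> Q_inv z \<odot> A = A \<odot> Q_inv z"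
  using inverse_commute[OF Q_in_ops A Q_inv_inverse(4)] A by (simp add: Q_mult mult_Q mult_assoc)

lemma Q_inv_commute:
  assumes w: "w \<in> resolvent_region" and z: "z \<in> resolvent_region"
  shows "Q_inv w \<odot> Q_inv z = Q_inv z \<odot> Q_inv w"
proof (rule inverse_commute[OF Q_in_ops _ Q_inv_inverse(4)[OF z]])
  note q = Q_inv_inverse(1)[OF w]
  then show "Q_inv w \<odot> Q z = Q z \<odot> Q_inv w"
    using A by (simp add: Q_mult mult_Q A_Q_inv[OF w] mult_assoc mult_closed)
qed (rule Q_inv_inverse(1)[OF w])

text \<open>
  The components of the product of the resolvents at \<open>w\<close> and \<open>z\<close>.
\<close>

definition res_prod_re :: "complex \<Rightarrow> complex \<Rightarrow> 'y \<Rightarrow>\<^sub>L 'y" where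
  "res_prod_re w z = res_re w \<odot> res_re z - res_im w \<odot> res_im z"

definition res_prod_im :: "complex \<Rightarrow> complex \<Rightarrow> 'y \<Rightarrow>\<^sub>L 'y" where
  "res_prod_im w z = res_re w \<odot> res_im z + res_im w \<odot> res_re z"

text \<open>
  The components of \<open>(w - A)\<^sup>-\<^sup>1 - (z - A)\<^sup>-\<^sup>1 = - (w - z) (w - A)\<^sup>-\<^sup>1 (z - A)\<^sup>-\<^sup>1\<close>. As everything commutes with \<open>A\<close>, both
  sides are real polynomials in \<open>A\<close> times \<open>K = Q\<^sub>w\<^sup>-\<^sup>1 Q\<^sub>z\<^sup>-\<^sup>1\<close>, and the coefficients of \<open>K, A K, A\<^sup>2 K, A\<^sup>3 K\<close> agree.
\<close>

lemma resolvent_identity: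
  assumes w: "w \<in> resolvent_region" and z: "z \<in> resolvent_region"
  shows "res_re w - res_re z = Im (w - z) *\<^sub>R res_prod_im w z - Re (w - z) *\<^sub>R res_prod_re w z"
    and "res_im w - res_im z = - (Im (w - z) *\<^sub>R res_prod_re w z) - Re (w - z) *\<^sub>R res_prod_im w z"
proof -
  note qw = Q_inv_inverse[OF w] and qz = Q_inv_inverse[OF z]
  define K where "K = Q_inv w \<odot> Q_inv z"
  define K1 where "K1 = A \<odot> K"
  define K2 where "K2 = A \<odot> K1"
  define K3 where "K3 = A \<odot> K2"
  have K: "K \<in> ops B" "K1 \<in> ops B" "K2 \<in> ops B"
    using qw(1) qz(1) A by (auto simp: K_def K1_def K2_def mult_closed)
  have Kz: "Q_inv z = K2 - (2 * Re w) *\<^sub>R K1 + (cmod w)\<^sup>2 *\<^sub>R K"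
  proof -
    have "Q_inv z = Q w \<odot> K"
      using qw qz by (simp add: K_def mult_assoc[symmetric] Q_in_ops mult_id_left)
    then show ?thesis using Q_mult[OF K(1)] by (simp add: K1_def K2_def)
  qed
  have Kw: "Q_inv w = K2 - (2 * Re z) *\<^sub>R K1 + (cmod z)\<^sup>2 *\<^sub>R K"
  proof -
    have "Q_inv w = Q z \<odot> K"
      unfolding K_def Q_inv_commute[OF w z]
      using qw qz by (simp add: mult_assoc[symmetric] Q_in_ops mult_id_left)
    then show ?thesis using Q_mult[OF K(1)] by (simp add: K1_def K2_def)
  qed
  have AK: "A \<odot> (K2 - c *\<^sub>R K1 + d *\<^sub>R K) = K3 - c *\<^sub>R K2 + d *\<^sub>R K1" for c d
    using A K by (simp add: K1_def[symmetric] K2_def[symmetric] K3_def[symmetric]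
        mult_add_right mult_diff scaleR_mult_right ops_intros)
  have p1: "Q_inv w \<odot> (A \<odot> Q_inv z) = K1"
    using A qw(1) qz(1) by (simp add: mult_assoc[symmetric] A_Q_inv[OF w]) (simp add: mult_assoc K1_def K_def)
  have p2: "(A \<odot> Q_inv w) \<odot> Q_inv z = K1"
    using A qw(1) qz(1) by (simp add: mult_assoc K1_def K_def)
  have p3: "(A \<odot> Q_inv w) \<odot> (A \<odot> Q_inv z) = K2"
    using A qw(1) qz(1) p1 by (simp add: mult_assoc mult_closed K2_def)
  have re: "res_prod_re w z = (Re w * Re z - Im w * Im z) *\<^sub>R K - (Re w + Re z) *\<^sub>R K1 + K2"
  proof -
    have "res_re w \<odot> res_re z = (Re w * Re z) *\<^sub>R K - Re w *\<^sub>R K1 - Re z *\<^sub>R K1 + K2"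
      using A qw(1) qz(1)
      by (simp add: res_re_def mult_diff scaleR_mult_left scaleR_mult_right p1 p2 p3 K_def[symmetric]
          ops_intros algebra_simps)
    moreover have "res_im w \<odot> res_im z = (Im w * Im z) *\<^sub>R K"
      using scaleR_mult_left[of "Q_inv w" "(- Im z) *\<^sub>R Q_inv z" "- Im w"]
        scaleR_mult_right[of "Q_inv w" "Q_inv z" "- Im z"] ops_scale[OF qz(1), of "- Im z"] qw(1) qz(1)
      by (simp add: res_im_def K_def)
    ultimately show ?thesis by (simp add: res_prod_re_def algebra_simps)
  qed
  have im: "res_prod_im w z = (Im w + Im z) *\<^sub>R K1 - (Re w * Im z + Im w * Re z) *\<^sub>R K"
  proof -
    have "res_re w \<odot> res_im z = Im z *\<^sub>R K1 - (Re w * Im z) *\<^sub>R K"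
    proof -
      have "res_re w \<odot> ((- Im z) *\<^sub>R Q_inv z) = (- Im z) *\<^sub>R (Re w *\<^sub>R K - K1)"
        using A qw(1) qz(1) res_in_ops(1)[OF w]
        by (subst scaleR_mult_right)
          (simp_all add: res_re_def mult_diff scaleR_mult_left p2 K_def[symmetric] ops_intros)
      then show ?thesis by (simp add: res_im_def algebra_simps)
    qed
    moreover have "res_im w \<odot> res_re z = Im w *\<^sub>R K1 - (Im w * Re z) *\<^sub>R K"
    proof -
      have "((- Im w) *\<^sub>R Q_inv w) \<odot> res_re z = (- Im w) *\<^sub>R (Re z *\<^sub>R K - K1)"
        using A qw(1) qz(1) res_in_ops(1)[OF z]
        by (subst scaleR_mult_left)
          (simp_all add: res_re_def mult_diff scaleR_mult_right p1 K_def[symmetric] ops_intros)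
      then show ?thesis by (simp add: res_im_def algebra_simps)
    qed
    ultimately show ?thesis by (simp add: res_prod_im_def algebra_simps)
  qed
  have c: "(cmod z)\<^sup>2 = (Re z)\<^sup>2 + (Im z)\<^sup>2" for z by (simp add: cmod_def)
  show "res_re w - res_re z = Im (w - z) *\<^sub>R res_prod_im w z - Re (w - z) *\<^sub>R res_prod_re w z"
    unfolding res_re_def re im Kz Kw AK c
  proof (rule eq_if_functionals_eq)
    fix \<phi> :: "('y \<Rightarrow>\<^sub>L 'y) \<Rightarrow> real" assume "bounded_linear \<phi>"
    then have "linear \<phi>" by (rule bounded_linear.linear)
    then show "\<phi> (Re w *\<^sub>R (K2 - (2 * Re z) *\<^sub>R K1 + ((Re z)\<^sup>2 + (Im z)\<^sup>2) *\<^sub>R K) -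
           (K3 - (2 * Re z) *\<^sub>R K2 + ((Re z)\<^sup>2 + (Im z)\<^sup>2) *\<^sub>R K1) -
           (Re z *\<^sub>R (K2 - (2 * Re w) *\<^sub>R K1 + ((Re w)\<^sup>2 + (Im w)\<^sup>2) *\<^sub>R K) -
            (K3 - (2 * Re w) *\<^sub>R K2 + ((Re w)\<^sup>2 + (Im w)\<^sup>2) *\<^sub>R K1)))
      = \<phi> (Im (w - z) *\<^sub>R ((Im w + Im z) *\<^sub>R K1 - (Re w * Im z + Im w * Re z) *\<^sub>R K) -
          Re (w - z) *\<^sub>R ((Re w * Re z - Im w * Im z) *\<^sub>R K - (Re w + Re z) *\<^sub>R K1 + K2))"
      by (simp add: linear_add linear_diff linear_scale) algebra
  qed
  show "res_im w - res_im z = - (Im (w - z) *\<^sub>R res_prod_re w z) - Re (w - z) *\<^sub>R res_prod_im w z"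
    unfolding res_im_def re im Kz Kw c
  proof (rule eq_if_functionals_eq)
    fix \<phi> :: "('y \<Rightarrow>\<^sub>L 'y) \<Rightarrow> real" assume "bounded_linear \<phi>"
    then have "linear \<phi>" by (rule bounded_linear.linear)
    then show "\<phi> (- (Im w *\<^sub>R (K2 - (2 * Re z) *\<^sub>R K1 + ((Re z)\<^sup>2 + (Im z)\<^sup>2) *\<^sub>R K)) -
           - (Im z *\<^sub>R (K2 - (2 * Re w) *\<^sub>R K1 + ((Re w)\<^sup>2 + (Im w)\<^sup>2) *\<^sub>R K)))
      = \<phi> (- (Im (w - z) *\<^sub>R ((Re w * Re z - Im w * Im z) *\<^sub>R K - (Re w + Re z) *\<^sub>R K1 + K2)) -
          Re (w - z) *\<^sub>R ((Im w + Im z) *\<^sub>R K1 - (Re w * Im z + Im w * Re z) *\<^sub>R K))"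
      by (simp add: linear_add linear_diff linear_scale linear_neg) algebra
  qed
qed

text \<open>
  By the resolvent identity the difference quotient of each scalar component is minus the product of the
  resolvents, which is continuous in the first argument.
\<close>

lemma weakly_holomorphic_resolvent:
  fixes M :: "('y \<Rightarrow>\<^sub>L 'y) \<Rightarrow> 'e::real_normed_vector"
  assumes M: "bounded_linear_on (ops B) M"
  shows "weakly_holomorphic_on resolvent_region (\<lambda>z. M (res_re z)) (\<lambda>z. M (res_im z))"
  unfolding weakly_holomorphic_on_def
proof (intro conjI allI impI)
  show "continuous_on resolvent_region (\<lambda>z. M (res_re z))" "continuous_on resolvent_region (\<lambda>z. M (res_im z))"
    using res_in_ops
    by (auto intro!: continuous_on_compose2[OF continuous_on_bounded_linear_on[OF M subspace_ops]]
        continuous_res)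
next
  fix \<phi> :: "'e \<Rightarrow> real" assume "bounded_linear \<phi>"
  \<comment> \<open>From here on only the scalar functional \<open>\<mu>\<close> matters, which is bounded and linear on \<open>ops B\<close>.\<close>
  define \<mu> where "\<mu> T = \<phi> (M T)" for T
  have \<mu>: "bounded_linear_on (ops B) \<mu>"
    unfolding \<mu>_def by (rule bounded_linear_on_compose[OF \<open>bounded_linear \<phi>\<close> M])
  note \<mu>_diff = bounded_linear_on_diff[OF \<mu> subspace_ops]
  have \<mu>_scale: "\<mu> (c *\<^sub>R T) = c * \<mu> T" if "T \<in> ops B" for c T
    using \<mu> that by (auto simp: bounded_linear_on_def)
  have \<mu>_neg: "\<mu> (- T) = - \<mu> T" if "T \<in> ops B" for T
    using \<mu>_scale[OF that, of "- 1"] by simp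
  define \<psi> where "\<psi> z = Complex (\<mu> (res_re z)) (\<mu> (res_im z))" for z
  define D where "D w z = - Complex (\<mu> (res_prod_re w z)) (\<mu> (res_prod_im w z))" for w z
  have "(\<psi> has_field_derivative D z z) (at z)" if z: "z \<in> resolvent_region" for z
  proof -
    have ops: "res_prod_re w z \<in> ops B" "res_prod_im w z \<in> ops B" if "w \<in> resolvent_region" for w
      using res_in_ops[OF that] res_in_ops[OF z]
      by (auto simp: res_prod_re_def res_prod_im_def intro: ops_intros)
    have quot: "(\<psi> w - \<psi> z) / (w - z) = D w z" if w: "w \<in> resolvent_region" "w \<noteq> z" for w
    proof -
      have "\<mu> (res_re w) - \<mu> (res_re z)
          = Im (w - z) * \<mu> (res_prod_im w z) - Re (w - z) * \<mu> (res_prod_re w z)"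
        using ops[OF w(1)] res_in_ops[OF w(1)] res_in_ops[OF z]
        by (simp add: \<mu>_diff[symmetric] resolvent_identity(1)[OF w(1) z])
          (simp add: \<mu>_diff \<mu>_scale ops_scale)
      moreover have "\<mu> (res_im w) - \<mu> (res_im z)
          = - (Im (w - z) * \<mu> (res_prod_re w z)) - Re (w - z) * \<mu> (res_prod_im w z)"
        using ops[OF w(1)] res_in_ops[OF w(1)] res_in_ops[OF z]
        by (simp add: \<mu>_diff[symmetric] resolvent_identity(2)[OF w(1) z])
          (simp add: \<mu>_diff \<mu>_neg \<mu>_scale ops_scale ops_neg)
      ultimately have "\<psi> w - \<psi> z = D w z * (w - z)"
        by (simp add: \<psi>_def D_def complex_eq_iff)
      then show ?thesis using w(2) by simp
    qed
    have cont: "continuous_on resolvent_region (\<lambda>w. \<mu> (res_re w \<odot> T))"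
        "continuous_on resolvent_region (\<lambda>w. \<mu> (res_im w \<odot> T))" if "T \<in> ops B" for T
      using res_in_ops that
      by (auto intro!: continuous_on_compose2[OF continuous_on_bounded_linear_on[OF \<mu> subspace_ops]]
          continuous_on_compose2[OF continuous_on_bounded_linear_on[OF
              bounded_linear_on_mult_right[OF that] subspace_ops]] continuous_res mult_closed)
    have "continuous_on resolvent_region (\<lambda>w. D w z)"
    proof -
      have "D w z = - Complex (\<mu> (res_re w \<odot> res_re z) - \<mu> (res_im w \<odot> res_im z))
          (\<mu> (res_re w \<odot> res_im z) + \<mu> (res_im w \<odot> res_re z))" if "w \<in> resolvent_region" for w
        using res_in_ops[OF that] res_in_ops[OF z] \<mu>
        by (simp add: D_def res_prod_re_def res_prod_im_def \<mu>_diff mult_closed bounded_linear_on_def)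
      then show ?thesis
        using res_in_ops[OF z] cont
        by (subst continuous_on_cong[OF refl]) (auto intro!: continuous_intros continuous_on_Complex)
    qed
    then have "((\<lambda>w. D w z) \<longlongrightarrow> D z z) (at z)"
      using z open_resolvent_region by (simp add: continuous_on_eq_continuous_at isCont_def)
    moreover have "\<forall>\<^sub>F w in at z. D w z = (\<psi> w - \<psi> z) / (w - z)"
      using open_resolvent_region z quot by (auto simp: eventually_at_topological)
    ultimately show ?thesis
      unfolding has_field_derivative_iff by (rule Lim_transform_eventually)
  qed
  then show "(\<lambda>z. Complex (\<phi> (M (res_re z))) (\<phi> (M (res_im z)))) holomorphic_on resolvent_region"
    unfolding \<psi>_def \<mu>_def using open_resolvent_region
    by (auto simp: holomorphic_on_open)
qed

lemma resolvent_region_cnj: "cnj z \<in> resolvent_region \<longleftrightarrow> z \<in> resolvent_region"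
  by (simp add: resolvent_region_def Q_def)

lemma res_cnj: "res_re (cnj z) = res_re z" "res_im (cnj z) = - res_im z"
  by (simp_all add: res_re_def res_im_def Q_inv_def Q_def)

lemma Q_op_in_slice:
  assumes "J \<in> imag_units"
  shows "Q_op B (in_slice J z) A = Q z"
proof -
  have "2 *\<^sub>R cone_Re (in_slice J z) = of_real (2 * Re z)"
    by (simp add: cone_Re_in_slice[OF assms] of_real_eq_scaleR_one)
  then show ?thesis
    by (simp only: Q_op_def Q_def norm_in_slice[OF assms] lscale_of_real[OF A])
qed

lemma slice_of_S_spectrum: "J \<in> imag_units \<Longrightarrow> slice_of J (S_spectrum B A) = - resolvent_region"
  by (auto simp: slice_of_def S_spectrum_def S_resolvent_set_def Q_op_in_slice
      in_slice_mem_weak_cone resolvent_region_def)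

lemma lscale_conjg_in_slice:
  assumes J: "J \<in> imag_units"
  shows "op_lscale B (conjg (in_slice J z)) id_blinfun
    = Re z *\<^sub>R id_blinfun - Im z *\<^sub>R op_lscale B J id_blinfun"
proof -
  have "conjg (in_slice J z) = of_real (Re z) + (- Im z) *\<^sub>R J"
    unfolding conjg_in_slice[OF J] by (simp add: in_slice_eq of_real_eq_scaleR_one)
  then have "op_lscale B (conjg (in_slice J z)) id_blinfun
      = op_lscale B (of_real (Re z)) id_blinfun + op_lscale B ((- Im z) *\<^sub>R J) id_blinfun"
    by (simp only: lscale_add_left[OF id_in_ops])
  then show ?thesis
    by (simp only: lscale_of_real[OF id_in_ops] lscale_scaleR(2)[OF id_in_ops]) simp
qed

lemma S_resolvent_L_in_slice:
  assumes J: "J \<in> imag_units" and z: "z \<in> resolvent_region"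
  shows "S_resolvent_L B (in_slice J z) A = res_re z + op_rscale B (res_im z) J"
proof -
  note q = Q_inv_inverse(1)[OF z]
  have "Q_inv z \<odot> op_lscale B J id_blinfun = op_rscale B (Q_inv z) J"
    using rscale_mid[OF q id_in_ops, of J] by (simp add: mult_id_right rscale_closed q)
  then have "S_resolvent_L B (in_slice J z) A
      = - (A \<odot> Q_inv z - (Re z *\<^sub>R Q_inv z - Im z *\<^sub>R op_rscale B (Q_inv z) J))"
    unfolding S_resolvent_L_def Q_op_in_slice[OF J] Q_inv_def[symmetric] lscale_conjg_in_slice[OF J]
    using q A by (simp add: mult_diff scaleR_mult_right mult_id_right A_Q_inv[OF z] ops_intros)
  moreover have "op_rscale B (res_im z) J = - (Im z *\<^sub>R op_rscale B (Q_inv z) J)"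
    using rscale_scaleR(1)[OF q, of "- Im z" J] by (simp add: res_im_def)
  ultimately show ?thesis by (simp add: res_re_def)
qed

lemma S_resolvent_R_in_slice:
  assumes J: "J \<in> imag_units" and z: "z \<in> resolvent_region"
  shows "S_resolvent_R B (in_slice J z) A = res_re z + op_lscale B J (res_im z)"
proof -
  note q = Q_inv_inverse(1)[OF z]
  have "op_lscale B J id_blinfun \<odot> Q_inv z = op_lscale B J (Q_inv z)"
    using lscale_op_mult[OF id_in_ops q, of J] by (simp add: mult_id_left q)
  then have "S_resolvent_R B (in_slice J z) A
      = - (A \<odot> Q_inv z - (Re z *\<^sub>R Q_inv z - Im z *\<^sub>R op_lscale B J (Q_inv z)))"
    unfolding S_resolvent_R_def Q_op_in_slice[OF J] Q_inv_def[symmetric] lscale_conjg_in_slice[OF J]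
    using q A by (simp add: mult_diff scaleR_mult_left mult_id_left ops_intros)
  moreover have "op_lscale B J (res_im z) = - (Im z *\<^sub>R op_lscale B J (Q_inv z))"
    using lscale_scaleR(1)[OF q, of J "- Im z"] by (simp add: res_im_def)
  ultimately show ?thesis by (simp add: res_re_def)
qed

end


section \<open>The forms behind the integrands\<close>

text \<open>
  The differential equations for \<open>f0\<close> and \<open>f1\<close> are the Cauchy-Riemann equations of \<open>f0 + \<i> f1\<close>.
\<close>

lemma slice_pair_holomorphic:
  assumes V: "axial_base V" and f: "slice_pair V f0 f1" and \<phi>: "bounded_linear \<phi>"
  shows "(\<lambda>z. Complex (\<phi> (f0 (Re z, Im z))) (\<phi> (f1 (Re z, Im z)))) holomorphic_on base_region V"
proof -
  obtain f0u f0v f1u f1v where C1: "C1_with_partials V f0 f0u f0v" "C1_with_partials V f1 f1u f1v"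
    and CR: "\<And>p. p \<in> V \<Longrightarrow> f0u p = f1v p \<and> f0v p = - f1u p"
    using f unfolding slice_pair_def by blast
  have coords: "((\<lambda>z. (Re z, Im z)) has_derivative (\<lambda>h. (Re h, Im h))) (at z)" for z
    by (intro derivative_eq_intros) auto
  have partial: "((\<lambda>z. complex_of_real (\<phi> (g (Re z, Im z)))) has_derivative
      (\<lambda>h. complex_of_real (Re h * \<phi> (gu (Re z, Im z)) + Im h * \<phi> (gv (Re z, Im z))))) (at z)"
    if g: "C1_with_partials V g gu gv" and z: "(Re z, Im z) \<in> V" for g gu gv z
  proof -
    have "(g has_derivative (\<lambda>(h, k). h *\<^sub>R gu (Re z, Im z) + k *\<^sub>R gv (Re z, Im z)))
        (at (Re z, Im z))"
      using g z by (auto simp: C1_with_partials_def)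
    from has_derivative_compose[OF coords this]
    have "((\<lambda>z. g (Re z, Im z)) has_derivative
        (\<lambda>h. Re h *\<^sub>R gu (Re z, Im z) + Im h *\<^sub>R gv (Re z, Im z))) (at z)"
      by simp
    from bounded_linear.has_derivative[OF bounded_linear_of_real bounded_linear.has_derivative[OF \<phi> this]]
    show ?thesis
      using bounded_linear.linear[OF \<phi>] by (simp add: linear_add linear_scale)
  qed
  have "((\<lambda>z. Complex (\<phi> (f0 (Re z, Im z))) (\<phi> (f1 (Re z, Im z)))) has_field_derivative
      Complex (\<phi> (f0u (Re z, Im z))) (\<phi> (f1u (Re z, Im z)))) (at z)" if "z \<in> base_region V" for z
  proof -
    let ?p = "(Re z, Im z)"
    have p: "?p \<in> V" using that by (simp add: base_region_def)
    have "((\<lambda>z. complex_of_real (\<phi> (f0 (Re z, Im z))) + \<i> * complex_of_real (\<phi> (f1 (Re z, Im z))))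
        has_derivative (\<lambda>h. complex_of_real (Re h * \<phi> (f0u ?p) + Im h * \<phi> (f0v ?p))
          + \<i> * complex_of_real (Re h * \<phi> (f1u ?p) + Im h * \<phi> (f1v ?p)))) (at z)"
      by (intro has_derivative_add has_derivative_mult_right partial C1 p)
    moreover have "(\<lambda>h. complex_of_real (Re h * \<phi> (f0u ?p) + Im h * \<phi> (f0v ?p))
          + \<i> * complex_of_real (Re h * \<phi> (f1u ?p) + Im h * \<phi> (f1v ?p)))
        = (*) (Complex (\<phi> (f0u ?p)) (\<phi> (f1u ?p)))"
      using CR[OF p] bounded_linear.linear[OF \<phi>]
      by (auto simp: complex_eq_iff linear_neg algebra_simps)
    ultimately show ?thesis
      by (simp add: has_field_derivative_def Complex_eq)
  qed
  then show ?thesis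
    by (auto simp: holomorphic_on_open[OF open_base_region[OF V]])
qed

text \<open>
  All that the integrals see of the domain \<open>U\<close> is its slice in complex coordinates, which is invariant under
  conjugation because \<open>U\<close> is axially symmetric.
\<close>

lemma admissible_choice_slice:
  assumes adm: "admissible_choice K (axial_set V) J U \<gamma>s" and V: "axial_base V"
  obtains W where "open W" "bounded W" "\<And>z. cnj z \<in> W \<longleftrightarrow> z \<in> W" "closure W \<subseteq> base_region V"
    "slice_of J K \<subseteq> W" "positively_oriented_boundary \<gamma>s W"
proof -
  have J: "J \<in> imag_units" using adm by (simp add: admissible_choice_def)
  obtain V' where V': "axial_base V'" "U = axial_set V'"
    using adm by (auto simp: admissible_choice_def slice_cauchy_domain_def axially_symmetric_open_def)
  show ?thesis
  proof (rule that[of "slice_of J U"])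
    have eq: "slice_of J U = base_region V'"
      by (simp add: V'(2) slice_of_axial_set[OF V'(1) J])
    show "open (slice_of J U)" "cnj z \<in> slice_of J U \<longleftrightarrow> z \<in> slice_of J U" for z
      by (simp_all add: eq open_base_region cnj_base_region V'(1))
    show "bounded (slice_of J U)"
      using adm by (intro bounded_slice_of J) (simp add: admissible_choice_def)
    have "slice_of J (closure U) \<subseteq> slice_of J (axial_set V)"
      using adm by (auto simp: admissible_choice_def slice_of_def)
    then show "closure (slice_of J U) \<subseteq> base_region V"
      using closure_slice_of[of J U] by (simp add: slice_of_axial_set[OF V J])
    show "slice_of J K \<subseteq> slice_of J U" "positively_oriented_boundary \<gamma>s (slice_of J U)"
      using adm by (auto simp: admissible_choice_def slice_of_def)
  qed
qed

context operator_in_algebra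
begin

text \<open>
  The components of \<open>\<Sum>\<^sub>u F\<^sub>u(z) (M\<^sub>u (res_re z) + \<i> M\<^sub>u (res_im z))\<close>.
\<close>

definition sum_form_re ::
    "('f \<Rightarrow> complex \<Rightarrow> complex) \<Rightarrow> ('f \<Rightarrow> ('y \<Rightarrow>\<^sub>L 'y) \<Rightarrow> ('y \<Rightarrow>\<^sub>L 'y)) \<Rightarrow> complex \<Rightarrow> 'y \<Rightarrow>\<^sub>L 'y" where
  "sum_form_re F M z = (\<Sum>u\<in>ubasis. Re (F u z) *\<^sub>R M u (res_re z) - Im (F u z) *\<^sub>R M u (res_im z))"

definition sum_form_im ::
    "('f \<Rightarrow> complex \<Rightarrow> complex) \<Rightarrow> ('f \<Rightarrow> ('y \<Rightarrow>\<^sub>L 'y) \<Rightarrow> ('y \<Rightarrow>\<^sub>L 'y)) \<Rightarrow> complex \<Rightarrow> 'y \<Rightarrow>\<^sub>L 'y" where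
  "sum_form_im F M z = (\<Sum>u\<in>ubasis. Re (F u z) *\<^sub>R M u (res_im z) + Im (F u z) *\<^sub>R M u (res_re z))"

lemma weakly_holomorphic_sum_form:
  assumes "\<And>u. u \<in> ubasis \<Longrightarrow> F u holomorphic_on S" "\<And>u. bounded_linear_on (ops B) (M u)"
    and "S \<subseteq> resolvent_region"
  shows "weakly_holomorphic_on S (sum_form_re F M) (sum_form_im F M)"
  unfolding sum_form_re_def[abs_def] sum_form_im_def[abs_def] using assms
  by (intro weakly_holomorphic_on_sum weakly_holomorphic_on_mult
      weakly_holomorphic_on_subset[OF weakly_holomorphic_resolvent]) auto

text \<open>
  \<open>Q\<close> is invariant under conjugation, so \<open>res_re\<close> is even and \<open>res_im\<close> odd in the imaginary part, like the
  components of \<open>F\<close>.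
\<close>

lemma sum_form_cnj:
  assumes F: "\<And>u. u \<in> ubasis \<Longrightarrow> F u (cnj z) = cnj (F u z)"
    and M: "\<And>u. bounded_linear_on (ops B) (M u)" and z: "z \<in> resolvent_region"
  shows "sum_form_re F M (cnj z) = sum_form_re F M z" "sum_form_im F M (cnj z) = - sum_form_im F M z"
proof -
  have neg: "M u (- res_im z) = - M u (res_im z)" for u
  proof -
    have "M u ((- 1) *\<^sub>R res_im z) = (- 1) *\<^sub>R M u (res_im z)"
      using M[of u] res_in_ops(2)[OF z] unfolding bounded_linear_on_def by blast
    then show ?thesis by simp
  qed
  show "sum_form_re F M (cnj z) = sum_form_re F M z"
    unfolding sum_form_re_def by (intro sum.cong) (auto simp: F res_cnj neg)
  show "sum_form_im F M (cnj z) = - sum_form_im F M z"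
    unfolding sum_form_im_def sum_negf[symmetric] by (intro sum.cong) (auto simp: F res_cnj neg)
qed

end


section \<open>Independence of the domain and of the imaginary unit\<close>

text \<open>
  The common shape of the left and the right integrand. \<open>M u\<close> multiplies an operator by the basis element \<open>u\<close>
  and \<open>N J u\<close> by \<open>J u\<close> (by \<open>u J\<close> on the other side). The number \<open>w u\<close> is the complex coordinate of \<open>ds\<^sub>J\<close> times
  that of the component \<open>F u\<close> of the function. With \<open>R = res_re + \<i> res_im\<close>, the two summands are the real part of
  \<open>w u * M u R\<close> and the imaginary part of \<open>w u * N J u R\<close>.
\<close>

locale slice_calculus_integrand = operator_in_algebra lact ract B A
  for lact :: "'f::weak_cone_algebra \<Rightarrow> 'y::banach \<Rightarrow> 'y"
    and ract :: "'y \<Rightarrow> 'f \<Rightarrow> 'y"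
    and B :: "('f, 'y \<Rightarrow>\<^sub>L 'y) op_structure"
    and A :: "'y \<Rightarrow>\<^sub>L 'y" +
  fixes V :: "(real \<times> real) set"
    and F :: "'f \<Rightarrow> complex \<Rightarrow> complex"
    and M :: "'f \<Rightarrow> ('y \<Rightarrow>\<^sub>L 'y) \<Rightarrow> ('y \<Rightarrow>\<^sub>L 'y)"
    and N :: "'f \<Rightarrow> 'f \<Rightarrow> ('y \<Rightarrow>\<^sub>L 'y) \<Rightarrow> ('y \<Rightarrow>\<^sub>L 'y)"
    and G :: "'f \<Rightarrow> (real \<Rightarrow> complex) \<Rightarrow> real \<Rightarrow> ('y \<Rightarrow>\<^sub>L 'y)"
  assumes V: "axial_base V"
    and F_holomorphic: "u \<in> ubasis \<Longrightarrow> F u holomorphic_on base_region V"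
    and F_cnj: "u \<in> ubasis \<Longrightarrow> z \<in> base_region V \<Longrightarrow> F u (cnj z) = cnj (F u z)"
    and M_bounded: "bounded_linear_on (ops B) (M u)"
    and N_bounded: "bounded_linear_on (ops B) (N J u)"
    and M_ops: "T \<in> ops B \<Longrightarrow> M u T \<in> ops B"
    and N_ops: "T \<in> ops B \<Longrightarrow> N J u T \<in> ops B"
    and G_eq: "\<lbrakk>J \<in> imag_units; \<gamma> t \<in> base_region V; \<gamma> t \<in> resolvent_region;
        \<And>u. w u = - \<i> * vector_derivative \<gamma> (at t within {0..1}) * F u (\<gamma> t)\<rbrakk>
      \<Longrightarrow> G J \<gamma> t = (\<Sum>u\<in>ubasis.
            (Re (w u) *\<^sub>R M u (res_re (\<gamma> t)) - Im (w u) *\<^sub>R M u (res_im (\<gamma> t)))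
          + (Im (w u) *\<^sub>R N J u (res_re (\<gamma> t)) + Re (w u) *\<^sub>R N J u (res_im (\<gamma> t))))"
begin

text \<open>
  The two components of the integrand, as real parts of holomorphic forms. The factor \<open>- \<i>\<close> in the first comes
  from \<open>ds\<^sub>J = ds (- J)\<close>. The second is an imaginary part, and \<open>Im w = Re (- \<i> w)\<close> contributes another \<open>- \<i>\<close>,
  so its factor \<open>- 1\<close> is real and the form keeps its symmetry under conjugation.
\<close>

definition "free_re = sum_form_re (\<lambda>u z. - \<i> * F u z) M"
definition "free_im = sum_form_im (\<lambda>u z. - \<i> * F u z) M"
definition "unit_re J = sum_form_re (\<lambda>u z. - F u z) (N J)"
definition "unit_im J = sum_form_im (\<lambda>u z. - F u z) (N J)"

lemma weakly_holomorphic_free: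
  assumes "S \<subseteq> base_region V" "S \<subseteq> resolvent_region"
  shows "weakly_holomorphic_on S free_re free_im"
  unfolding free_re_def free_im_def using assms
  by (intro weakly_holomorphic_sum_form holomorphic_intros M_bounded)
    (auto intro: holomorphic_on_subset F_holomorphic)

lemma weakly_holomorphic_unit:
  assumes "S \<subseteq> base_region V" "S \<subseteq> resolvent_region"
  shows "weakly_holomorphic_on S (unit_re J) (unit_im J)"
  unfolding unit_re_def unit_im_def using assms
  by (intro weakly_holomorphic_sum_form holomorphic_intros N_bounded)
    (auto intro: holomorphic_on_subset F_holomorphic)

lemma unit_form_cnj:
  assumes "z \<in> base_region V" "z \<in> resolvent_region"
  shows "unit_re J (cnj z) = unit_re J z" "unit_im J (cnj z) = - unit_im J z"
  unfolding unit_re_def unit_im_def using assms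
  by (intro sum_form_cnj N_bounded; simp add: F_cnj)+

lemma integrand_eq_forms:
  assumes "J \<in> imag_units" "\<gamma> t \<in> base_region V" "\<gamma> t \<in> resolvent_region"
  shows "G J \<gamma> t = form_on_path free_re free_im \<gamma> t + form_on_path (unit_re J) (unit_im J) \<gamma> t"
proof -
  let ?d = "vector_derivative \<gamma> (at t within {0..1})"
  show ?thesis
    unfolding G_eq[of J \<gamma> t "\<lambda>u. - \<i> * ?d * F u (\<gamma> t)", OF assms refl] form_on_path_def real_form_def free_re_def free_im_def
      unit_re_def unit_im_def sum_form_re_def sum_form_im_def scaleR_sum_right
      sum_subtractf[symmetric] sum.distrib[symmetric]
    by (intro sum.cong refl) (simp add: algebra_simps)
qed

lemma integrand_in_ops:
  assumes "J \<in> imag_units" "\<gamma> t \<in> base_region V" "\<gamma> t \<in> resolvent_region"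
  shows "G J \<gamma> t \<in> ops B"
  unfolding G_eq[of J \<gamma> t "\<lambda>u. - \<i> * vector_derivative \<gamma> (at t within {0..1}) * F u (\<gamma> t)",
      OF assms refl] using res_in_ops[OF assms(3)]
  by (intro subspace_sum[OF subspace_ops] ops_intros M_ops N_ops)

lemma positively_oriented_boundary_paths:
  assumes W: "open W" "closure W \<subseteq> base_region V" "- resolvent_region \<subseteq> W"
    and "positively_oriented_boundary \<gamma>s W" and \<gamma>: "\<gamma> \<in> set \<gamma>s"
  shows "valid_path \<gamma>" "pathfinish \<gamma> = pathstart \<gamma>" "path_image \<gamma> \<subseteq> closure W"
    "path_image \<gamma> \<subseteq> base_region V \<inter> resolvent_region"
proof -
  have bd: "jordan_boundary \<gamma>s W" using assms(4) by (simp add: positively_oriented_boundary_def)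
  then show "valid_path \<gamma>" "pathfinish \<gamma> = pathstart \<gamma>"
    using \<gamma> by (auto simp: jordan_boundary_def)
  have "path_image \<gamma> \<subseteq> frontier W" using bd \<gamma> by (auto simp: jordan_boundary_def)
  moreover have "frontier W = closure W - W" using W(1) by (simp add: frontier_def interior_open)
  ultimately show "path_image \<gamma> \<subseteq> closure W" "path_image \<gamma> \<subseteq> base_region V \<inter> resolvent_region"
    using W by blast+
qed

text \<open>
  The form that contains \<open>J\<close> integrates to 0 over the boundary of a domain that is symmetric under conjugation, so
  only the form without \<open>J\<close> contributes.
\<close>

lemma integrable_and_integral_eq:
  assumes J: "J \<in> imag_units" and W: "open W" "bounded W" "\<And>z. cnj z \<in> W \<longleftrightarrow> z \<in> W"
    "closure W \<subseteq> base_region V" "- resolvent_region \<subseteq> W" "positively_oriented_boundary \<gamma>s W"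
  shows "\<forall>\<gamma>\<in>set \<gamma>s. G J \<gamma> integrable_on {0..1} \<and> integral {0..1} (G J \<gamma>) \<in> ops B"
    and "(\<Sum>\<gamma>\<leftarrow>\<gamma>s. integral {0..1} (G J \<gamma>)) = (\<Sum>\<gamma>\<leftarrow>\<gamma>s. integral {0..1} (form_on_path free_re free_im \<gamma>))"
proof -
  \<comment> \<open>The ball only makes the region bounded: points outside it are outside \<open>closure W\<close>, where the total winding number is 0.\<close>
  obtain r where r: "closure W \<subseteq> ball 0 r"
    using bounded_subset_ballD[OF bounded_closure[OF W(2)], of 0] by blast
  define S where "S = base_region V \<inter> resolvent_region \<inter> ball 0 r"
  have S: "open S" "bounded S" "S \<subseteq> base_region V" "S \<subseteq> resolvent_region"
    unfolding S_def by (auto intro!: open_Int open_base_region V open_resolvent_region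
        bounded_subset[OF bounded_ball])
  note paths = positively_oriented_boundary_paths[OF W(1,4,5,6)]
  have \<gamma>s: "\<forall>\<gamma>\<in>set \<gamma>s. valid_path \<gamma> \<and> pathfinish \<gamma> = pathstart \<gamma> \<and> path_image \<gamma> \<subseteq> S"
    using paths r unfolding S_def by blast
  note free = weakly_holomorphic_free[OF S(3,4)] and unit = weakly_holomorphic_unit[OF S(3,4), of J]
  have int: "form_on_path free_re free_im \<gamma> integrable_on {0..1}"
      "form_on_path (unit_re J) (unit_im J) \<gamma> integrable_on {0..1}"
      if "\<gamma> \<in> set \<gamma>s" for \<gamma>
    using \<gamma>s that form_on_path_integrable[OF S(1) free] form_on_path_integrable[OF S(1) unit]
    by auto
  have on_path: "\<gamma> t \<in> base_region V \<and> \<gamma> t \<in> resolvent_region"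
    if "\<gamma> \<in> set \<gamma>s" "t \<in> {0..1}" for \<gamma> t
  proof -
    have "\<gamma> t \<in> path_image \<gamma>" using that(2) by (simp add: path_image_def)
    then show ?thesis using \<gamma>s that(1) S(3,4) by blast
  qed
  have eq: "G J \<gamma> t = form_on_path free_re free_im \<gamma> t + form_on_path (unit_re J) (unit_im J) \<gamma> t"
    if "\<gamma> \<in> set \<gamma>s" "t \<in> {0..1}" for \<gamma> t
    using integrand_eq_forms[OF J] on_path[OF that] by blast
  have integrable: "G J \<gamma> integrable_on {0..1}" if "\<gamma> \<in> set \<gamma>s" for \<gamma>
    by (rule iffD2[OF integrable_cong[OF eq[OF that]] integrable_add[OF int[OF that]]])
  then show "\<forall>\<gamma>\<in>set \<gamma>s. G J \<gamma> integrable_on {0..1} \<and> integral {0..1} (G J \<gamma>) \<in> ops B"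
    using integral_in_ops integrand_in_ops[OF J] on_path by metis
  have "integral {0..1} (G J \<gamma>) = integral {0..1} (form_on_path free_re free_im \<gamma>)
      + integral {0..1} (form_on_path (unit_re J) (unit_im J) \<gamma>)" if "\<gamma> \<in> set \<gamma>s" for \<gamma>
    by (rule trans[OF integral_cong[OF eq[OF that]] integral_add[OF int[OF that]]])
  then have "(\<Sum>\<gamma>\<leftarrow>\<gamma>s. integral {0..1} (G J \<gamma>))
      = (\<Sum>\<gamma>\<leftarrow>\<gamma>s. integral {0..1} (form_on_path free_re free_im \<gamma>))
        + (\<Sum>\<gamma>\<leftarrow>\<gamma>s. integral {0..1} (form_on_path (unit_re J) (unit_im J) \<gamma>))"
    unfolding sum_list_addf[symmetric] by (intro arg_cong[where f = sum_list] map_cong refl)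
  moreover have "(\<Sum>\<gamma>\<leftarrow>\<gamma>s. integral {0..1} (form_on_path (unit_re J) (unit_im J) \<gamma>)) = 0"
  proof (rule integral_real_symmetric_form_eq_0[OF S(1,2) _ unit _ \<gamma>s])
    show "cnj z \<in> S" if "z \<in> S" for z
      using that by (simp add: S_def cnj_base_region[OF V] resolvent_region_cnj)
    show "unit_re J (cnj z) = unit_re J z \<and> unit_im J (cnj z) = - unit_im J z" if "z \<in> S" for z
      using that S(3,4) unit_form_cnj by blast
    fix w assume "w \<notin> S"
    then have "w \<in> W \<or> w \<notin> closure W" using W(4,5) r by (auto simp: S_def)
    moreover have "cnj w \<notin> closure W" if "w \<notin> closure W"
    proof
      assume "cnj w \<in> closure W"
      moreover have "cnj ` W = W"
      proof -
        have "z \<in> cnj ` W" if "z \<in> W" for z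
          using that W(3)[of z] by (intro image_eqI[of z cnj "cnj z"]) auto
        then show ?thesis using W(3) by auto
      qed
      ultimately have "cnj (cnj w) \<in> closure W"
        using image_closure_subset[of W cnj "closure W"] closure_subset[of W]
        by (auto simp: image_subset_iff intro!: continuous_intros)
      with that show False by simp
    qed
    ultimately show "(\<Sum>\<gamma>\<leftarrow>\<gamma>s. winding_number \<gamma> (cnj w)) = cnj (\<Sum>\<gamma>\<leftarrow>\<gamma>s. winding_number \<gamma> w)"
      using W(6) W(3)[of w] by (auto simp: positively_oriented_boundary_def)
  qed
  ultimately show "(\<Sum>\<gamma>\<leftarrow>\<gamma>s. integral {0..1} (G J \<gamma>))
      = (\<Sum>\<gamma>\<leftarrow>\<gamma>s. integral {0..1} (form_on_path free_re free_im \<gamma>))" by simp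
qed

lemma free_integral_independent:
  assumes W: "open W" "bounded W" "closure W \<subseteq> base_region V" "- resolvent_region \<subseteq> W"
    "positively_oriented_boundary \<gamma>s W"
    and W': "open W'" "bounded W'" "closure W' \<subseteq> base_region V" "- resolvent_region \<subseteq> W'"
    "positively_oriented_boundary \<eta>s W'"
  shows "(\<Sum>\<gamma>\<leftarrow>\<gamma>s. integral {0..1} (form_on_path free_re free_im \<gamma>))
    = (\<Sum>\<eta>\<leftarrow>\<eta>s. integral {0..1} (form_on_path free_re free_im \<eta>))"
proof -
  \<comment> \<open>One ball for both domains; the total winding numbers of both boundaries vanish outside it.\<close>
  have "bounded (closure W \<union> closure W')" using W(2) W'(2) by (simp add: bounded_closure)
  then obtain r where r: "closure W \<union> closure W' \<subseteq> ball 0 r"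
    using bounded_subset_ballD[of _ 0] by blast
  define S where "S = base_region V \<inter> resolvent_region \<inter> ball 0 r"
  have S: "open S" "bounded S" "S \<subseteq> base_region V" "S \<subseteq> resolvent_region"
    unfolding S_def by (auto intro!: open_Int open_base_region V open_resolvent_region
        bounded_subset[OF bounded_ball])
  show ?thesis
  proof (rule integral_form_homologous_cycles[OF S(1,2) weakly_holomorphic_free[OF S(3,4)]])
    show "\<forall>\<gamma>\<in>set \<gamma>s. valid_path \<gamma> \<and> pathfinish \<gamma> = pathstart \<gamma> \<and> path_image \<gamma> \<subseteq> S"
      using positively_oriented_boundary_paths[OF W(1,3,4,5)] r unfolding S_def by blast
    show "\<forall>\<gamma>\<in>set \<eta>s. valid_path \<gamma> \<and> pathfinish \<gamma> = pathstart \<gamma> \<and> path_image \<gamma> \<subseteq> S"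
      using positively_oriented_boundary_paths[OF W'(1,3,4,5)] r unfolding S_def by blast
    fix w assume "w \<notin> S"
    then have "w \<in> W \<and> w \<in> W' \<or> w \<notin> closure W \<and> w \<notin> closure W'"
      using W(3,4) W'(3,4) r by (auto simp: S_def)
    then show "(\<Sum>\<gamma>\<leftarrow>\<gamma>s. winding_number \<gamma> w) = (\<Sum>\<eta>\<leftarrow>\<eta>s. winding_number \<eta> w)"
      using W(5) W'(5) by (auto simp: positively_oriented_boundary_def)
  qed
qed

text \<open>
  Any one admissible choice supplies the operator \<open>T\<close>; if there is none, every operator will do.
\<close>

theorem integral_independent_of_choices:
  "\<exists>T\<in>ops B. \<forall>J U \<gamma>s. admissible_choice (S_spectrum B A) (axial_set V) J U \<gamma>s \<longrightarrow>
     (\<forall>\<gamma>\<in>set \<gamma>s. G J \<gamma> integrable_on {0..1}) \<and>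
     (1 / (2 * pi)) *\<^sub>R (\<Sum>\<gamma>\<leftarrow>\<gamma>s. integral {0..1} (G J \<gamma>)) = T"
proof (cases "\<exists>J U \<gamma>s. admissible_choice (S_spectrum B A) (axial_set V) J U \<gamma>s")
  case True
  have slice: "\<exists>W. J \<in> imag_units \<and> open W \<and> bounded W \<and> (\<forall>z. cnj z \<in> W \<longleftrightarrow> z \<in> W) \<and>
      closure W \<subseteq> base_region V \<and> - resolvent_region \<subseteq> W \<and> positively_oriented_boundary \<gamma>s W"
    if adm: "admissible_choice (S_spectrum B A) (axial_set V) J U \<gamma>s" for J U \<gamma>s
  proof -
    have J: "J \<in> imag_units" using adm by (simp add: admissible_choice_def)
    show ?thesis
      using admissible_choice_slice[OF adm V] unfolding slice_of_S_spectrum[OF J]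
      using J by metis
  qed
  from True obtain J0 U0 \<gamma>s0 where "admissible_choice (S_spectrum B A) (axial_set V) J0 U0 \<gamma>s0"
    by blast
  from slice[OF this] obtain W0 where W0: "J0 \<in> imag_units" "open W0" "bounded W0"
      "\<And>z. cnj z \<in> W0 \<longleftrightarrow> z \<in> W0" "closure W0 \<subseteq> base_region V" "- resolvent_region \<subseteq> W0"
      "positively_oriented_boundary \<gamma>s0 W0"
    by blast
  let ?T = "\<Sum>\<gamma>\<leftarrow>\<gamma>s0. integral {0..1} (G J0 \<gamma>)"
  show ?thesis
  proof (intro bexI[of _ "(1 / (2 * pi)) *\<^sub>R ?T"] allI impI)
    fix J U \<gamma>s assume "admissible_choice (S_spectrum B A) (axial_set V) J U \<gamma>s"
    from slice[OF this] obtain W where W: "J \<in> imag_units" "open W" "bounded W" "\<And>z. cnj z \<in> W \<longleftrightarrow> z \<in> W"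
        "closure W \<subseteq> base_region V" "- resolvent_region \<subseteq> W" "positively_oriented_boundary \<gamma>s W"
      by blast
    have "(\<Sum>\<gamma>\<leftarrow>\<gamma>s. integral {0..1} (G J \<gamma>)) = ?T"
      unfolding integrable_and_integral_eq(2)[OF W] integrable_and_integral_eq(2)[OF W0]
      by (rule free_integral_independent[OF W(2,3,5,6,7) W0(2,3,5,6,7)])
    then show "(\<forall>\<gamma>\<in>set \<gamma>s. G J \<gamma> integrable_on {0..1}) \<and>
        (1 / (2 * pi)) *\<^sub>R (\<Sum>\<gamma>\<leftarrow>\<gamma>s. integral {0..1} (G J \<gamma>)) = (1 / (2 * pi)) *\<^sub>R ?T"
      using integrable_and_integral_eq(1)[OF W] by simp
  next
    have "(\<Sum>\<gamma>\<leftarrow>\<gamma>s. integral {0..1} (G J0 \<gamma>)) \<in> ops B" if "set \<gamma>s \<subseteq> set \<gamma>s0" for \<gamma>s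
      using that integrable_and_integral_eq(1)[OF W0]
      by (induction \<gamma>s) (auto intro: ops_add subspace_0[OF subspace_ops])
    then show "(1 / (2 * pi)) *\<^sub>R ?T \<in> ops B" by (intro ops_scale) simp
  qed
qed (use subspace_0[OF subspace_ops] in blast)

end


section \<open>The left and the right functional calculus\<close>

lemma coordinate_expansion:
  obtains \<phi> :: "'f \<Rightarrow> 'f::weak_cone_algebra \<Rightarrow> real"
  where "\<And>u. bounded_linear (\<phi> u)" "\<And>x. x = (\<Sum>u\<in>ubasis. \<phi> u x *\<^sub>R u)"
  using bounded_coordinate_functionals[OF finite_ubasis] span_ubasis by (metis UNIV_I)

lemma in_slice_i: "in_slice J \<i> = J"
  by (simp add: in_slice_eq)

lemma in_slice_uminus_i: "in_slice J (- \<i>) = - J"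
  by (simp add: in_slice_eq)

lemma ds_J_eq:
  assumes "J \<in> imag_units"
  shows "ds_J J \<gamma> t = in_slice J (- \<i> * vector_derivative \<gamma> (at t within {0..1}))"
  unfolding ds_J_def mult.commute[of "- \<i>"] in_slice_mult[OF assms] in_slice_uminus_i ..

context operator_in_algebra
begin

lemma linear_rscale: "T \<in> ops B \<Longrightarrow> linear (op_rscale B T)"
  by (intro linearI) (auto simp: rscale_add_right rscale_scaleR)

lemma linear_lscale: "T \<in> ops B \<Longrightarrow> linear (\<lambda>a. op_lscale B a T)"
  by (intro linearI) (auto simp: lscale_add_left lscale_scaleR)

text \<open>
  On each slice the complex numbers act through the ring homomorphism \<open>in_slice J\<close>. In
  \<open>(R\<^sub>1 + R\<^sub>2 J) (\<Sum>\<^sub>u w\<^sub>u u)\<close> the unit in the resolvent is absorbed into the coordinates, as multiplication by \<open>\<i>\<close>.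
\<close>

lemma L_integrand_expansion:
  assumes J: "J \<in> imag_units" and z: "\<gamma> t \<in> resolvent_region"
    and f: "f (in_slice J (\<gamma> t)) = (\<Sum>u\<in>ubasis. in_slice J (F u (\<gamma> t)) * u)"
    and w: "\<And>u. w u = - \<i> * vector_derivative \<gamma> (at t within {0..1}) * F u (\<gamma> t)"
  shows "L_integrand B A f J \<gamma> t = (\<Sum>u\<in>ubasis.
            (Re (w u) *\<^sub>R op_rscale B (res_re (\<gamma> t)) u - Im (w u) *\<^sub>R op_rscale B (res_im (\<gamma> t)) u)
          + (Im (w u) *\<^sub>R op_rscale B (res_re (\<gamma> t)) (J * u) + Re (w u) *\<^sub>R op_rscale B (res_im (\<gamma> t)) (J * u)))"
proof -
  note r = res_in_ops[OF z]
  have X: "ds_J J \<gamma> t * f (in_slice J (\<gamma> t)) = (\<Sum>u\<in>ubasis. in_slice J (w u) * u)"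
    unfolding w in_slice_mult[OF J, of _ "F _ _"]
    unfolding f ds_J_eq[OF J] sum_distrib_left mult.assoc[of "in_slice J _"] ..
  \<comment> \<open>Stated for arbitrary coordinates: it is applied to \<open>w\<close> and to \<open>\<i> w\<close>.\<close>
  have re: "op_rscale B T (\<Sum>u\<in>ubasis. in_slice J (w u) * u)
      = (\<Sum>u\<in>ubasis. Re (w u) *\<^sub>R op_rscale B T u + Im (w u) *\<^sub>R op_rscale B T (J * u))"
    if "T \<in> ops B" for T w
    using linear_rscale[OF that]
    by (simp add: linear_sum in_slice_eq distrib_right linear_add linear_scale)
  have "J * (\<Sum>u\<in>ubasis. in_slice J (w u) * u) = (\<Sum>u\<in>ubasis. in_slice J (\<i> * w u) * u)"
    by (simp only: sum_distrib_left in_slice_mult[OF J] in_slice_i mult.assoc)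
  then have "L_integrand B A f J \<gamma> t
      = op_rscale B (res_re (\<gamma> t)) (\<Sum>u\<in>ubasis. in_slice J (w u) * u)
        + op_rscale B (res_im (\<gamma> t)) (\<Sum>u\<in>ubasis. in_slice J (\<i> * w u) * u)"
    using r by (simp add: L_integrand_def X S_resolvent_L_in_slice[OF J z] rscale_add_left
        rscale_closed rscale_mult[symmetric])
  then show ?thesis
    unfolding re[OF r(1)] re[OF r(2)] sum.distrib[symmetric]
    by (simp only:) (intro sum.cong refl, simp add: algebra_simps)
qed

lemma R_integrand_expansion:
  assumes J: "J \<in> imag_units" and z: "\<gamma> t \<in> resolvent_region"
    and f: "f (in_slice J (\<gamma> t)) = (\<Sum>u\<in>ubasis. u * in_slice J (F u (\<gamma> t)))"
    and w: "\<And>u. w u = - \<i> * vector_derivative \<gamma> (at t within {0..1}) * F u (\<gamma> t)"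
  shows "R_integrand B A f J \<gamma> t = (\<Sum>u\<in>ubasis.
            (Re (w u) *\<^sub>R op_lscale B u (res_re (\<gamma> t)) - Im (w u) *\<^sub>R op_lscale B u (res_im (\<gamma> t)))
          + (Im (w u) *\<^sub>R op_lscale B (u * J) (res_re (\<gamma> t)) + Re (w u) *\<^sub>R op_lscale B (u * J) (res_im (\<gamma> t))))"
proof -
  note r = res_in_ops[OF z]
  have w': "w u = F u (\<gamma> t) * (- \<i> * vector_derivative \<gamma> (at t within {0..1}))" for u
    by (simp add: w)
  have X: "f (in_slice J (\<gamma> t)) * ds_J J \<gamma> t = (\<Sum>u\<in>ubasis. u * in_slice J (w u))"
    unfolding w' in_slice_mult[OF J, of "F _ _"] f ds_J_eq[OF J] sum_distrib_right mult.assoc ..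
  \<comment> \<open>Stated for arbitrary coordinates: it is applied to \<open>w\<close> and to \<open>w \<i>\<close>.\<close>
  have re: "op_lscale B (\<Sum>u\<in>ubasis. u * in_slice J (w u)) T
      = (\<Sum>u\<in>ubasis. Re (w u) *\<^sub>R op_lscale B u T + Im (w u) *\<^sub>R op_lscale B (u * J) T)"
    if "T \<in> ops B" for T w
    using linear_lscale[OF that]
    by (simp add: linear_sum[of "\<lambda>a. op_lscale B a T"] in_slice_eq distrib_left
        lscale_add_left lscale_scaleR that)
  have "(\<Sum>u\<in>ubasis. u * in_slice J (w u)) * J = (\<Sum>u\<in>ubasis. u * in_slice J (w u * \<i>))"
    by (simp only: sum_distrib_right in_slice_mult[OF J] in_slice_i mult.assoc)
  then have "R_integrand B A f J \<gamma> t
      = op_lscale B (\<Sum>u\<in>ubasis. u * in_slice J (w u)) (res_re (\<gamma> t))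
        + op_lscale B (\<Sum>u\<in>ubasis. u * in_slice J (w u * \<i>)) (res_im (\<gamma> t))"
    using r by (simp add: R_integrand_def X S_resolvent_R_in_slice[OF J z] lscale_add_right
        lscale_closed lscale_mult[symmetric])
  then show ?thesis
    unfolding re[OF r(1)] re[OF r(2)] sum.distrib[symmetric]
    by (simp only:) (intro sum.cong refl, simp add: algebra_simps)
qed

lemma S_calculus_L_independent:
  assumes "left_slice_hyperholomorphic_on D f"
  shows "\<exists>T\<in>ops B. \<forall>J U \<gamma>s. admissible_choice (S_spectrum B A) D J U \<gamma>s \<longrightarrow>
     (\<forall>\<gamma>\<in>set \<gamma>s. L_integrand B A f J \<gamma> integrable_on {0..1}) \<and> S_calculus_L B A f J \<gamma>s = T"
proof -
  obtain V f0 f1 where base: "axial_base V" and D: "D = axial_set V" and f01: "slice_pair V f0 f1"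
    and f: "\<And>J u v. J \<in> imag_units \<Longrightarrow> (u, v) \<in> V \<Longrightarrow> f (slice_point J u v) = f0 (u, v) + J * f1 (u, v)"
    using assms unfolding left_slice_hyperholomorphic_on_def by blast
  obtain \<phi> :: "'f \<Rightarrow> 'f \<Rightarrow> real" where \<phi>: "\<And>u. bounded_linear (\<phi> u)"
      "\<And>x. x = (\<Sum>u\<in>ubasis. \<phi> u x *\<^sub>R u)"
    using coordinate_expansion by blast
  define F where "F u z = Complex (\<phi> u (f0 (Re z, Im z))) (\<phi> u (f1 (Re z, Im z)))" for u z
  interpret slice_calculus_integrand lact ract B A V F "\<lambda>u T. op_rscale B T u"
    "\<lambda>J u T. op_rscale B T (J * u)" "L_integrand B A f"
  proof
    show "F u holomorphic_on base_region V" for u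
      unfolding F_def by (rule slice_pair_holomorphic[OF base f01 \<phi>(1)])
    show "F u (cnj z) = cnj (F u z)" if "z \<in> base_region V" for u z
      using f01 that bounded_linear.linear[OF \<phi>(1)]
      by (simp add: F_def slice_pair_def base_region_def complex_eq_iff linear_neg)
    fix J :: 'f and \<gamma> t and w :: "'f \<Rightarrow> complex"
    assume J: "J \<in> imag_units" and z: "\<gamma> t \<in> base_region V" "\<gamma> t \<in> resolvent_region"
      and w: "\<And>u. w u = - \<i> * vector_derivative \<gamma> (at t within {0..1}) * F u (\<gamma> t)"
    have "f (in_slice J (\<gamma> t)) = f0 (Re (\<gamma> t), Im (\<gamma> t)) + J * f1 (Re (\<gamma> t), Im (\<gamma> t))"
      using f[OF J] z(1) by (simp add: in_slice_def base_region_def)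
    also have "\<dots> = (\<Sum>u\<in>ubasis. \<phi> u (f0 (Re (\<gamma> t), Im (\<gamma> t))) *\<^sub>R u)
        + J * (\<Sum>u\<in>ubasis. \<phi> u (f1 (Re (\<gamma> t), Im (\<gamma> t))) *\<^sub>R u)"
      unfolding \<phi>(2)[symmetric] ..
    also have "\<dots> = (\<Sum>u\<in>ubasis. in_slice J (F u (\<gamma> t)) * u)"
      by (simp add: F_def in_slice_eq distrib_right sum.distrib sum_distrib_left)
    finally show "L_integrand B A f J \<gamma> t = (\<Sum>u\<in>ubasis.
            (Re (w u) *\<^sub>R op_rscale B (res_re (\<gamma> t)) u - Im (w u) *\<^sub>R op_rscale B (res_im (\<gamma> t)) u)
          + (Im (w u) *\<^sub>R op_rscale B (res_re (\<gamma> t)) (J * u) + Re (w u) *\<^sub>R op_rscale B (res_im (\<gamma> t)) (J * u)))"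
      by (rule L_integrand_expansion[of J \<gamma> t f F w, OF J z(2) _ w])
  qed (auto intro: base bounded_linear_on_rscale rscale_closed)
  show ?thesis
    unfolding S_calculus_L_def D by (rule integral_independent_of_choices)
qed

lemma S_calculus_R_independent:
  assumes "right_slice_hyperholomorphic_on D f"
  shows "\<exists>T\<in>ops B. \<forall>J U \<gamma>s. admissible_choice (S_spectrum B A) D J U \<gamma>s \<longrightarrow>
     (\<forall>\<gamma>\<in>set \<gamma>s. R_integrand B A f J \<gamma> integrable_on {0..1}) \<and> S_calculus_R B A f J \<gamma>s = T"
proof -
  obtain V f0 f1 where base: "axial_base V" and D: "D = axial_set V" and f01: "slice_pair V f0 f1"
    and f: "\<And>J u v. J \<in> imag_units \<Longrightarrow> (u, v) \<in> V \<Longrightarrow> f (slice_point J u v) = f0 (u, v) + f1 (u, v) * J"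
    using assms unfolding right_slice_hyperholomorphic_on_def by blast
  obtain \<phi> :: "'f \<Rightarrow> 'f \<Rightarrow> real" where \<phi>: "\<And>u. bounded_linear (\<phi> u)"
      "\<And>x. x = (\<Sum>u\<in>ubasis. \<phi> u x *\<^sub>R u)"
    using coordinate_expansion by blast
  define F where "F u z = Complex (\<phi> u (f0 (Re z, Im z))) (\<phi> u (f1 (Re z, Im z)))" for u z
  interpret slice_calculus_integrand lact ract B A V F "\<lambda>u T. op_lscale B u T"
    "\<lambda>J u T. op_lscale B (u * J) T" "R_integrand B A f"
  proof
    show "F u holomorphic_on base_region V" for u
      unfolding F_def by (rule slice_pair_holomorphic[OF base f01 \<phi>(1)])
    show "F u (cnj z) = cnj (F u z)" if "z \<in> base_region V" for u z
      using f01 that bounded_linear.linear[OF \<phi>(1)]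
      by (simp add: F_def slice_pair_def base_region_def complex_eq_iff linear_neg)
    fix J :: 'f and \<gamma> t and w :: "'f \<Rightarrow> complex"
    assume J: "J \<in> imag_units" and z: "\<gamma> t \<in> base_region V" "\<gamma> t \<in> resolvent_region"
      and w: "\<And>u. w u = - \<i> * vector_derivative \<gamma> (at t within {0..1}) * F u (\<gamma> t)"
    have "f (in_slice J (\<gamma> t)) = f0 (Re (\<gamma> t), Im (\<gamma> t)) + f1 (Re (\<gamma> t), Im (\<gamma> t)) * J"
      using f[OF J] z(1) by (simp add: in_slice_def base_region_def)
    also have "\<dots> = (\<Sum>u\<in>ubasis. \<phi> u (f0 (Re (\<gamma> t), Im (\<gamma> t))) *\<^sub>R u)
        + (\<Sum>u\<in>ubasis. \<phi> u (f1 (Re (\<gamma> t), Im (\<gamma> t))) *\<^sub>R u) * J"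
      unfolding \<phi>(2)[symmetric] ..
    also have "\<dots> = (\<Sum>u\<in>ubasis. u * in_slice J (F u (\<gamma> t)))"
      by (simp add: F_def in_slice_eq distrib_left sum.distrib sum_distrib_right)
    finally show "R_integrand B A f J \<gamma> t = (\<Sum>u\<in>ubasis.
            (Re (w u) *\<^sub>R op_lscale B u (res_re (\<gamma> t)) - Im (w u) *\<^sub>R op_lscale B u (res_im (\<gamma> t)))
          + (Im (w u) *\<^sub>R op_lscale B (u * J) (res_re (\<gamma> t)) + Re (w u) *\<^sub>R op_lscale B (u * J) (res_im (\<gamma> t))))"
      by (rule R_integrand_expansion[of J \<gamma> t f F w, OF J z(2) _ w])
  qed (auto intro: base bounded_linear_on_lscale lscale_closed)
  show ?thesis
    unfolding S_calculus_R_def D by (rule integral_independent_of_choices)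
qed

end

theorem theorem3p22:
  fixes lact :: "'f::weak_cone_algebra \<Rightarrow> 'y::banach \<Rightarrow> 'y"
    and ract :: "'y \<Rightarrow> 'f \<Rightarrow> 'y"
    and B :: "('f, 'y \<Rightarrow>\<^sub>L 'y) op_structure"
    and A :: "'y \<Rightarrow>\<^sub>L 'y"
  assumes "operator_algebra lact ract B"
    and "A \<in> ops B"
  shows "(\<forall>D f. (D, f) \<in> SH_L (S_spectrum B A) \<longrightarrow>
           (\<exists>T\<in>ops B. \<forall>J U \<gamma>s. admissible_choice (S_spectrum B A) D J U \<gamma>s \<longrightarrow>
              (\<forall>\<gamma>\<in>set \<gamma>s. L_integrand B A f J \<gamma> integrable_on {0..1}) \<and>
              S_calculus_L B A f J \<gamma>s = T))
       \<and> (\<forall>D f. (D, f) \<in> SH_R (S_spectrum B A) \<longrightarrow>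
           (\<exists>T\<in>ops B. \<forall>J U \<gamma>s. admissible_choice (S_spectrum B A) D J U \<gamma>s \<longrightarrow>
              (\<forall>\<gamma>\<in>set \<gamma>s. R_integrand B A f J \<gamma> integrable_on {0..1}) \<and>
              S_calculus_R B A f J \<gamma>s = T))"
proof -
  interpret operator_in_algebra lact ract B A
    using assms by (intro operator_in_algebra.intro operator_in_algebra_axioms.intro)
  show ?thesis
    using S_calculus_L_independent S_calculus_R_independent by (simp add: SH_L_def SH_R_def)
qed

end
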